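(* For every stable allocation instance with real-valued quotas and capacities and every given feasible allocation $x$, there is a sequence of better response steps starting from $x$ that leads to a stable allocation, and such a sequence can be computed (and executed) in $O(|V|^2|E|)$ time.
   Context: A stable allocation instance consists of a bipartite graph $G=(V,E)$ with color classes $J$ (jobs, the active side) and $M$ (machines, the passive side), quotas $q:V\to\mathbb{R}_{\ge 0}$, edge capacities $c:E\to\mathbb{R}_{\ge 0}$, and for every vertex $v$ a strict ranking of its incident edges. An allocation is $x:E\to\mathbb{R}_{\ge0}$ with $x(e)\le c(e)$ for all $e$ and $x(v):=\sum_{e\in\delta(v)}x(e)\le q(v)$ for all $v$. An edge $jm$ blocks $x$ if (1) $x(jm)<c(jm)$; (2) $x(j)<q(j)$ or $j$ prefers $jm$ to its worst edge with positive value in $x$; (3) $x(m)<q(m)$ or $m$ prefers $jm$ to its worst edge with positive value in $x$. An allocation is stable if no edge blocks it. A better response step: a job $j$ chooses a blocking edge $jm$ and increases $x(jm)$; simultaneously $j$ and $m$ may decrease allocation only on edges that they rank worse than $jm$, such that the result is again a feasible allocation. *)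

theory Defs
  imports Complex_Main
begin

section \<open>Stable allocation instances\<close>

type_synonym 'v edge = "'v \<times> 'v"
type_synonym 'v allocation = "'v edge \<Rightarrow> real"

text \<open>An edge is a pair (job, machine).  The strict ranking of the edges incident to a vertex
  is the list of these edges, best edge first.\<close>

record 'v alloc_instance =
  jobs :: "'v set"
  machines :: "'v set"
  edges :: "'v edge set"
  quota :: "'v \<Rightarrow> real"
  capacity :: "'v edge \<Rightarrow> real"
  ranking :: "'v \<Rightarrow> 'v edge list"

definition vertices :: "'v alloc_instance \<Rightarrow> 'v set" where
  "vertices I = jobs I \<union> machines I"

definition incident :: "'v alloc_instance \<Rightarrow> 'v \<Rightarrow> 'v edge set" where
  "incident I v = {e \<in> edges I. fst e = v \<or> snd e = v}"

definition valid_instance :: "'v alloc_instance \<Rightarrow> bool" where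
  "valid_instance I \<longleftrightarrow>
     finite (jobs I) \<and> finite (machines I) \<and> jobs I \<inter> machines I = {} \<and>
     edges I \<subseteq> jobs I \<times> machines I \<and>
     (\<forall>v \<in> vertices I. 0 \<le> quota I v) \<and>
     (\<forall>e \<in> edges I. 0 \<le> capacity I e) \<and>
     (\<forall>v \<in> vertices I. distinct (ranking I v) \<and> set (ranking I v) = incident I v)"

definition prefers :: "'v alloc_instance \<Rightarrow> 'v \<Rightarrow> 'v edge \<Rightarrow> 'v edge \<Rightarrow> bool" where
  "prefers I v e f \<longleftrightarrow>
     (\<exists>i k. i < k \<and> k < length (ranking I v) \<and> ranking I v ! i = e \<and> ranking I v ! k = f)"

definition load :: "'v alloc_instance \<Rightarrow> 'v allocation \<Rightarrow> 'v \<Rightarrow> real" where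
  "load I x v = (\<Sum>e \<in> incident I v. x e)"

text \<open>Only the values of an allocation on the edges of the instance are relevant; all notions
  below ignore its values elsewhere.\<close>

definition feasible :: "'v alloc_instance \<Rightarrow> 'v allocation \<Rightarrow> bool" where
  "feasible I x \<longleftrightarrow>
     (\<forall>e \<in> edges I. 0 \<le> x e \<and> x e \<le> capacity I e) \<and>
     (\<forall>v \<in> vertices I. load I x v \<le> quota I v)"

definition worst_positive :: "'v alloc_instance \<Rightarrow> 'v allocation \<Rightarrow> 'v \<Rightarrow> 'v edge \<Rightarrow> bool" where
  "worst_positive I x v f \<longleftrightarrow>
     f \<in> incident I v \<and> 0 < x f \<and>
     (\<forall>g \<in> incident I v. 0 < x g \<longrightarrow> g = f \<or> prefers I v g f)"

definition blocks :: "'v alloc_instance \<Rightarrow> 'v allocation \<Rightarrow> 'v edge \<Rightarrow> bool" where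
  "blocks I x e \<longleftrightarrow>
     e \<in> edges I \<and> x e < capacity I e \<and>
     (\<forall>v \<in> {fst e, snd e}.
        load I x v < quota I v \<or> (\<exists>f. worst_positive I x v f \<and> prefers I v e f))"

definition stable_allocation :: "'v alloc_instance \<Rightarrow> 'v allocation \<Rightarrow> bool" where
  "stable_allocation I x \<longleftrightarrow> feasible I x \<and> (\<forall>e \<in> edges I. \<not> blocks I x e)"

section \<open>Better response dynamics\<close>

text \<open>The job \<open>fst e\<close> chooses the blocking edge \<open>e\<close>; the allocation \<open>x\<close> becomes \<open>y\<close>.\<close>

definition better_response ::
    "'v alloc_instance \<Rightarrow> 'v edge \<Rightarrow> 'v allocation \<Rightarrow> 'v allocation \<Rightarrow> bool" where
  "better_response I e x y \<longleftrightarrow>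
     blocks I x e \<and> x e < y e \<and>
     (\<forall>f \<in> edges I. f \<noteq> e \<longrightarrow>
        y f = x f \<or> (y f < x f \<and> (prefers I (fst e) e f \<or> prefers I (snd e) e f))) \<and>
     feasible I y"

text \<open>A sequence of steps lists the chosen edges together with the resulting allocations.\<close>

fun better_response_seq ::
    "'v alloc_instance \<Rightarrow> 'v allocation \<Rightarrow> ('v edge \<times> 'v allocation) list \<Rightarrow> bool" where
  "better_response_seq I x [] \<longleftrightarrow> True"
| "better_response_seq I x ((e, y) # p) \<longleftrightarrow> better_response I e x y \<and> better_response_seq I y p"

definition final_allocation ::
    "'v allocation \<Rightarrow> ('v edge \<times> 'v allocation) list \<Rightarrow> 'v allocation" where
  "final_allocation x p = last (x # map snd p)"

section \<open>A real random access machine\<close>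

text \<open>Running times refer to programs of a small imperative language over arrays of natural
  numbers and arrays of real numbers.  The only operations are indirect addressing, constants,
  addition, (truncated) subtraction and comparison on naturals, and zero, addition, subtraction
  and comparison on reals; in particular reals cannot be rounded or used as addresses.  The named
  arrays hold the input and, in \<open>Alloc\<close>, the current allocation; \<open>IAux\<close> and \<open>RAux\<close> are work
  arrays with arbitrary initial contents, scalars being kept in a single array cell.\<close>

datatype iarr = NJobs | NMachines | NEdges | JobOf | MachineOf | First | Ranked | IAux nat
datatype rarr = Quota | Capacity | Alloc | RAux nat

datatype iexp = IConst nat | IGet iarr iexp | IPlus iexp iexp | IMinus iexp iexp
datatype rexp = RZero | RGet rarr iexp | RPlus rexp rexp | RMinus rexp rexp
datatype bexp = ILess iexp iexp | RLess rexp rexp | Not bexp | And bexp bexp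

datatype com =
    Skip
  | IAssign iarr iexp iexp
  | RAssign rarr iexp rexp
  | Respond iexp
  | Seq com com
  | If bexp com com
  | While bexp com

text \<open>The \<open>step_log\<close> cannot be read by a program.  It records the better response steps executed
  so far: \<open>Respond k\<close> declares that the changes made to \<open>Alloc\<close> since the previous step
  constitute one step along the edge number \<open>k\<close>.  As these changes were written entry by entry
  at unit cost, the running time also bounds the size of an explicit list of all changes.\<close>

record state =
  imem :: "iarr \<Rightarrow> nat \<Rightarrow> nat"
  rmem :: "rarr \<Rightarrow> nat \<Rightarrow> real"
  step_log :: "(nat \<times> (nat \<Rightarrow> real)) list"

primrec ival :: "iexp \<Rightarrow> state \<Rightarrow> nat" where
  "ival (IConst n) s = n"
| "ival (IGet a i) s = imem s a (ival i s)"
| "ival (IPlus i k) s = ival i s + ival k s"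
| "ival (IMinus i k) s = ival i s - ival k s"

primrec rval :: "rexp \<Rightarrow> state \<Rightarrow> real" where
  "rval RZero s = 0"
| "rval (RGet a i) s = rmem s a (ival i s)"
| "rval (RPlus r t) s = rval r s + rval t s"
| "rval (RMinus r t) s = rval r s - rval t s"

primrec bval :: "bexp \<Rightarrow> state \<Rightarrow> bool" where
  "bval (ILess i k) s \<longleftrightarrow> ival i s < ival k s"
| "bval (RLess r t) s \<longleftrightarrow> rval r s < rval t s"
| "bval (Not b) s \<longleftrightarrow> \<not> bval b s"
| "bval (And b d) s \<longleftrightarrow> bval b s \<and> bval d s"

text \<open>\<open>runs P s t s'\<close>: started in \<open>s\<close>, the program \<open>P\<close> halts in \<open>s'\<close> after time \<open>t\<close>.
  Every assignment and every test costs one unit; the size of the expressions in a fixed program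
  is bounded, so charging for it as well would change running times by a constant factor only.\<close>

inductive runs :: "com \<Rightarrow> state \<Rightarrow> nat \<Rightarrow> state \<Rightarrow> bool" where
  Skip: "runs Skip s 1 s"
| IAssign: "runs (IAssign a i k) s 1
    (s\<lparr>imem := (imem s)(a := (imem s a)(ival i s := ival k s))\<rparr>)"
| RAssign: "runs (RAssign a i r) s 1
    (s\<lparr>rmem := (rmem s)(a := (rmem s a)(ival i s := rval r s))\<rparr>)"
| Respond: "runs (Respond k) s 1 (s\<lparr>step_log := step_log s @ [(ival k s, rmem s Alloc)]\<rparr>)"
| Seq: "runs P s t s' \<Longrightarrow> runs Q s' u s'' \<Longrightarrow> runs (Seq P Q) s (t + u) s''"
| IfTrue: "bval b s \<Longrightarrow> runs P s t s' \<Longrightarrow> runs (If b P Q) s (1 + t) s'"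
| IfFalse: "\<not> bval b s \<Longrightarrow> runs Q s t s' \<Longrightarrow> runs (If b P Q) s (1 + t) s'"
| WhileFalse: "\<not> bval b s \<Longrightarrow> runs (While b P) s 1 s"
| WhileTrue: "bval b s \<Longrightarrow> runs P s t s' \<Longrightarrow> runs (While b P) s' u s'' \<Longrightarrow>
    runs (While b P) s (1 + t + u) s''"

section \<open>Input and output of programs\<close>

text \<open>An array represents the values of an allocation along an enumeration \<open>es\<close> of the edges.\<close>

definition represents :: "'v edge list \<Rightarrow> (nat \<Rightarrow> real) \<Rightarrow> 'v allocation \<Rightarrow> bool" where
  "represents es a x \<longleftrightarrow> (\<forall>k < length es. a k = x (es ! k))"

text \<open>The jobs and then the machines are numbered along \<open>js @ ms\<close>, the edges along \<open>es\<close>.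
  Rankings are stored as consecutive segments of the array \<open>Ranked\<close> of edge numbers, the one of
  vertex number \<open>i\<close> occupying the positions from \<open>First i\<close> to just before \<open>First (i + 1)\<close>.\<close>

definition encodes ::
    "'v alloc_instance \<Rightarrow> 'v allocation \<Rightarrow> 'v list \<Rightarrow> 'v list \<Rightarrow> 'v edge list \<Rightarrow> state \<Rightarrow> bool" where
  "encodes I x js ms es s \<longleftrightarrow>
     distinct js \<and> set js = jobs I \<and>
     distinct ms \<and> set ms = machines I \<and>
     distinct es \<and> set es = edges I \<and>
     imem s NJobs 0 = length js \<and> imem s NMachines 0 = length ms \<and> imem s NEdges 0 = length es \<and>
     (\<forall>k < length es.
        imem s JobOf k < length (js @ ms) \<and> (js @ ms) ! imem s JobOf k = fst (es ! k) \<and>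
        imem s MachineOf k < length (js @ ms) \<and> (js @ ms) ! imem s MachineOf k = snd (es ! k)) \<and>
     imem s First 0 = 0 \<and>
     (\<forall>i < length (js @ ms).
        imem s First (Suc i) = imem s First i + length (ranking I ((js @ ms) ! i)) \<and>
        (\<forall>d < length (ranking I ((js @ ms) ! i)).
           imem s Ranked (imem s First i + d) < length es \<and>
           es ! imem s Ranked (imem s First i + d) = ranking I ((js @ ms) ! i) ! d)) \<and>
     (\<forall>i < length (js @ ms). rmem s Quota i = quota I ((js @ ms) ! i)) \<and>
     represents es (rmem s Capacity) (capacity I) \<and>
     represents es (rmem s Alloc) x \<and>
     step_log s = []"

definition records_seq ::
    "'v edge list \<Rightarrow> (nat \<times> (nat \<Rightarrow> real)) list \<Rightarrow> ('v edge \<times> 'v allocation) list \<Rightarrow> bool" where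
  "records_seq es l p \<longleftrightarrow>
     list_all2 (\<lambda>(k, a) (e, y). k < length es \<and> es ! k = e \<and> represents es a y) l p"

end

theory Submission
  imports Defs
begin

text \<open>An edge is acceptable if it is unsaturated and its machine does not reject it.  As long as some
  job has an acceptable edge \<open>e\<close> and a worse positive edge, raise \<open>e\<close>, empty the worst positive edge of
  the job, and empty the worst positive edge of the machine if it is worse than \<open>e\<close>.  The worst
  positive edges of the jobs only improve, so at most \<open>|E|\<close> such steps are possible, and afterwards
  every blocking edge is blocking only because its job has free quota.

  From then on run deferred acceptance: jobs with free quota propose along their best acceptable edge,
  and full machines drop their worst positive edge by the same amount.  Acceptable edges never come
  back.  While no edge is saturated or emptied, the excess moves from job to job along a fixed map, so
  it is absorbed or enters a cycle within \<open>|J|\<close> pushes.  On a cycle, small pushes might take very many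
  laps.  Instead, the first machine drops the bottleneck \<open>\<theta>\<close> of the whole cycle although it
  receives only the excess \<open>\<epsilon>\<close>; then all other jobs can shift \<open>\<theta>\<close>, and finally the first job fills the
  gap \<open>\<theta> - \<epsilon>\<close>.  This is one lap of better responses that saturates or empties an edge.  There are
  \<open>O(|E|)\<close> rounds, and each of them can afford to recompute all tables in time \<open>O(|V|\<^sup>2)\<close>.\<close>

section \<open>Timed execution\<close>

text \<open>Progress is counted by events that cannot be undone, not by amounts, which may be
  arbitrarily small reals. The relation \<open>improves\<close> makes them irrevocable: only best
  acceptable edges rise, only rejected edges fall, and no machine loses load. A lap with \<epsilon>
  < \<theta> violates the last condition on its way, since the first machine is short of \<theta> -
  \<epsilon> until the closing step. The single steps of a lap are therefore shown to be better
  responses only, and \<open>improves\<close> compares its two ends, where all loads agree. The map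
  from job to job is fixed during a round because an uneventful push changes neither the best
  acceptable edge of a job nor the worst positive edge of a machine. For the same reason the tables
  stay valid, and a push takes constant time; only rebuilding the tables costs more than
  \<open>O(nv)\<close> in a round.\<close>

primrec loop_free :: "com \<Rightarrow> bool" where
  "loop_free Skip \<longleftrightarrow> True"
| "loop_free (IAssign a i k) \<longleftrightarrow> True"
| "loop_free (RAssign a i r) \<longleftrightarrow> True"
| "loop_free (Respond k) \<longleftrightarrow> True"
| "loop_free (Seq P Q) \<longleftrightarrow> loop_free P \<and> loop_free Q"
| "loop_free (If b P Q) \<longleftrightarrow> loop_free P \<and> loop_free Q"
| "loop_free (While b P) \<longleftrightarrow> False"

text \<open>The \<open>While\<close> clauses of \<open>exec\<close> and \<open>cost\<close> are
  dummies, as both functions are applied to \<open>loop_free\<close> code only. On such code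
  \<open>exec\<close> is a symbolic evaluator, so the simplifier can compute the effect of a
  command.\<close>

primrec exec :: "com \<Rightarrow> state \<Rightarrow> state" where
  "exec Skip s = s"
| "exec (IAssign a i k) s =
    s\<lparr>imem := (imem s)(a := (imem s a)(ival i s := ival k s))\<rparr>"
| "exec (RAssign a i r) s =
    s\<lparr>rmem := (rmem s)(a := (rmem s a)(ival i s := rval r s))\<rparr>"
| "exec (Respond k) s = s\<lparr>step_log := step_log s @ [(ival k s, rmem s Alloc)]\<rparr>"
| "exec (Seq P Q) s = exec Q (exec P s)"
| "exec (If b P Q) s = (if bval b s then exec P s else exec Q s)"
| "exec (While b P) s = s"

primrec cost :: "com \<Rightarrow> nat" where
  "cost Skip = 1"
| "cost (IAssign a i k) = 1"
| "cost (RAssign a i r) = 1"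
| "cost (Respond k) = 1"
| "cost (Seq P Q) = cost P + cost Q"
| "cost (If b P Q) = 1 + max (cost P) (cost Q)"
| "cost (While b P) = 0"

lemma runs_exec: "loop_free P \<Longrightarrow> \<exists>t \<le> cost P. runs P s t (exec P s)"
proof (induction P arbitrary: s)
  case (Seq P Q)
  then obtain t u where "t \<le> cost P" "runs P s t (exec P s)"
      "u \<le> cost Q" "runs Q (exec P s) u (exec Q (exec P s))"
    by (meson loop_free.simps(5))
  then show ?case
    using runs.Seq add_mono by (metis cost.simps(5) exec.simps(5))
next
  case (If b P Q)
  then obtain t u where "t \<le> cost P" "runs P s t (exec P s)" "u \<le> cost Q" "runs Q s u (exec Q s)"
    by (meson loop_free.simps(6))
  then show ?case
    using runs.IfTrue[of b s P t "exec P s" Q] runs.IfFalse[of b s Q u "exec Q s" P]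
    by (intro exI[of _ "if bval b s then 1 + t else 1 + u"]) auto
qed (use runs.intros(1-4) in fastforce)+

section \<open>Hoare-style reasoning with time bounds\<close>

definition wp :: "com \<Rightarrow> nat \<Rightarrow> (state \<Rightarrow> bool) \<Rightarrow> state \<Rightarrow> bool" where
  "wp P T Q s \<longleftrightarrow> (\<exists>t s'. runs P s t s' \<and> t \<le> T \<and> Q s')"

lemma wp_mono: "wp P t Q s \<Longrightarrow> t \<le> T \<Longrightarrow> (\<And>s'. Q s' \<Longrightarrow> R s') \<Longrightarrow> wp P T R s"
  unfolding wp_def using le_trans by blast

lemma wp_exec: "loop_free P \<Longrightarrow> cost P \<le> T \<Longrightarrow> Q (exec P s) \<Longrightarrow> wp P T Q s"
  unfolding wp_def using runs_exec le_trans by blast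

lemma wp_Seq:
  assumes "wp P t R s" "\<And>s'. R s' \<Longrightarrow> wp Q u S s'" "t + u \<le> T"
  shows "wp (Seq P Q) T S s"
  using assms unfolding wp_def by (meson runs.Seq add_mono le_trans)

lemma wp_If:
  assumes "bval b s \<Longrightarrow> wp P t Q s" "\<not> bval b s \<Longrightarrow> wp R t Q s" "1 + t \<le> T"
  shows "wp (If b P R) T Q s"
proof (cases "bval b s")
  case True
  then obtain u s' where "runs P s u s'" "u \<le> t" "Q s'" using assms(1) unfolding wp_def by auto
  then show ?thesis using runs.IfTrue[OF True] assms(3) unfolding wp_def
    by (intro exI[of _ "1 + u"] exI[of _ s']) auto
next
  case False
  then obtain u s' where "runs R s u s'" "u \<le> t" "Q s'" using assms(2) unfolding wp_def by auto
  then show ?thesis using runs.IfFalse[OF False] assms(3) unfolding wp_def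
    by (intro exI[of _ "1 + u"] exI[of _ s']) auto
qed

text \<open>Every round pays one test and the body, and the failing test pays 1. As
  \<open>\<mu>\<close> falls in each round, \<open>n\<close> bounds their number.\<close>

lemma wp_While:
  assumes "J s"
    and body: "\<And>s. J s \<Longrightarrow> bval b s \<Longrightarrow> wp P t (\<lambda>s'. J s' \<and> \<mu> s' < (\<mu> s :: nat)) s"
    and "1 + n * (t + 1) \<le> T" "\<mu> s \<le> n"
  shows "wp (While b P) T (\<lambda>s'. J s' \<and> \<not> bval b s') s"
  using assms(1,3,4)
proof (induction n arbitrary: s T)
  case 0
  then have "\<not> bval b s" using body[of s] unfolding wp_def by auto
  then show ?case using 0 unfolding wp_def by (meson WhileFalse add_leD1)
next
  case (Suc n)
  show ?case
  proof (cases "bval b s")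
    case True
    then obtain u s' where s': "runs P s u s'" "u \<le> t" "J s'" "\<mu> s' < \<mu> s"
      using body[OF Suc.prems(1)] unfolding wp_def by blast
    then have "wp (While b P) (1 + n * (t + 1)) (\<lambda>s'. J s' \<and> \<not> bval b s') s'"
      using Suc by auto
    then obtain v s'' where "runs (While b P) s' v s''" "v \<le> 1 + n * (t + 1)" "J s''" "\<not> bval b s''"
      unfolding wp_def by blast
    then show ?thesis using runs.WhileTrue[OF True s'(1)] s'(2) Suc.prems(2) unfolding wp_def
      by (intro exI[of _ "1 + u + v"] exI[of _ s'']) auto
  next
    case False
    then show ?thesis using Suc.prems runs.WhileFalse[OF False, of P] unfolding wp_def
      by (intro exI[of _ 1] exI[of _ s]) auto
  qed
qed

abbreviation ivar :: "nat \<Rightarrow> iexp" where "ivar n \<equiv> IGet (IAux n) (IConst 0)"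
abbreviation rvar :: "nat \<Rightarrow> rexp" where "rvar n \<equiv> RGet (RAux n) (IConst 0)"
abbreviation iset :: "nat \<Rightarrow> iexp \<Rightarrow> com" where "iset n k \<equiv> IAssign (IAux n) (IConst 0) k"
abbreviation rset :: "nat \<Rightarrow> rexp \<Rightarrow> com" where "rset n r \<equiv> RAssign (RAux n) (IConst 0) r"
abbreviation idec :: "iexp \<Rightarrow> iexp" where "idec k \<equiv> IMinus k (IConst 1)"
abbreviation isuc :: "iexp \<Rightarrow> iexp" where "isuc k \<equiv> IPlus k (IConst 1)"

text \<open>The counter is always \<open>IAux 0\<close>. Bodies are loop-free, so these loops are
  never nested and one counter is enough.\<close>

definition For :: "iexp \<Rightarrow> com \<Rightarrow> com" where
  "For n P = Seq (iset 0 (IConst 0)) (While (ILess (ivar 0) n) (Seq P (iset 0 (isuc (ivar 0)))))"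

lemma wp_For:
  assumes "loop_free P"
    and "J 0 (exec (iset 0 (IConst 0)) s)"
    and step: "\<And>k s. k < N \<Longrightarrow> J k s \<Longrightarrow> J (Suc k) (exec (Seq P (iset 0 (isuc (ivar 0)))) s)"
    and var: "\<And>k s. J k s \<Longrightarrow> imem s (IAux 0) 0 = k \<and> ival n s = N"
    and T: "2 + N * (cost P + 2) \<le> T"
  shows "wp (For n P) T (J N) s"
  unfolding For_def
proof (rule wp_Seq[where t = 1 and u = "1 + N * (cost P + 2)"])
  show "wp (iset 0 (IConst 0)) 1 (J 0) s" by (rule wp_exec) (use assms in auto)
next
  fix s assume "J 0 s"
  have "wp (While (ILess (ivar 0) n) (Seq P (iset 0 (isuc (ivar 0))))) (1 + N * (cost P + 1 + 1))
    (\<lambda>s'. (\<exists>k \<le> N. J k s') \<and> \<not> bval (ILess (ivar 0) n) s') s"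
  proof (rule wp_While[where \<mu> = "\<lambda>s. N - imem s (IAux 0) 0" and n = N])
    fix s assume "\<exists>k\<le>N. J k s" and b: "bval (ILess (ivar 0) n) s"
    then obtain k where k: "J k s" "k \<le> N" by blast
    then have "k < N" using b var[OF k(1)] by simp
    then have J: "J (Suc k) (exec (Seq P (iset 0 (isuc (ivar 0)))) s)" using step k by blast
    show "wp (Seq P (iset 0 (isuc (ivar 0)))) (cost P + 1)
      (\<lambda>s'. (\<exists>k\<le>N. J k s') \<and> N - imem s' (IAux 0) 0 < N - imem s (IAux 0) 0) s"
    proof (rule wp_exec, use assms in simp, simp, intro conjI exI[of _ "Suc k"] J)
      show "Suc k \<le> N" using \<open>k < N\<close> by simp
      show "N - imem (exec (Seq P (iset 0 (isuc (ivar 0)))) s) (IAux 0) 0 < N - imem s (IAux 0) 0"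
        using var[OF J] var[OF k(1)] \<open>k < N\<close> by presburger
    qed
  qed (use \<open>J 0 s\<close> in auto)
  then show "wp (While (ILess (ivar 0) n) (Seq P (iset 0 (isuc (ivar 0))))) (1 + N * (cost P + 2))
    (J N) s"
    by (rule wp_mono) (use var in fastforce)+
qed (use T in simp)

section \<open>Markets on edge numbers\<close>

text \<open>The numbers \<open>pj e\<close> and \<open>pm e\<close> are meant as positions of
  \<open>e\<close> in one array holding all rankings, a smaller position being better. Hence
  injectivity is asked for over all edges, although positions are compared only between edges with a
  common end.\<close>

locale market =
  fixes nE :: nat and jo mo pj pm :: "nat \<Rightarrow> nat" and q c :: "nat \<Rightarrow> real"
  assumes simple: "k < nE \<Longrightarrow> l < nE \<Longrightarrow> jo k = jo l \<Longrightarrow> mo k = mo l \<Longrightarrow> k = l"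
    and bip: "k < nE \<Longrightarrow> l < nE \<Longrightarrow> jo k \<noteq> mo l"
    and pj_inj: "k < nE \<Longrightarrow> l < nE \<Longrightarrow> pj k = pj l \<Longrightarrow> k = l"
    and pm_inj: "k < nE \<Longrightarrow> l < nE \<Longrightarrow> pm k = pm l \<Longrightarrow> k = l"
begin

definition L :: "(nat \<Rightarrow> real) \<Rightarrow> nat \<Rightarrow> real" where
  "L x v = (\<Sum>k<nE. if jo k = v \<or> mo k = v then x k else 0)"

definition feas :: "(nat \<Rightarrow> real) \<Rightarrow> bool" where
  "feas x \<longleftrightarrow> (\<forall>k<nE. 0 \<le> x k \<and> x k \<le> c k \<and> L x (jo k) \<le> q (jo k) \<and> L x (mo k) \<le> q (mo k))"

definition rej :: "(nat \<Rightarrow> real) \<Rightarrow> nat \<Rightarrow> bool" where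
  "rej x e \<longleftrightarrow> q (mo e) \<le> L x (mo e) \<and> (\<forall>k<nE. mo k = mo e \<longrightarrow> 0 < x k \<longrightarrow> pm k \<le> pm e)"

definition acc :: "(nat \<Rightarrow> real) \<Rightarrow> nat \<Rightarrow> bool" where
  "acc x e \<longleftrightarrow> e < nE \<and> x e < c e \<and> \<not> rej x e"

text \<open>Any positive edge below \<open>e\<close> serves as a witness instead of the worst
  positive one; the worst one is then below \<open>e\<close> too, so both versions agree.\<close>

definition blk :: "(nat \<Rightarrow> real) \<Rightarrow> nat \<Rightarrow> bool" where
  "blk x e \<longleftrightarrow> acc x e \<and>
     (L x (jo e) < q (jo e) \<or> (\<exists>k<nE. jo k = jo e \<and> 0 < x k \<and> pj e < pj k))"

definition br :: "nat \<Rightarrow> (nat \<Rightarrow> real) \<Rightarrow> (nat \<Rightarrow> real) \<Rightarrow> bool" where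
  "br e x y \<longleftrightarrow> blk x e \<and> x e < y e \<and>
     (\<forall>k<nE. k \<noteq> e \<longrightarrow> y k = x k \<or> (y k < x k \<and>
        (jo k = jo e \<and> pj e < pj k \<or> mo k = mo e \<and> pm e < pm k))) \<and> feas y"

definition settled :: "(nat \<Rightarrow> real) \<Rightarrow> bool" where
  "settled x \<longleftrightarrow> (\<forall>e k. acc x e \<longrightarrow> k < nE \<longrightarrow> jo k = jo e \<longrightarrow> 0 < x k \<longrightarrow> pj k \<le> pj e)"

lemma L_upd: "e < nE \<Longrightarrow>
  L (x(e := z)) v = L x v + (if jo e = v \<or> mo e = v then z - x e else 0)"
proof -
  assume e: "e < nE"
  have "L y v = (if jo e = v \<or> mo e = v then y e else 0) +
      (\<Sum>k\<in>{..<nE} - {e}. if jo k = v \<or> mo k = v then y k else 0)" for y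
    unfolding L_def using e by (intro sum.remove) auto
  note split = this
  have "(\<Sum>k\<in>{..<nE} - {e}. if jo k = v \<or> mo k = v then (x(e := z)) k else 0) =
      (\<Sum>k\<in>{..<nE} - {e}. if jo k = v \<or> mo k = v then x k else 0)"
    by (rule sum.cong) auto
  then show ?thesis unfolding split[of x] split[of "x(e := z)"] by simp
qed

lemma L_mono:
  "(\<And>k. k < nE \<Longrightarrow> jo k = v \<or> mo k = v \<Longrightarrow> x k \<le> y k) \<Longrightarrow> L x v \<le> L y v"
  unfolding L_def by (rule sum_mono) auto

lemma not_rej: "\<not> rej x e \<longleftrightarrow>
    L x (mo e) < q (mo e) \<or> (\<exists>k<nE. mo k = mo e \<and> 0 < x k \<and> pm e < pm k)"
  unfolding rej_def by (auto simp: not_le)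

text \<open>All values except that of \<open>e\<close> only fall, so quotas can be violated only at
  the two ends of \<open>e\<close>.\<close>

lemma brI:
  assumes "feas x" "blk x e" "x e < y e" "y e \<le> c e"
    and "\<And>k. k < nE \<Longrightarrow> k \<noteq> e \<Longrightarrow> y k \<noteq> x k \<Longrightarrow> 0 \<le> y k \<and> y k < x k \<and>
      (jo k = jo e \<and> pj e < pj k \<or> mo k = mo e \<and> pm e < pm k)"
    and "L y (jo e) \<le> q (jo e)" "L y (mo e) \<le> q (mo e)"
  shows "br e x y"
proof -
  have e: "e < nE" using assms(2) unfolding blk_def acc_def by auto
  have le: "y k \<le> x k" if "k < nE" "k \<noteq> e" for k using assms(5)[OF that] by force
  have L: "L y v \<le> L x v" if "v \<noteq> jo e" "v \<noteq> mo e" for v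
    using that by (intro L_mono le) auto
  have "feas y"
    unfolding feas_def
  proof (intro allI impI conjI)
    fix k assume k: "k < nE"
    show "0 \<le> y k" using assms(1,3) assms(5)[of k] k unfolding feas_def by (cases "k = e"; force)
    show "y k \<le> c k" using assms(1,4) le[OF k] k unfolding feas_def by (cases "k = e"; force)
    show "L y (jo k) \<le> q (jo k)"
      using L[of "jo k"] assms(1,6,7) k e unfolding feas_def by (metis order_trans)
    show "L y (mo k) \<le> q (mo k)"
      using L[of "mo k"] assms(1,6,7) k e unfolding feas_def by (metis order_trans)
  qed
  then show ?thesis unfolding br_def using assms by blast
qed

lemma br_feas: "br e x y \<Longrightarrow> feas y" unfolding br_def by simp

fun trace :: "(nat \<Rightarrow> real) \<Rightarrow> (nat \<times> (nat \<Rightarrow> real)) list \<Rightarrow> (nat \<Rightarrow> real) \<Rightarrow> bool" where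
  "trace x [] y \<longleftrightarrow> y = x"
| "trace x ((e, z) # l) y \<longleftrightarrow> br e x z \<and> trace z l y"

lemma trace_snoc: "trace x l y \<Longrightarrow> br e y z \<Longrightarrow> trace x (l @ [(e, z)]) z"
  by (induction x l y rule: trace.induct) auto

section \<open>Settling the jobs\<close>

text \<open>For each job this is the part of its ranking down to its worst positive edge. Its size
  turns the improvement of these worst edges into a measure bounded by \<open>nE\<close>.\<close>

definition tail_free :: "(nat \<Rightarrow> real) \<Rightarrow> nat set" where
  "tail_free x = {k. k < nE \<and> (\<exists>l<nE. jo l = jo k \<and> 0 < x l \<and> pj k \<le> pj l)}"

lemma card_tail_free: "card (tail_free x) \<le> nE"
  using card_mono[of "{..<nE}" "tail_free x"] unfolding tail_free_def by auto

text \<open>The raised edge \<open>e\<close> lies above \<open>w\<close>, so it adds nothing below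
  the old worst edge, and all other values only fall. Once \<open>w\<close> is empty, no positive
  edge is left at or below it.\<close>

lemma tail_free_decreases:
  assumes w: "w < nE" "jo w = jo e" "0 < x w" "pj e < pj w" "y w = 0" and e: "e < nE"
    and worst: "\<And>k. k < nE \<Longrightarrow> jo k = jo e \<Longrightarrow> 0 < x k \<Longrightarrow> pj k \<le> pj w"
    and le: "\<And>k. k < nE \<Longrightarrow> k \<noteq> e \<Longrightarrow> y k \<le> x k"
  shows "card (tail_free y) < card (tail_free x)"
proof (rule psubset_card_mono)
  show "finite (tail_free x)" unfolding tail_free_def by auto
  have "w \<notin> tail_free y"
  proof
    assume "w \<in> tail_free y"
    then obtain l where l: "l < nE" "jo l = jo w" "0 < y l" "pj w \<le> pj l"
      unfolding tail_free_def by blast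
    have "l \<noteq> e" using l w by auto
    then have "pj l \<le> pj w" using worst[of l] le[of l] l w by force
    then have "l = w" using pj_inj l w by (metis le_antisym)
    then show False using l w by simp
  qed
  moreover have "w \<in> tail_free x" using w unfolding tail_free_def by auto
  moreover have "tail_free y \<subseteq> tail_free x"
  proof
    fix k assume "k \<in> tail_free y"
    then obtain l where l: "l < nE" "jo l = jo k" "0 < y l" "pj k \<le> pj l" "k < nE"
      unfolding tail_free_def by blast
    show "k \<in> tail_free x"
    proof (cases "l = e")
      case True
      then show ?thesis using w l unfolding tail_free_def by force
    next
      case False
      then have "0 < x l" using le[of l] l by force
      then show ?thesis using l unfolding tail_free_def by auto
    qed
  qed
  ultimately show "tail_free y \<subset> tail_free x" by blast
qed

text \<open>The edges \<open>w\<close> and \<open>r\<close> are emptied completely even if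
  \<open>d\<close> is less than what they hold, since lowering worse edges is free. This leaves room
  for a positive \<open>d\<close> at full vertices, and emptying \<open>w\<close> is progress
  whatever bounds \<open>d\<close>. The flag \<open>D\<close> tells whether the machine has a worse
  positive edge.\<close>

lemma settle_step:
  assumes feas: "feas x" and acc: "acc x e"
    and w: "w < nE" "jo w = jo e" "0 < x w" "pj e < pj w"
    and worst: "\<And>k. k < nE \<Longrightarrow> jo k = jo e \<Longrightarrow> 0 < x k \<Longrightarrow> pj k \<le> pj w"
    and d: "0 < d" "d \<le> c e - x e" "d \<le> q (jo e) - L x (jo e) + x w"
    and r: "if D then r < nE \<and> mo r = mo e \<and> 0 < x r \<and> pm e < pm r \<and>
              d \<le> q (mo e) - L x (mo e) + x r
            else d \<le> q (mo e) - L x (mo e)"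
    and y: "y = (if D then x(r := 0) else x)(e := x e + d, w := 0)"
  shows "br e x y" "card (tail_free y) < card (tail_free x)"
proof -
  have e: "e < nE" using acc unfolding acc_def by simp
  have ew: "w \<noteq> e" using w by auto
  have jm: "jo w \<noteq> mo e" "mo w \<noteq> jo e" "jo e \<noteq> mo e" using bip e w by metis+
  \<comment> \<open>\<open>w\<close> shares its job with \<open>e\<close>; as there are no parallel
    edges, it does not contribute to the load of \<open>mo e\<close>.\<close>
  have mw: "mo w \<noteq> mo e" using simple[of w e] w e ew by blast
  have rr: "r \<noteq> e" "r \<noteq> w" "jo r \<noteq> jo e" "jo r \<noteq> mo e" "mo r \<noteq> jo e" if D
  proof -
    have R: "r < nE" "mo r = mo e" "pm e < pm r" using that r by auto
    then show "r \<noteq> e" by auto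
    then show "jo r \<noteq> jo e" using simple[of r e] R e by blast
    show "r \<noteq> w" using R mw by auto
    show "jo r \<noteq> mo e" "mo r \<noteq> jo e" using bip[of r e] R e jm by auto
  qed
  have L: "L y (jo e) = L x (jo e) + d - x w"
    using e w ew jm rr r unfolding y by (auto simp: L_upd)
  have L': "L y (mo e) = L x (mo e) + d - (if D then x r else 0)"
    using e w ew jm rr r mw unfolding y by (auto simp: L_upd)
  show "br e x y"
  proof (rule brI[OF feas])
    show "blk x e" unfolding blk_def using acc w by blast
    show "L y (jo e) \<le> q (jo e)" using L d by simp
    show "L y (mo e) \<le> q (mo e)" using L' r by (auto split: if_splits)
  qed (use d r w ew y rr in \<open>auto split: if_splits\<close>)
  show "card (tail_free y) < card (tail_free x)"
  proof (rule tail_free_decreases[where w = w and e = e])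
    show "y w = 0" unfolding y by simp
    show "pj k \<le> pj w" if "k < nE" "jo k = jo e" "0 < x k" for k using worst that .
    show "y k \<le> x k" if "k < nE" "k \<noteq> e" for k
      using that r w feas unfolding y feas_def by (auto split: if_splits)
  qed (use w e in auto)
qed

section \<open>Deferred acceptance\<close>

definition best :: "(nat \<Rightarrow> real) \<Rightarrow> nat \<Rightarrow> bool" where
  "best x e \<longleftrightarrow> acc x e \<and> (\<forall>f. acc x f \<longrightarrow> jo f = jo e \<longrightarrow> pj e \<le> pj f)"

definition improves :: "(nat \<Rightarrow> real) \<Rightarrow> (nat \<Rightarrow> real) \<Rightarrow> bool" where
  "improves x y \<longleftrightarrow> (\<forall>k<nE. (x k < y k \<longrightarrow> best x k) \<and> (y k < x k \<longrightarrow> rej x k) \<and>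
     L x (mo k) \<le> L y (mo k))"

text \<open>The machine stays full because its load does not fall. An edge \<open>l\<close> that
  becomes positive was acceptable; were it worse than \<open>e\<close>, whatever rejects
  \<open>e\<close> would have rejected \<open>l\<close> as well.\<close>

lemma improves_rej:
  assumes "improves x y" "rej x e" "e < nE"
  shows "rej y e"
  unfolding rej_def
proof (intro conjI allI impI)
  show "q (mo e) \<le> L y (mo e)" using assms unfolding improves_def rej_def by force
  fix l assume l: "l < nE" "mo l = mo e" "0 < y l"
  show "pm l \<le> pm e"
  proof (cases "0 < x l")
    case True
    then show ?thesis using assms l unfolding rej_def by auto
  next
    case False
    then have "\<not> rej x l" using assms l unfolding improves_def best_def acc_def by force
    then show ?thesis using assms l unfolding rej_def by (metis le_trans nat_le_linear)
  qed
qed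

text \<open>Only rejected edges fall, so an edge that is not rejected cannot become unsaturated, and
  rejection itself persists.\<close>

lemma improves_acc:
  assumes "improves x y" "feas x" "acc y e"
  shows "acc x e"
proof -
  have e: "e < nE" "y e < c e" "\<not> rej y e" using assms(3) unfolding acc_def by auto
  then have "\<not> rej x e" using improves_rej assms(1) by blast
  then have "x e \<le> y e" using assms(1) e unfolding improves_def by force
  then show ?thesis unfolding acc_def using e \<open>\<not> rej x e\<close> by simp
qed

text \<open>A newly positive edge was the best acceptable one of its job, and any edge acceptable
  afterwards was already acceptable, hence not better.\<close>

lemma improves_settled:
  assumes "improves x y" "feas x" "settled x"
  shows "settled y"
  unfolding settled_def
proof (intro allI impI)
  fix e k assume k: "acc y e" "k < nE" "jo k = jo e" "0 < y k"
  then have e: "acc x e" using improves_acc assms by blast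
  show "pj k \<le> pj e"
  proof (cases "0 < x k")
    case True
    then show ?thesis using e k assms(3) unfolding settled_def by blast
  next
    case False
    then have "best x k" using k assms(1) unfolding improves_def by force
    then show ?thesis using e k unfolding best_def by metis
  qed
qed

section \<open>The potential of deferred acceptance\<close>

definition live :: "(nat \<Rightarrow> real) \<Rightarrow> nat set" where
  "live x = {j. L x j < q j \<and> (\<exists>e. acc x e \<and> jo e = j)}"

text \<open>One summand for each irrevocable event: an edge is saturated, a rejected edge is
  emptied, a machine becomes full. The second set includes the acceptable edges so that an edge
  becoming positive is not new in it.\<close>

definition work :: "(nat \<Rightarrow> real) \<Rightarrow> nat" where
  "work x = card {e. acc x e} + card {e. acc x e \<or> e < nE \<and> 0 < x e} +
     card {m \<in> mo ` {..<nE}. L x m < q m}"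

text \<open>A round of pushes decreases \<open>work\<close>, or else makes a job cease to be live.  It makes at most one
  further job live, hence the factor 2.\<close>

definition pot :: "(nat \<Rightarrow> real) \<Rightarrow> nat" where
  "pot x = card (live x) + 2 * work x"

lemma finite_acc [simp]: "finite {e. acc x e}"
  by (rule finite_subset[of _ "{..<nE}"]) (auto simp: acc_def)

lemma finite_acc_pos [simp]: "finite {e. acc x e \<or> e < nE \<and> 0 < x e}"
  by (rule finite_subset[of _ "{..<nE}"]) (auto simp: acc_def)

lemma live_subset: "live x \<subseteq> jo ` {..<nE}"
  unfolding live_def acc_def by auto

lemma finite_live [simp]: "finite (live x)"
  using live_subset finite_subset by blast

text \<open>7 = 1 + 2 * 3: the set of live jobs and the three sets counted by \<open>work\<close>
  have at most \<open>nE\<close> elements each.\<close>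

lemma pot_le: "pot x \<le> 7 * nE"
proof -
  have "card (live x) \<le> card (jo ` {..<nE})" by (intro card_mono live_subset) simp
  also have "\<dots> \<le> nE" using card_image_le[of "{..<nE}" jo] by simp
  finally have "card (live x) \<le> nE" .
  moreover have "card {e. acc x e} \<le> card {..<nE}"
    by (intro card_mono) (auto simp: acc_def)
  moreover have "card {e. acc x e \<or> e < nE \<and> 0 < x e} \<le> card {..<nE}"
    by (intro card_mono) (auto simp: acc_def)
  moreover have "card {m \<in> mo ` {..<nE}. L x m < q m} \<le> card (mo ` {..<nE})"
    by (intro card_mono) auto
  moreover have "card (mo ` {..<nE}) \<le> nE" using card_image_le[of "{..<nE}" mo] by simp
  ultimately show ?thesis unfolding pot_def work_def by simp
qed

lemma improves_sets:
  assumes "improves x y" "feas x" "feas y"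
  shows "{e. acc y e} \<subseteq> {e. acc x e}"
    "{e. acc y e \<or> e < nE \<and> 0 < y e} \<subseteq> {e. acc x e \<or> e < nE \<and> 0 < x e}"
    "{m \<in> mo ` {..<nE}. L y m < q m} \<subseteq> {m \<in> mo ` {..<nE}. L x m < q m}"
proof -
  show a: "{e. acc y e} \<subseteq> {e. acc x e}" using improves_acc assms by blast
  show "{e. acc y e \<or> e < nE \<and> 0 < y e} \<subseteq> {e. acc x e \<or> e < nE \<and> 0 < x e}"
  proof
    fix e assume e: "e \<in> {e. acc y e \<or> e < nE \<and> 0 < y e}"
    show "e \<in> {e. acc x e \<or> e < nE \<and> 0 < x e}"
    proof (cases "acc y e")
      case False
      then have e: "e < nE" "0 < y e" using e by auto
      then show ?thesis using assms(1) unfolding improves_def best_def by fastforce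
    qed (use a in blast)
  qed
  show "{m \<in> mo ` {..<nE}. L y m < q m} \<subseteq> {m \<in> mo ` {..<nE}. L x m < q m}"
    using assms(1) unfolding improves_def by force
qed

lemma work_le:
  assumes "improves x y" "feas x" "feas y"
  shows "work y \<le> work x"
  unfolding work_def using improves_sets[OF assms] by (intro add_mono card_mono) auto

lemma work_less:
  assumes imp: "improves x y" "feas x" "feas y"
    and "acc x e \<and> c e \<le> y e \<or> e < nE \<and> rej x e \<and> 0 < x e \<and> y e = 0 \<or>
         e < nE \<and> L x (mo e) < q (mo e) \<and> q (mo e) \<le> L y (mo e)"
  shows "work y < work x"
proof -
  note S = improves_sets[OF imp]
  have le: "card {e. acc y e} \<le> card {e. acc x e}"
    "card {e. acc y e \<or> e < nE \<and> 0 < y e} \<le> card {e. acc x e \<or> e < nE \<and> 0 < x e}"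
    "card {m \<in> mo ` {..<nE}. L y m < q m} \<le> card {m \<in> mo ` {..<nE}. L x m < q m}"
    using S by (simp_all add: card_mono)
  consider "acc x e" "c e \<le> y e" | "e < nE" "rej x e" "0 < x e" "y e = 0"
    | "e < nE" "L x (mo e) < q (mo e)" "q (mo e) \<le> L y (mo e)" using assms(4) by blast
  then show ?thesis
  proof cases
    case 1
    then have "e \<notin> {e. acc y e}" "e \<in> {e. acc x e}" unfolding acc_def by simp_all
    then have "card {e. acc y e} < card {e. acc x e}"
      using S(1) by (intro psubset_card_mono psubsetI finite_acc) blast+
    then show ?thesis using le unfolding work_def by linarith
  next
    case 2
    \<comment> \<open>The emptied edge does not reenter as an acceptable one, because its rejection
      persists.\<close>
    have "e \<notin> {e. acc y e \<or> e < nE \<and> 0 < y e}" "e \<in> {e. acc x e \<or> e < nE \<and> 0 < x e}"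
      using improves_rej[OF imp(1) 2(2,1)] 2 unfolding acc_def by simp_all
    then have "card {e. acc y e \<or> e < nE \<and> 0 < y e} < card {e. acc x e \<or> e < nE \<and> 0 < x e}"
      using S(2) by (intro psubset_card_mono psubsetI finite_acc_pos) blast+
    then show ?thesis using le unfolding work_def by linarith
  next
    case 3
    have "mo e \<notin> {m \<in> mo ` {..<nE}. L y m < q m}" "mo e \<in> {m \<in> mo ` {..<nE}. L x m < q m}"
      using 3 by simp_all
    then have "card {m \<in> mo ` {..<nE}. L y m < q m} < card {m \<in> mo ` {..<nE}. L x m < q m}"
      using S(3) by (intro psubset_card_mono psubsetI) (simp, blast+)
    then show ?thesis using le unfolding work_def by linarith
  qed
qed

lemma pot_less:
  assumes "improves x y" "feas x" "feas y" "live y \<subseteq> insert j (live x)"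
    "work y < work x \<or> live y \<subset> live x"
  shows "pot y < pot x"
proof (cases "work y < work x")
  case True
  have "card (live y) \<le> card (insert j (live x))" using assms by (intro card_mono) auto
  also have "\<dots> \<le> Suc (card (live x))" by (rule card_insert_le_m1) auto
  finally show ?thesis using True unfolding pot_def by linarith
next
  case False
  then have "card (live y) < card (live x)" using assms by (intro psubset_card_mono) auto
  then show ?thesis using work_le[OF assms(1-3)] unfolding pot_def by linarith
qed

section \<open>Pushes to free and to full machines\<close>

text \<open>\<open>P j\<close> is \<open>Suc e\<close> for the best acceptable edge \<open>e\<close> of \<open>j\<close>, and \<open>0\<close> if there is none.\<close>

definition config :: "(nat \<Rightarrow> real) \<Rightarrow> (nat \<Rightarrow> nat) \<Rightarrow> (nat \<Rightarrow> nat) \<Rightarrow> bool" where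
  "config x P r \<longleftrightarrow>
     (\<forall>j. 0 < P j \<longrightarrow> best x (P j - 1) \<and> jo (P j - 1) = j) \<and>
     (\<forall>f. acc x f \<longrightarrow> 0 < P (jo f)) \<and>
     (\<forall>k<nE. 0 < x k \<longrightarrow> r (mo k) < nE \<and> mo (r (mo k)) = mo k \<and> 0 < x (r (mo k)) \<and>
        pm k \<le> pm (r (mo k)))"

text \<open>A full machine that does not reject \<open>e\<close> has a positive edge worse than
  \<open>e\<close>. Its worst one is rejected, since nothing positive lies below it, and it belongs
  to another job because there are no parallel edges.\<close>

lemma config_worst:
  assumes "config x P r" "acc x e" "q (mo e) \<le> L x (mo e)"
  shows "r (mo e) < nE" "mo (r (mo e)) = mo e" "0 < x (r (mo e))" "pm e < pm (r (mo e))"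
    "rej x (r (mo e))" "jo (r (mo e)) \<noteq> jo e" "r (mo e) \<noteq> e"
proof -
  obtain k where k: "k < nE" "mo k = mo e" "0 < x k" "pm e < pm k"
    using assms(2,3) unfolding acc_def rej_def by (auto simp: not_le)
  then show r: "r (mo e) < nE" "mo (r (mo e)) = mo e" "0 < x (r (mo e))" "pm e < pm (r (mo e))"
    using assms(1) unfolding config_def by (metis, metis, metis, metis less_le_trans)
  show "rej x (r (mo e))"
    unfolding rej_def using r assms unfolding config_def by metis
  show "r (mo e) \<noteq> e" using r by auto
  then show "jo (r (mo e)) \<noteq> jo e" using simple[of "r (mo e)" e] r assms(2) unfolding acc_def by blast
qed

text \<open>Whichever bound \<open>d\<close> attains, there is progress: the job is filled and
  ceases to be live, the edge is saturated, or the machine becomes full. No job loses load, so none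
  becomes live.\<close>

lemma free_push:
  assumes feas: "feas x" and settled: "settled x" and best: "best x e"
    and free: "L x (mo e) < q (mo e)" and live: "L x (jo e) < q (jo e)"
    and d: "0 < d" "d \<le> q (jo e) - L x (jo e)" "d \<le> c e - x e" "d \<le> q (mo e) - L x (mo e)"
      "d = q (jo e) - L x (jo e) \<or> d = c e - x e \<or> d = q (mo e) - L x (mo e)"
    and y: "y = x(e := x e + d)"
  shows "br e x y" "settled y" "pot y < pot x"
proof -
  have e: "acc x e" "e < nE" using best unfolding best_def acc_def by auto
  have L: "L y v = L x v + (if jo e = v \<or> mo e = v then d else 0)" for v
    unfolding y using e by (simp add: L_upd)
  show br: "br e x y"
    by (rule brI[OF feas]) (use d L y live e in \<open>auto simp: blk_def\<close>)
  have imp: "improves x y" unfolding improves_def using L d best y by auto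
  show "settled y" using improves_settled imp feas settled by blast
  have sub: "live y \<subseteq> live x"
    using improves_acc[OF imp feas] L d(1) unfolding live_def
    by (smt (verit) mem_Collect_eq subsetI)
  show "pot y < pot x"
  proof (rule pot_less[OF imp feas br_feas[OF br], of "jo e"])
    show "work y < work x \<or> live y \<subset> live x"
    proof (cases "d = q (jo e) - L x (jo e)")
      case True
      then have "jo e \<notin> live y" "jo e \<in> live x" using L[of "jo e"] live e unfolding live_def by auto
      then show ?thesis using sub by blast
    next
      case False
      then have "work y < work x"
        using work_less[OF imp feas br_feas[OF br], of e] d(5) e y free L[of "mo e"] by auto
      then show ?thesis ..
    qed
  qed (use sub in auto)
qed

text \<open>The excess passes from \<open>jo e\<close> to \<open>jo R\<close>. Without an event,
  \<open>d\<close> is the whole free quota of \<open>jo e\<close>, so one job is filled for one that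
  is opened, the potential does not grow, and \<open>P\<close> and \<open>r\<close> remain valid. If
  \<open>jo R\<close> has no acceptable edge, it does not become live and the push is progress as
  well.\<close>

lemma full_push:
  assumes feas: "feas x" and settled: "settled x" and cfg: "config x P r"
    and e: "best x e" and R: "R = r (mo e)"
    and full: "q (mo e) \<le> L x (mo e)" and live: "L x (jo e) < q (jo e)"
    and d: "0 < d" "d \<le> q (jo e) - L x (jo e)" "d \<le> c e - x e" "d \<le> x R"
      "d = q (jo e) - L x (jo e) \<or> d = c e - x e \<or> d = x R"
    and y: "y = x(e := x e + d, R := x R - d)"
  shows "br e x y" "settled y"
    "y e < c e \<and> 0 < y R \<and> 0 < P (jo R) \<Longrightarrow>
       config y P r \<and> L y (jo R) < q (jo R) \<and> pot y \<le> pot x"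
    "\<not> (y e < c e \<and> 0 < y R \<and> 0 < P (jo R)) \<Longrightarrow> pot y < pot x"
    "L y v = L x v + (if v = jo e then d else 0) - (if v = jo R then d else 0)"
proof -
  have ac: "acc x e" and eE: "e < nE" using e unfolding best_def acc_def by auto
  note W = config_worst[OF cfg ac full, folded R]
  have jm: "jo e \<noteq> mo e" "jo R \<noteq> mo e" using eE W bip by metis+
  show L: "L y v = L x v + (if v = jo e then d else 0) - (if v = jo R then d else 0)" for v
    unfolding y using eE W jm by (auto simp: L_upd)
  show br: "br e x y"
  proof (rule brI[OF feas])
    show "L y (mo e) \<le> q (mo e)" using L[of "mo e"] jm feas eE unfolding feas_def by auto
    show "blk x e" using ac live unfolding blk_def by auto
  qed (use d L W y live ac in \<open>auto simp: blk_def split: if_splits\<close>)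
  note feas' = br_feas[OF br]
  have imp: "improves x y"
    unfolding improves_def
  proof (intro allI impI conjI)
    fix k assume k: "k < nE"
    show "best x k" if "x k < y k" using that d(1) e y by (auto split: if_splits)
    show "rej x k" if "y k < x k" using that d(1) W(5) y by (auto split: if_splits)
    have "mo k \<noteq> jo R" "mo k \<noteq> jo e" using bip[OF W(1) k] bip[OF eE k] by auto
    then show "L x (mo k) \<le> L y (mo k)" unfolding L by simp
  qed
  show "settled y" using improves_settled imp feas settled by blast
  have sub: "live y \<subseteq> insert (jo R) (live x)"
    using improves_acc[OF imp feas] L d(1) unfolding live_def
    by (smt (verit) insertCI mem_Collect_eq subsetI)
  have ev: "work y < work x" if "\<not> (y e < c e \<and> 0 < y R)"
  proof (cases "y e < c e")
    case True
    then have "y R = 0" using that feas' W unfolding feas_def by force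
    then show ?thesis using work_less[OF imp feas feas', of R] W by blast
  qed (use work_less[OF imp feas feas', of e] ac in auto)
  have jolive: "jo e \<in> live x" using ac live unfolding live_def by auto
  have noev: "jo e \<notin> live y" if "y e < c e \<and> 0 < y R"
    using d(5) that L[of "jo e"] W y unfolding live_def by (auto split: if_splits)
  {
    assume *: "y e < c e \<and> 0 < y R \<and> 0 < P (jo R)"
    \<comment> \<open>At \<open>mo e\<close> the edge \<open>R\<close> is still positive and worse
      than every acceptable edge; at other machines neither values nor loads change.\<close>
    have acc: "acc y f" if f: "acc x f" for f
      unfolding acc_def
    proof (intro conjI)
      show "f < nE" using f unfolding acc_def by simp
      show "y f < c f" using * f d(1) unfolding y acc_def by auto
      show "\<not> rej y f"
      proof (cases "mo f = mo e")
        case True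
        then have "pm f < pm R" using config_worst[OF cfg f] full R by simp
        then show ?thesis using * W True unfolding rej_def by force
      next
        case False
        have [simp]: "y k = x k" if "mo k = mo f" for k using that False W unfolding y by auto
        have "L y (mo f) = L x (mo f)"
          unfolding L using f bip[OF eE, of f] bip[OF W(1), of f] by (auto simp: acc_def)
        then show ?thesis using f unfolding acc_def rej_def by force
      qed
    qed
    have acc_eq: "acc y = acc x" using acc improves_acc[OF imp feas] by blast
    have "config y P r"
      unfolding config_def
    proof (intro conjI allI impI)
      fix k assume k: "k < nE" "0 < y k"
      have r: "r (mo k) < nE \<and> mo (r (mo k)) = mo k \<and> 0 < x (r (mo k)) \<and> pm k \<le> pm (r (mo k))"
      proof (cases "k = e")
        case True
        then show ?thesis using W R by simp
      next
        case False
        then have "0 < x k" using k W d(1) unfolding y by (auto split: if_splits)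
        then show ?thesis using cfg k unfolding config_def by blast
      qed
      then show "r (mo k) < nE" "mo (r (mo k)) = mo k" "pm k \<le> pm (r (mo k))" by auto
      show "0 < y (r (mo k))" using r d * W unfolding y by (auto split: if_splits)
    qed (use cfg in \<open>auto simp: config_def best_def acc_eq\<close>)
    moreover have "L y (jo R) < q (jo R)"
      using L[of "jo R"] W d(1) feas unfolding feas_def by force
    \<comment> \<open>The job of \<open>R\<close> can only take the place of \<open>jo e\<close>,
      which has been filled.\<close>
    moreover have "card (live y) \<le> card (live x)"
    proof -
      have "card (live y) \<le> card (insert (jo R) (live x - {jo e}))"
        using sub noev * by (intro card_mono) auto
      also have "\<dots> \<le> Suc (card (live x - {jo e}))" by (rule card_insert_le_m1) auto
      also have "\<dots> = card (live x)" using jolive by (intro card_Suc_Diff1) auto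
      finally show ?thesis .
    qed
    ultimately show "config y P r \<and> L y (jo R) < q (jo R) \<and> pot y \<le> pot x"
      using work_le[OF imp feas feas'] unfolding pot_def by auto
  }
  {
    assume *: "\<not> (y e < c e \<and> 0 < y R \<and> 0 < P (jo R))"
    show "pot y < pot x"
    proof (rule pot_less[OF imp feas feas' sub])
      show "work y < work x \<or> live y \<subset> live x"
      proof (cases "y e < c e \<and> 0 < y R")
        case True
        then have "P (jo R) = 0" using * by simp
        then have "jo R \<notin> live y"
          using improves_acc[OF imp feas] cfg unfolding live_def config_def by force
        then show ?thesis using sub noev[OF True] jolive by blast
      qed (use ev in blast)
    qed
  }
qed

end

section \<open>Rotations\<close>

text \<open>By the pigeonhole principle two of the first \<open>N + 1\<close> iterates agree. From
  there on the orbit repeats itself, so the \<open>N\<close>-th iterate lies on the cycle and no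
  later iterate is new.\<close>

lemma funpow_returns:
  fixes f :: "nat \<Rightarrow> nat"
  assumes "\<And>k. k \<le> N \<Longrightarrow> (f ^^ k) a < N"
  shows "\<exists>n. 0 < n \<and> n \<le> N \<and> (f ^^ n) ((f ^^ N) a) = (f ^^ N) a"
    and "\<exists>l < N. (f ^^ m) a = (f ^^ l) a"
proof -
  have "\<not> inj_on (\<lambda>k. (f ^^ k) a) {..N}"
  proof
    assume "inj_on (\<lambda>k. (f ^^ k) a) {..N}"
    then have "card {..N} \<le> card {..<N}"
      by (rule card_inj_on_le) (use assms in auto)
    then show False by simp
  qed
  then obtain k' l' where "k' \<le> N" "l' \<le> N" "k' \<noteq> l'" "(f ^^ k') a = (f ^^ l') a"
    unfolding inj_on_def by auto
  then obtain k l where kl: "k < l" "l \<le> N" "(f ^^ k) a = (f ^^ l) a"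
    by (metis nat_neq_iff)
  have shift: "(f ^^ (m + l)) a = (f ^^ (m + k)) a" for m
    using kl(3) by (simp add: funpow_add)
  show "\<exists>n. 0 < n \<and> n \<le> N \<and> (f ^^ n) ((f ^^ N) a) = (f ^^ N) a"
  proof (intro exI[of _ "l - k"] conjI)
    have "(f ^^ (l - k)) ((f ^^ N) a) = (f ^^ (N - k + l)) a"
      using kl by (simp flip: funpow_add[THEN fun_cong, unfolded o_apply] add: add.commute)
    also have "\<dots> = (f ^^ N) a" using kl shift[of "N - k"] by simp
    finally show "(f ^^ (l - k)) ((f ^^ N) a) = (f ^^ N) a" .
  qed (use kl in auto)
  show "\<exists>l < N. (f ^^ m) a = (f ^^ l) a"
  proof (induction m rule: less_induct)
    case (less m)
    show ?case
    proof (cases "m < N")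
      case False
      \<comment> \<open>Going back by the period \<open>l - k\<close> reduces the index until it is
        below \<open>N\<close>.\<close>
      then show ?thesis using less[of "m - l + k"] shift[of "m - l"] kl by auto
    qed auto
  qed
qed

text \<open>\<open>i k\<close> is the \<open>k\<close>-th job on the cycle, \<open>p (i k)\<close>
  its proposal, and \<open>re (i k)\<close> the edge dropped in exchange, which belongs to
  \<open>i (Suc k)\<close>. Indices range over all naturals, which keeps arithmetic modulo
  \<open>n\<close> out of the assumptions. \<theta> is the bottleneck of the cycle, and \<epsilon>
  an amount for which \<open>j\<close> has room.\<close>

locale rotation = market +
  fixes x :: "nat \<Rightarrow> real" and P r :: "nat \<Rightarrow> nat" and j n :: nat and \<epsilon> \<theta> :: real
  fixes p nxt i re
  defines "p \<equiv> \<lambda>j. P j - 1" and "re \<equiv> \<lambda>j. r (mo (p j))" and "nxt \<equiv> \<lambda>j. jo (re j)"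
    and "i \<equiv> \<lambda>k. (nxt ^^ k) j"
  assumes feas: "feas x" and settled: "settled x" and cfg: "config x P r"
    and ok: "\<And>k. 0 < P (i k) \<and> q (mo (p (i k))) \<le> L x (mo (p (i k)))"
    and returns: "0 < n" "i n = j"
    and minimal: "\<And>k. 0 < k \<Longrightarrow> k < n \<Longrightarrow> i k \<noteq> j"
    and \<epsilon>: "0 < \<epsilon>" "\<epsilon> \<le> \<theta>" "\<epsilon> \<le> q j - L x j"
    and \<theta>: "\<And>k. \<theta> \<le> c (p (i k)) - x (p (i k)) \<and> \<theta> \<le> x (re (i k))"
    and tight: "\<exists>k. \<theta> = c (p (i k)) - x (p (i k)) \<or> \<theta> = x (re (i k))"
begin

lemma i_simps: "i 0 = j" "nxt (i k) = i (Suc k)" unfolding i_def by simp_all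

lemma p_facts: "best x (p (i k))" "acc x (p (i k))" "p (i k) < nE" "jo (p (i k)) = i k"
  using ok[of k] cfg unfolding config_def p_def best_def acc_def by auto

lemma re_facts: "re (i k) < nE" "mo (re (i k)) = mo (p (i k))" "0 < x (re (i k))"
    "pm (p (i k)) < pm (re (i k))" "rej x (re (i k))" "jo (re (i k)) = i (Suc k)"
  using config_worst[OF cfg p_facts(2)] ok[of k] i_simps(2)[of k] unfolding re_def nxt_def by auto

lemma p_neq_re: "p (i k) \<noteq> re (i l)"
  using p_facts(2)[of k] re_facts(5)[of l] unfolding acc_def by metis

text \<open>If \<open>i a = i b\<close>, the \<open>n - b\<close> steps leading from
  \<open>i b\<close> back to \<open>j\<close> also lead there from \<open>i a\<close>, after fewer
  than \<open>n\<close> steps in total.\<close>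

lemma i_inj: "a < b \<Longrightarrow> b < n \<Longrightarrow> i a \<noteq> i b"
proof
  assume *: "a < b" "b < n" "i a = i b"
  have "i (n - b + a) = (nxt ^^ (n - b)) (i a)" unfolding i_def by (simp add: funpow_add)
  also have "\<dots> = (nxt ^^ (n - b)) (i b)" using * by simp
  also have "\<dots> = i (n - b + b)" unfolding i_def by (subst funpow_add) simp
  also have "\<dots> = j" using returns * by simp
  finally have j: "i (n - b + a) = j" .
  have "0 < n - b + a" "n - b + a < n" using * by arith+
  from minimal[OF this] j show False by contradiction
qed

text \<open>The edge \<open>re (i a)\<close> lies at the job \<open>i (Suc a)\<close>, so this
  separates the dropped edges; the return \<open>i n = j\<close> is the additional case.\<close>

lemma i_Suc_inj: "a < b \<Longrightarrow> b < n \<Longrightarrow> i (Suc a) \<noteq> i (Suc b)"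
proof (cases "Suc b = n")
  case True
  then show "a < b \<Longrightarrow> i (Suc a) \<noteq> i (Suc b)" using returns minimal[of "Suc a"] by simp
next
  case False
  then show "a < b \<Longrightarrow> b < n \<Longrightarrow> i (Suc a) \<noteq> i (Suc b)" using i_inj[of "Suc a" "Suc b"] by simp
qed

lemma i_mod: "i k = i (k mod n)"
proof -
  have "i (m * n + a) = i a" for m a
  proof (induction m)
    case (Suc m)
    have "i (Suc m * n + a) = (nxt ^^ (m * n + a)) (i n)"
      unfolding i_def by (simp flip: funpow_add[THEN fun_cong, unfolded o_apply] add: ac_simps)
    then show ?case using Suc returns unfolding i_def by simp
  qed simp
  from this[of "k div n" "k mod n"] show ?thesis by simp
qed

primrec rot :: "nat \<Rightarrow> nat \<Rightarrow> real" where
  "rot 0 = x"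
| "rot (Suc l) = (rot l)(p (i l) := rot l (p (i l)) + (if l = 0 then \<epsilon> else \<theta>),
     re (i l) := rot l (re (i l)) - \<theta>)"

lemma rot_before: "l \<le> a \<Longrightarrow> a < n \<Longrightarrow>
    rot l (p (i a)) = x (p (i a)) \<and> rot l (re (i a)) = x (re (i a))"
proof (induction l)
  case (Suc l)
  have "p (i a) \<noteq> p (i l)" using i_inj[of l a] Suc p_facts(4) by (metis Suc_le_lessD)
  moreover have "re (i a) \<noteq> re (i l)" using i_Suc_inj[of l a] Suc re_facts(6) by (metis Suc_le_lessD)
  moreover have "rot l (p (i a)) = x (p (i a))" "rot l (re (i a)) = x (re (i a))"
    using Suc by simp_all
  ultimately show ?case using p_neq_re[of a l] p_neq_re[of l a, symmetric] by simp
qed simp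

lemma rot_after: "a < l \<Longrightarrow> l \<le> n \<Longrightarrow>
    rot l (p (i a)) = x (p (i a)) + (if a = 0 then \<epsilon> else \<theta>) \<and>
    rot l (re (i a)) = x (re (i a)) - \<theta>"
proof (induction l)
  case (Suc l)
  show ?case
  proof (cases "a = l")
    case True
    have "l < n" using Suc by simp
    then show ?thesis unfolding True using rot_before[of l l] p_neq_re[of l l] by simp
  next
    case False
    then have "a < l" "l < n" using Suc by auto
    then have "p (i a) \<noteq> p (i l)" "re (i a) \<noteq> re (i l)"
      using i_inj[of a l] i_Suc_inj[of a l] p_facts(4) re_facts(6) by metis+
    moreover have "rot l (p (i a)) = x (p (i a)) + (if a = 0 then \<epsilon> else \<theta>)"
        "rot l (re (i a)) = x (re (i a)) - \<theta>"
      using Suc \<open>a < l\<close> \<open>l < n\<close> by simp_all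
    ultimately show ?thesis using p_neq_re[of a l] p_neq_re[of l a, symmetric] by simp
  qed
qed simp

text \<open>During the lap three vertices are off balance: \<open>j\<close> has gained \<epsilon>,
  the next job \<open>i l\<close> has just lost \<theta>, and the first machine is short of \<theta>
  - \<epsilon>. The condition \<open>0 < l\<close> matters, as nothing is missing before the first
  step. For \<open>l = n\<close> the two job terms meet at \<open>j\<close>.\<close>

lemma L_rot: "0 < l \<Longrightarrow> l \<le> n \<Longrightarrow> L (rot l) v = L x v + (if v = j then \<epsilon> else 0) -
    (if v = i l then \<theta> else 0) + (if v = mo (p j) then \<epsilon> - \<theta> else 0)"
proof (induction l)
  case (Suc l)
  have "L (rot (Suc l)) v = L (rot l) v +
      (if v = i l then if l = 0 then \<epsilon> else \<theta> else 0) - (if v = i (Suc l) then \<theta> else 0) +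
      (if v = mo (p (i l)) then (if l = 0 then \<epsilon> else \<theta>) - \<theta> else 0)"
    using p_facts(3,4)[of l] re_facts(1,2,6)[of l] p_neq_re[of l l]
      bip[OF p_facts(3)[of l] p_facts(3)[of l]] bip[OF re_facts(1)[of l] p_facts(3)[of l]]
    by (auto simp: L_upd)
  note step = this
  show ?case
  proof (cases "l = 0")
    case True
    show ?thesis unfolding step unfolding True by (simp add: i_simps del: rot.simps(2))
  next
    case False
    then have IH: "L (rot l) v = L x v + (if v = j then \<epsilon> else 0) - (if v = i l then \<theta> else 0) +
        (if v = mo (p j) then \<epsilon> - \<theta> else 0)" using Suc by simp
    show ?thesis unfolding step IH using False by (simp del: rot.simps(2))
  qed
qed simp

lemma rot_step: "l < n \<Longrightarrow> feas (rot l) \<Longrightarrow> br (p (i l)) (rot l) (rot (Suc l))"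
proof (rule brI)
  assume l: "l < n" and feas_l: "feas (rot l)"
  have b: "rot l (p (i l)) = x (p (i l))" "rot l (re (i l)) = x (re (i l))" using rot_before l by auto
  have le: "L x (i l) \<le> q (i l)" "L x (mo (p (i l))) \<le> q (mo (p (i l)))"
    using feas p_facts(3,4)[of l] unfolding feas_def by metis+
  have nm: "mo (p (i l)) \<noteq> i k" for k using bip[OF p_facts(3)[of k] p_facts(3)[of l]] p_facts(4) by metis
  \<comment> \<open>The edge to be dropped is untouched so far, hence still positive and worse than
    the proposal, whatever the load of the machine.\<close>
  have "\<not> rej (rot l) (p (i l))"
    unfolding not_rej using re_facts[of l] b by metis
  \<comment> \<open>At the start \<open>j\<close> has room for \<epsilon>; every later job has just
    lost \<theta>.\<close>
  moreover have "L (rot l) (i l) < q (i l)"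
  proof (cases "l = 0")
    case True
    then show ?thesis using \<epsilon> by (simp add: i_simps)
  next
    case False
    then show ?thesis using L_rot[of l "i l"] nm[of l] bip[OF p_facts(3)[of l] p_facts(3)[of 0]]
        minimal[of l] l le \<epsilon> p_facts(4)
      by (auto simp: i_simps)
  qed
  ultimately show "blk (rot l) (p (i l))"
    unfolding blk_def acc_def using p_facts(2,3,4)[of l] b by (auto simp: acc_def)
  show "feas (rot l)" by (rule feas_l)
  show "rot l (p (i l)) < rot (Suc l) (p (i l))" "rot (Suc l) (p (i l)) \<le> c (p (i l))"
    using b \<theta>[of l] \<epsilon> p_neq_re[of l l] by auto
  show "0 \<le> rot (Suc l) k \<and> rot (Suc l) k < rot l k \<and>
      (jo k = jo (p (i l)) \<and> pj (p (i l)) < pj k \<or> mo k = mo (p (i l)) \<and> pm (p (i l)) < pm k)"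
    if "k < nE" "k \<noteq> p (i l)" "rot (Suc l) k \<noteq> rot l k" for k
    using that b \<theta>[of l] \<epsilon> re_facts[of l] by (auto split: if_splits)
  show "L (rot (Suc l)) (jo (p (i l))) \<le> q (jo (p (i l)))"
    using L_rot[of "Suc l" "i l"] l nm[of l] bip[OF p_facts(3)[of l] p_facts(3)[of 0]] le \<epsilon> p_facts(4)
    by (auto simp: i_simps split: if_splits)
  show "L (rot (Suc l)) (mo (p (i l))) \<le> q (mo (p (i l)))"
    using L_rot[of "Suc l" "mo (p (i l))"] l nm nm[of 0] le \<epsilon> by (auto simp: i_simps split: if_splits)
qed

lemma feas_rot: "l \<le> n \<Longrightarrow> feas (rot l)"
proof (induction l)
  case 0
  show ?case using feas by simp
next
  case (Suc l)
  then have "l < n" "feas (rot l)" by simp_all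
  then show ?case by (rule br_feas[OF rot_step])
qed

text \<open>Raised edges are best acceptable and lowered ones are rejected, so no edge moves in both
  directions. This yields the signs required by \<open>improves\<close> without following the
  cycle.\<close>

lemma rot_sign: "(best x k \<longrightarrow> x k \<le> rot l k) \<and> (rej x k \<longrightarrow> rot l k \<le> x k) \<and>
    (\<not> best x k \<longrightarrow> \<not> rej x k \<longrightarrow> rot l k = x k)"
proof (induction l)
  case (Suc l)
  have p: "best x (p (i l))" "\<not> rej x (p (i l))" and re: "\<not> best x (re (i l))" "rej x (re (i l))"
    using p_facts(1,2)[of l] re_facts(5)[of l] unfolding best_def acc_def by blast+
  consider "k = p (i l)" | "k = re (i l)" | "k \<noteq> p (i l)" "k \<noteq> re (i l)" by blast
  then show ?case
  proof cases
    case 1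
    have "rot (Suc l) k = rot l k + (if l = 0 then \<epsilon> else \<theta>)"
      unfolding 1 using p_neq_re[of l l] by simp
    then show ?thesis using Suc p \<epsilon> unfolding 1 by (simp del: rot.simps split: if_splits)
  next
    case 2
    have "rot (Suc l) k = rot l k - \<theta>" unfolding 2 by simp
    then show ?thesis using Suc re \<epsilon> unfolding 2 by (simp del: rot.simps)
  next
    case 3
    then have "rot (Suc l) k = rot l k" by simp
    then show ?thesis using Suc by (simp del: rot.simps)
  qed
qed simp

definition rotated :: "nat \<Rightarrow> real" where
  "rotated = (rot n)(p j := rot n (p j) + (\<theta> - \<epsilon>))"

text \<open>A complete lap restores every load: \<open>j\<close> gains \<epsilon>, loses \<theta>
  and regains \<theta> - \<epsilon>, and so does the first machine. The progress of a rotation thus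
  comes from edges alone.\<close>

lemma L_rotated: "L rotated v = L x v"
proof -
  have j: "p j < nE" "jo (p j) = j" using p_facts(3,4)[of 0] unfolding i_simps by simp_all
  then have "mo (p j) \<noteq> j" using bip by metis
  then show ?thesis using L_rot[of n v] returns unfolding rotated_def L_upd[OF j(1)] j(2) by auto
qed

text \<open>The end of the lap has taken \<theta> from \<open>j\<close>, and its first machine still
  misses \<theta> - \<epsilon>, so both ends of \<open>p j\<close> have free quota.\<close>

lemma rotated_step: "\<epsilon> < \<theta> \<Longrightarrow> br (p j) (rot n) rotated"
proof (rule brI)
  assume less: "\<epsilon> < \<theta>"
  have j: "rot n (p j) = x (p j) + \<epsilon>" "p j < nE" "jo (p j) = j" "acc x (p j)"
    using rot_after[of 0 n] returns p_facts[of 0] by (auto simp: i_simps)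
  have le: "L x j \<le> q j" "L x (mo (p j)) \<le> q (mo (p j))"
    using feas j unfolding feas_def by metis+
  have jm: "j \<noteq> mo (p j)" using bip j by metis
  have "L (rot n) j < q j" "L (rot n) (mo (p j)) < q (mo (p j))"
    using L_rot[of n] jm le less returns \<epsilon> by auto
  then show "blk (rot n) (p j)"
    unfolding blk_def acc_def not_rej using j less \<theta>[of 0] by (auto simp: i_simps)
  show "rot n (p j) < rotated (p j)" "rotated (p j) \<le> c (p j)"
    using j less \<theta>[of 0] unfolding rotated_def by (auto simp: i_simps)
  show "L rotated (jo (p j)) \<le> q (jo (p j))" "L rotated (mo (p j)) \<le> q (mo (p j))"
    unfolding L_rotated using le j by auto
qed (auto simp: feas_rot rotated_def)

lemma rotated_idle: "\<epsilon> = \<theta> \<Longrightarrow> rotated = rot n"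
  unfolding rotated_def by simp

lemma feas_rotated: "feas rotated"
  using feas_rot[of n] rotated_idle br_feas[OF rotated_step] \<epsilon> by fastforce

lemma rotated_improves: "improves x rotated"
  unfolding improves_def L_rotated
proof (intro allI impI conjI)
  have j: "best x (p j)" "\<not> rej x (p j)"
    using p_facts(1,2)[of 0] unfolding i_simps acc_def by blast+
  fix k assume "k < nE"
  show "best x k" if "x k < rotated k"
  proof (cases "k = p j")
    case False
    then have "rotated k = rot n k" unfolding rotated_def by simp
    then show ?thesis using that rot_sign[of k n] by linarith
  qed (use j in simp)
  show "rej x k" if "rotated k < x k"
  proof (cases "k = p j")
    case True
    then show ?thesis using that rot_sign[of "p j" n] j \<epsilon> unfolding rotated_def by simp
  next
    case False
    then have "rotated k = rot n k" unfolding rotated_def by simp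
    then show ?thesis using that rot_sign[of k n] by linarith
  qed
  show "L x (mo k) \<le> L x (mo k)" ..
qed

lemma rotated_settled: "settled rotated"
  using improves_settled rotated_improves feas settled by blast

lemma rotated_pot: "pot rotated < pot x"
proof (rule pot_less[OF rotated_improves feas feas_rotated])
  show "live rotated \<subseteq> insert j (live x)"
  proof
    fix v assume "v \<in> live rotated"
    then obtain e where e: "L rotated v < q v" "acc rotated e" "jo e = v"
      unfolding live_def by auto
    have "acc x e" by (rule improves_acc[OF rotated_improves feas e(2)])
    then show "v \<in> insert j (live x)" using e(1,3) unfolding L_rotated live_def by auto
  qed
  obtain m where m: "\<theta> = c (p (i m)) - x (p (i m)) \<or> \<theta> = x (re (i m))" using tight ..
  \<comment> \<open>The index of the tight edge is moved into the lap, where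
    \<open>rot_after\<close> applies.\<close>
  define k where "k = m mod n"
  have "i m = i k" unfolding k_def by (rule i_mod)
  moreover have "k < n" unfolding k_def using returns(1) by (rule mod_less_divisor)
  ultimately have k: "\<theta> = c (p (i k)) - x (p (i k)) \<or> \<theta> = x (re (i k))" "k < n"
    using m by auto
  have "c (p (i k)) \<le> rotated (p (i k))" if "\<theta> = c (p (i k)) - x (p (i k))"
  \<comment> \<open>The first edge is raised twice, by \<epsilon> and by \<theta> - \<epsilon>, so
    it gains \<theta> like the others.\<close>
  proof (cases "k = 0")
    case True
    then have "rotated (p (i k)) = x (p (i k)) + \<theta>"
      using rot_after[OF k(2) order_refl] unfolding rotated_def True i_simps by simp
    then show ?thesis using that by simp
  next
    case False
    then have "i k \<noteq> j" using minimal k(2) by simp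
    then have "p (i k) \<noteq> p j" using p_facts(4)[of k] p_facts(4)[of 0] unfolding i_simps by auto
    then have "rotated (p (i k)) = x (p (i k)) + \<theta>"
      using rot_after[OF k(2) order_refl] False unfolding rotated_def by simp
    then show ?thesis using that by simp
  qed
  moreover have "rotated (re (i k)) = 0" if "\<theta> = x (re (i k))"
    using rot_after[OF k(2) order_refl] that p_neq_re[of 0 k] unfolding rotated_def i_simps
    by simp
  ultimately have "work rotated < work x"
    using work_less[OF rotated_improves feas feas_rotated, of "p (i k)"]
      work_less[OF rotated_improves feas feas_rotated, of "re (i k)"] k(1)
      p_facts(2)[of k] re_facts(1,3,5)[of k]
    by metis
  then show "work rotated < work x \<or> live rotated \<subset> live x" ..
qed

end

section \<open>The program\<close>

abbreviation seq (infixr ";;" 55) where "P ;; Q \<equiv> Seq P Q"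

abbreviation at_job :: "iexp \<Rightarrow> iexp" where "at_job e \<equiv> IGet JobOf e"
abbreviation at_machine :: "iexp \<Rightarrow> iexp" where "at_machine e \<equiv> IGet MachineOf e"
abbreviation room :: "iexp \<Rightarrow> rexp" where "room e \<equiv> RMinus (RGet Capacity e) (RGet Alloc e)"
abbreviation slack :: "iexp \<Rightarrow> rexp" where "slack v \<equiv> RMinus (RGet Quota v) (RGet (RAux 0) v)"
abbreviation worst_edge :: "iexp \<Rightarrow> iexp" where "worst_edge v \<equiv> IGet Ranked (idec (IGet (IAux 2) v))"
abbreviation best_edge :: "iexp \<Rightarrow> iexp" where "best_edge j \<equiv> idec (IGet (IAux 3) j)"
definition cap_by :: "nat \<Rightarrow> rexp \<Rightarrow> com" where
  "cap_by n r = If (RLess r (rvar n)) (rset n r) Skip"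
abbreviation job_positions :: iexp where "job_positions \<equiv> IGet First (IGet NJobs (IConst 0))"
abbreviation vertex_count :: iexp where
  "vertex_count \<equiv> IPlus (IGet NJobs (IConst 0)) (IGet NMachines (IConst 0))"

lemma cap_by_simps [simp]:
  "loop_free (cap_by n r)" "cost (cap_by n r) = 2"
  "exec (cap_by n r) s = s\<lparr>rmem := (rmem s)(RAux n := (rmem s (RAux n))
     (0 := min (rval r s) (rmem s (RAux n) 0)))\<rparr>"
  unfolding cap_by_def by (auto simp: min_def)

definition clear :: com where
  "clear = RAssign (RAux 0) (ivar 0) RZero ;; IAssign (IAux 2) (ivar 0) (IConst 0) ;;
     IAssign (IAux 3) (ivar 0) (IConst 0)"

definition add_load :: com where
  "add_load =
     RAssign (RAux 0) (at_job (ivar 0))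
       (RPlus (RGet (RAux 0) (at_job (ivar 0))) (RGet Alloc (ivar 0))) ;;
     RAssign (RAux 0) (at_machine (ivar 0))
       (RPlus (RGet (RAux 0) (at_machine (ivar 0))) (RGet Alloc (ivar 0)))"

text \<open>Each ranking is scanned from best to worst with overwriting, so the entry that remains
  is the worst positive edge.\<close>

definition find_worst :: com where
  "find_worst =
     iset 4 (IGet Ranked (ivar 0)) ;;
     If (ILess (ivar 0) job_positions)
       (iset 5 (at_job (ivar 4)))
       (iset 5 (at_machine (ivar 4)) ;; IAssign (IAux 8) (ivar 4) (ivar 0)) ;;
     If (RLess RZero (RGet Alloc (ivar 4))) (IAssign (IAux 2) (ivar 5) (isuc (ivar 0))) Skip"

definition acceptable :: bexp where
  "acceptable = And (RLess (RGet Alloc (ivar 4)) (RGet Capacity (ivar 4)))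
     (Not (And
       (Not (RLess (RGet (RAux 0) (at_machine (ivar 4))) (RGet Quota (at_machine (ivar 4)))))
       (Not (ILess (isuc (IGet (IAux 8) (ivar 4))) (IGet (IAux 2) (at_machine (ivar 4)))))))"

text \<open>The scan runs backwards, so that the last edge written for a job is its best acceptable
  one. \<open>IAux 6\<close> receives an acceptable edge whose job has a worse positive edge,
  \<open>IAux 7\<close> one whose job has free quota, both shifted by one.\<close>

definition find_best :: com where
  "find_best =
     iset 5 (IMinus (idec job_positions) (ivar 0)) ;; iset 4 (IGet Ranked (ivar 5)) ;;
     If acceptable
       (IAssign (IAux 3) (at_job (ivar 4)) (isuc (ivar 4)) ;;
        If (ILess (isuc (ivar 5)) (IGet (IAux 2) (at_job (ivar 4)))) (iset 6 (isuc (ivar 4))) Skip ;;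
        If (RLess (RGet (RAux 0) (at_job (ivar 4))) (RGet Quota (at_job (ivar 4))))
          (iset 7 (isuc (ivar 4))) Skip)
       Skip"

text \<open>\<open>RAux 0\<close> holds the loads, \<open>IAux 8\<close> the positions in the rankings of the machines, \<open>IAux 2\<close>
  the successor of the position of the worst positive edge of a vertex, \<open>IAux 3\<close> the successor of
  the best acceptable edge of a job; \<open>0\<close> stands for none.\<close>

definition configure :: com where
  "configure = For vertex_count clear ;; For (IGet NEdges (IConst 0)) add_load ;;
     For (IGet First vertex_count) find_worst ;; iset 6 (IConst 0) ;; iset 7 (IConst 0) ;;
     For job_positions find_best"

definition settle :: com where
  "settle =
     iset 4 (idec (ivar 6)) ;; iset 5 (at_job (ivar 4)) ;; iset 12 (at_machine (ivar 4)) ;;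
     iset 13 (worst_edge (ivar 12)) ;; iset 14 (worst_edge (ivar 5)) ;;
     rset 3 (room (ivar 4)) ;; cap_by 3 (RPlus (slack (ivar 5)) (RGet Alloc (ivar 14))) ;;
     If (ILess (isuc (IGet (IAux 8) (ivar 4))) (IGet (IAux 2) (ivar 12)))
       (cap_by 3 (RPlus (slack (ivar 12)) (RGet Alloc (ivar 13))) ;; RAssign Alloc (ivar 13) RZero)
       (cap_by 3 (slack (ivar 12))) ;;
     RAssign Alloc (ivar 4) (RPlus (RGet Alloc (ivar 4)) (rvar 3)) ;;
     RAssign Alloc (ivar 14) RZero ;; Respond (ivar 4)"

text \<open>\<open>IAux 9\<close> is the job with the excess, \<open>IAux 10\<close> counts the
  pushes to full machines, and \<open>IAux 11\<close> is cleared when the round has made progress. A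
  push to a full machine changes the loads of two jobs only, so \<open>RAux 0\<close> is updated in
  constant time; a push to a free machine ends the round, after which all tables are
  rebuilt.\<close>

definition push :: com where
  "push =
     iset 4 (best_edge (ivar 9)) ;; iset 12 (at_machine (ivar 4)) ;;
     rset 3 (slack (ivar 9)) ;; cap_by 3 (room (ivar 4)) ;;
     If (RLess (RGet (RAux 0) (ivar 12)) (RGet Quota (ivar 12)))
       (cap_by 3 (slack (ivar 12)) ;;
        RAssign Alloc (ivar 4) (RPlus (RGet Alloc (ivar 4)) (rvar 3)) ;;
        Respond (ivar 4) ;; iset 11 (IConst 0))
       (iset 13 (worst_edge (ivar 12)) ;; cap_by 3 (RGet Alloc (ivar 13)) ;;
        RAssign Alloc (ivar 4) (RPlus (RGet Alloc (ivar 4)) (rvar 3)) ;;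
        RAssign Alloc (ivar 13) (RMinus (RGet Alloc (ivar 13)) (rvar 3)) ;;
        RAssign (RAux 0) (ivar 9) (RPlus (RGet (RAux 0) (ivar 9)) (rvar 3)) ;;
        RAssign (RAux 0) (at_job (ivar 13)) (RMinus (RGet (RAux 0) (at_job (ivar 13))) (rvar 3)) ;;
        Respond (ivar 4) ;; iset 9 (at_job (ivar 13)) ;; iset 10 (isuc (ivar 10)) ;;
        If (And (And (RLess (RGet Alloc (ivar 4)) (RGet Capacity (ivar 4)))
              (RLess RZero (RGet Alloc (ivar 13)))) (ILess (IConst 0) (IGet (IAux 3) (ivar 9))))
          Skip (iset 11 (IConst 0)))"

text \<open>The program does not compute the period of the cycle. The minimum is taken along
  \<open>|J|\<close> jobs, which cover it; repetitions do no harm.\<close>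

definition bottleneck :: com where
  "bottleneck =
     iset 4 (best_edge (ivar 14)) ;; iset 13 (worst_edge (at_machine (ivar 4))) ;;
     cap_by 2 (room (ivar 4)) ;; cap_by 2 (RGet Alloc (ivar 13)) ;; iset 14 (at_job (ivar 13))"

text \<open>The raised amount is read from \<open>RAux d\<close>, the dropped one always from
  \<open>RAux 2\<close>: the first step uses \<open>d = 3\<close>, holding \<epsilon>, and the later
  ones \<open>d = 2\<close>, holding \<theta>.\<close>

definition shift :: "nat \<Rightarrow> com" where
  "shift d =
     iset 4 (best_edge (ivar 14)) ;; iset 13 (worst_edge (at_machine (ivar 4))) ;;
     RAssign Alloc (ivar 4) (RPlus (RGet Alloc (ivar 4)) (rvar d)) ;;
     RAssign Alloc (ivar 13) (RMinus (RGet Alloc (ivar 13)) (rvar 2)) ;;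
     Respond (ivar 4) ;; iset 14 (at_job (ivar 13))"

text \<open>The machine of the first edge drops \<open>\<theta>\<close> although it receives only \<open>\<epsilon>\<close>.  This lets all further
  jobs on the cycle shift the full amount \<open>\<theta>\<close>, and the last step fills the machine again.\<close>

definition rotate :: com where
  "rotate =
     (iset 14 (ivar 9) ;; iset 4 (best_edge (ivar 9)) ;; rset 2 (room (ivar 4))) ;;
     For (IGet NJobs (IConst 0)) bottleneck ;;
     (rset 3 (slack (ivar 9)) ;; cap_by 3 (rvar 2) ;; iset 14 (ivar 9) ;; shift 3) ;;
     While (Not (And (Not (ILess (ivar 14) (ivar 9))) (Not (ILess (ivar 9) (ivar 14))))) (shift 2) ;;
     (iset 4 (best_edge (ivar 9)) ;;
     If (RLess (rvar 3) (rvar 2))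
       (RAssign Alloc (ivar 4) (RPlus (RGet Alloc (ivar 4)) (RMinus (rvar 2) (rvar 3))) ;;
        Respond (ivar 4)) Skip)"

definition play :: com where
  "play =
     (iset 9 (at_job (idec (ivar 7))) ;; iset 10 (IConst 0) ;; iset 11 (IConst 1)) ;;
     While (And (ILess (IConst 0) (ivar 11)) (ILess (ivar 10) (IGet NJobs (IConst 0)))) push ;;
     If (ILess (IConst 0) (ivar 11)) rotate Skip"

text \<open>The guard serves the time bound: without edges the bound is a constant, whereas
  \<open>configure\<close> visits all vertices.\<close>

definition stabilize :: com where
  "stabilize = If (ILess (IConst 0) (IGet NEdges (IConst 0)))
     (configure ;; While (ILess (IConst 0) (ivar 6)) (settle ;; configure) ;;
      While (ILess (IConst 0) (ivar 7)) (play ;; configure)) Skip"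

section \<open>Correctness and running time\<close>

text \<open>Positions below \<open>npj\<close> list the rankings of the jobs, the other ones those of the machines.  A
  position hence determines an edge and the end of it that ranks it, and edges at a common vertex
  are compared by comparing their positions.\<close>

locale indexed = market +
  fixes nj nm np npj :: nat and rk :: "nat \<Rightarrow> nat" and nv :: nat
  defines "nv \<equiv> nj + nm"
  assumes jo: "e < nE \<Longrightarrow> jo e < nj" and mo: "e < nE \<Longrightarrow> mo e < nv"
    and rk: "p < np \<Longrightarrow> rk p < nE" and npj: "npj \<le> np"
    and pj: "e < nE \<Longrightarrow> pj e < npj \<and> rk (pj e) = e"
    and pm: "e < nE \<Longrightarrow> npj \<le> pm e \<and> pm e < np \<and> rk (pm e) = e"
    and pj_rk: "p < npj \<Longrightarrow> pj (rk p) = p"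
    and pm_rk: "npj \<le> p \<Longrightarrow> p < np \<Longrightarrow> pm (rk p) = p"
    and nE: "0 < nE" "nE \<le> nv\<^sup>2" "np \<le> 2 * nv\<^sup>2"
begin

text \<open>Input arrays are never written, so they can be fixed as whole functions.
  \<open>First\<close> enters only through the borders \<open>npj\<close> and
  \<open>np\<close>.\<close>

definition holds :: "(nat \<Rightarrow> real) \<Rightarrow> (nat \<times> (nat \<Rightarrow> real)) list \<Rightarrow> state \<Rightarrow> bool" where
  "holds x l s \<longleftrightarrow> imem s NJobs 0 = nj \<and> imem s NMachines 0 = nm \<and> imem s NEdges 0 = nE \<and>
     imem s JobOf = jo \<and> imem s MachineOf = mo \<and> imem s Ranked = rk \<and>
     imem s First nj = npj \<and> imem s First nv = np \<and>
     rmem s Quota = q \<and> rmem s Capacity = c \<and> rmem s Alloc = x \<and> step_log s = l"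

definition own :: "nat \<Rightarrow> nat" where
  "own p = (if p < npj then jo (rk p) else mo (rk p))"

definition worst :: "nat \<Rightarrow> (nat \<Rightarrow> real) \<Rightarrow> nat \<Rightarrow> nat \<Rightarrow> bool" where
  "worst n x v w \<longleftrightarrow> (\<forall>p<n. own p = v \<longrightarrow> 0 < x (rk p) \<longrightarrow> p < w) \<and>
     (0 < w \<longrightarrow> w - 1 < n \<and> own (w - 1) = v \<and> 0 < x (rk (w - 1)))"

definition loads :: "(nat \<Rightarrow> real) \<Rightarrow> state \<Rightarrow> bool" where
  "loads x s \<longleftrightarrow> (\<forall>v<nv. rmem s (RAux 0) v = L x v)"

definition first_acc :: "nat \<Rightarrow> (nat \<Rightarrow> real) \<Rightarrow> nat \<Rightarrow> nat \<Rightarrow> bool" where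
  "first_acc b x j w \<longleftrightarrow>
     (\<forall>p. b \<le> p \<longrightarrow> p < npj \<longrightarrow> acc x (rk p) \<longrightarrow> jo (rk p) = j \<longrightarrow> 0 < w \<and> pj (w - 1) \<le> p) \<and>
     (0 < w \<longrightarrow> acc x (w - 1) \<and> jo (w - 1) = j \<and> b \<le> pj (w - 1))"

text \<open>\<open>w\<close> is the successor of an edge satisfying \<open>Q\<close>; \<open>0\<close> means that there is none from position \<open>b\<close> on.\<close>

definition witness :: "nat \<Rightarrow> (nat \<Rightarrow> bool) \<Rightarrow> nat \<Rightarrow> bool" where
  "witness b Q w \<longleftrightarrow> (w = 0 \<longrightarrow> (\<forall>p. b \<le> p \<longrightarrow> p < npj \<longrightarrow> \<not> Q (rk p))) \<and> (0 < w \<longrightarrow> Q (w - 1))"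

definition found :: "nat \<Rightarrow> (nat \<Rightarrow> real) \<Rightarrow> state \<Rightarrow> bool" where
  "found b x s \<longleftrightarrow> (\<forall>j<nv. first_acc b x j (imem s (IAux 3) j)) \<and>
     witness b (\<lambda>e. acc x e \<and> Suc (pj e) < imem s (IAux 2) (jo e)) (imem s (IAux 6) 0) \<and>
     witness b (\<lambda>e. acc x e \<and> L x (jo e) < q (jo e)) (imem s (IAux 7) 0)"

definition ranked :: "nat \<Rightarrow> (nat \<Rightarrow> real) \<Rightarrow> state \<Rightarrow> bool" where
  "ranked n x s \<longleftrightarrow> (\<forall>v<nv. worst n x v (imem s (IAux 2) v)) \<and>
     (\<forall>p<n. npj \<le> p \<longrightarrow> imem s (IAux 8) (rk p) = p)"

definition ready :: "(nat \<Rightarrow> real) \<Rightarrow> (nat \<times> (nat \<Rightarrow> real)) list \<Rightarrow> state \<Rightarrow> bool" where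
  "ready x l s \<longleftrightarrow> holds x l s \<and> loads x s \<and> ranked np x s \<and> found 0 x s"

lemma bval_acceptable:
  assumes "holds x l s" "loads x s" "ranked np x s" "imem s (IAux 4) 0 = e" "e < nE"
  shows "bval acceptable s \<longleftrightarrow> acc x e"
proof -
  have w: "worst np x (mo e) (imem s (IAux 2) (mo e))"
    using assms(3) mo[OF assms(5)] unfolding ranked_def by blast
  have "Suc (pm e) < imem s (IAux 2) (mo e) \<longleftrightarrow> (\<exists>k<nE. mo k = mo e \<and> 0 < x k \<and> pm e < pm k)"
  proof
    assume l: "Suc (pm e) < imem s (IAux 2) (mo e)"
    define p where "p = imem s (IAux 2) (mo e) - 1"
    have p: "p < np" "own p = mo e" "0 < x (rk p)" "pm e < p"
      using w l unfolding worst_def p_def by auto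
    then have "\<not> p < npj" using pm[OF assms(5)] by simp
    then have "mo (rk p) = mo e" "pm (rk p) = p" using p pm_rk[of p] unfolding own_def by auto
    then show "\<exists>k<nE. mo k = mo e \<and> 0 < x k \<and> pm e < pm k" using p rk[of p] by auto
  next
    assume "\<exists>k<nE. mo k = mo e \<and> 0 < x k \<and> pm e < pm k"
    then obtain k where k: "k < nE" "mo k = mo e" "0 < x k" "pm e < pm k" by blast
    then have "own (pm k) = mo e" unfolding own_def using pm[of k] by auto
    then have "pm k < imem s (IAux 2) (mo e)" using w k pm[of k] unfolding worst_def by auto
    then show "Suc (pm e) < imem s (IAux 2) (mo e)" using k by simp
  qed
  moreover have "imem s (IAux 8) e = pm e"
    using assms(3) pm[OF assms(5)] unfolding ranked_def by metis
  ultimately show ?thesis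
    using assms mo[OF assms(5)] unfolding acceptable_def acc_def not_rej holds_def loads_def by auto
qed

section \<open>Computing the tables\<close>

lemma configure_clear:
  assumes "holds x l s"
  shows "wp (For vertex_count clear) (2 + nv * 5)
    (\<lambda>s. holds x l s \<and> (\<forall>v<nv. rmem s (RAux 0) v = 0 \<and> imem s (IAux 2) v = 0 \<and> imem s (IAux 3) v = 0)) s"
proof (rule wp_mono[OF wp_For[where N = nv and J = "\<lambda>k s. imem s (IAux 0) 0 = k \<and> holds x l s \<and>
    (\<forall>v<k. rmem s (RAux 0) v = 0 \<and> imem s (IAux 2) v = 0 \<and> imem s (IAux 3) v = 0)"] order_refl])
qed (use assms in \<open>auto simp: clear_def holds_def less_Suc_eq nv_def\<close>)

lemma configure_loads:
  assumes "holds x l s \<and> (\<forall>v<nv. rmem s (RAux 0) v = 0 \<and> imem s (IAux 2) v = 0 \<and> imem s (IAux 3) v = 0)"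
  shows "wp (For (IGet NEdges (IConst 0)) add_load) (2 + nE * 4)
    (\<lambda>s. holds x l s \<and> loads x s \<and> (\<forall>v<nv. imem s (IAux 2) v = 0 \<and> imem s (IAux 3) v = 0)) s"
proof (rule wp_mono[OF wp_For[where N = nE and J = "\<lambda>k s. imem s (IAux 0) 0 = k \<and> holds x l s \<and>
    (\<forall>v<nv. rmem s (RAux 0) v = (\<Sum>e<k. if jo e = v \<or> mo e = v then x e else 0) \<and>
      imem s (IAux 2) v = 0 \<and> imem s (IAux 3) v = 0)"] order_refl])
  fix k s assume k: "k < nE" and J: "imem s (IAux 0) 0 = k \<and> holds x l s \<and>
    (\<forall>v<nv. rmem s (RAux 0) v = (\<Sum>e<k. if jo e = v \<or> mo e = v then x e else 0) \<and>
      imem s (IAux 2) v = 0 \<and> imem s (IAux 3) v = 0)"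
  have "jo k \<noteq> mo k" using bip k by blast
  then show "imem (exec (add_load ;; iset 0 (isuc (ivar 0))) s) (IAux 0) 0 = Suc k \<and>
      holds x l (exec (add_load ;; iset 0 (isuc (ivar 0))) s) \<and>
      (\<forall>v<nv. rmem (exec (add_load ;; iset 0 (isuc (ivar 0))) s) (RAux 0) v =
         (\<Sum>e<Suc k. if jo e = v \<or> mo e = v then x e else 0) \<and>
         imem (exec (add_load ;; iset 0 (isuc (ivar 0))) s) (IAux 2) v = 0 \<and>
         imem (exec (add_load ;; iset 0 (isuc (ivar 0))) s) (IAux 3) v = 0)"
    using J unfolding add_load_def holds_def by auto
qed (use assms in \<open>auto simp: add_load_def holds_def loads_def L_def\<close>)

lemma configure_worst:
  assumes "holds x l s \<and> loads x s \<and> (\<forall>v<nv. imem s (IAux 2) v = 0 \<and> imem s (IAux 3) v = 0)"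
  shows "wp (For (IGet First vertex_count) find_worst) (2 + np * 8)
    (\<lambda>s. holds x l s \<and> loads x s \<and> ranked np x s \<and> (\<forall>v<nv. imem s (IAux 3) v = 0)) s"
proof (rule wp_mono[OF wp_For[where N = np and J = "\<lambda>k s. imem s (IAux 0) 0 = k \<and> holds x l s \<and>
    loads x s \<and> ranked k x s \<and> (\<forall>v<nv. imem s (IAux 3) v = 0)"] order_refl])
  fix k s assume k: "k < np" and J: "imem s (IAux 0) 0 = k \<and> holds x l s \<and>
    loads x s \<and> ranked k x s \<and> (\<forall>v<nv. imem s (IAux 3) v = 0)"
  define s' where "s' = exec (find_worst ;; iset 0 (isuc (ivar 0))) s"
  have r: "imem s' (IAux 0) 0 = Suc k \<and> holds x l s' \<and> loads x s' \<and> (\<forall>v<nv. imem s' (IAux 3) v = 0)"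
    using J unfolding s'_def find_worst_def holds_def loads_def by auto
  have w: "imem s' (IAux 2) = (if 0 < x (rk k) then (imem s (IAux 2))(own k := Suc k) else imem s (IAux 2))"
    using J unfolding s'_def find_worst_def holds_def own_def by auto
  have p: "imem s' (IAux 8) = (if npj \<le> k then (imem s (IAux 8))(rk k := k) else imem s (IAux 8))"
    using J unfolding s'_def find_worst_def holds_def by auto
  have "worst (Suc k) x v (imem s' (IAux 2) v)" if "v < nv" for v
  proof -
    have "worst k x v (imem s (IAux 2) v)" using J that unfolding ranked_def by blast
    then show ?thesis unfolding w worst_def by (auto simp: less_Suc_eq)
  qed
  moreover have "imem s' (IAux 8) (rk p) = p" if "p < Suc k" "npj \<le> p" for p
    using that J k pm_rk[of p] pm_rk[of k] unfolding p ranked_def by (cases "p = k") auto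
  ultimately have "ranked (Suc k) x s'" unfolding ranked_def by blast
  with r show "imem s' (IAux 0) 0 = Suc k \<and> holds x l s' \<and> loads x s' \<and> ranked (Suc k) x s' \<and>
      (\<forall>v<nv. imem s' (IAux 3) v = 0)" by blast
qed (use assms in \<open>auto simp: find_worst_def holds_def loads_def ranked_def worst_def nv_def\<close>)

lemma configure_best:
  assumes "holds x l s \<and> loads x s \<and> ranked np x s \<and> found npj x s"
  shows "wp (For job_positions find_best) (2 + npj * 10) (ready x l) s"
proof (rule wp_mono[OF wp_For[where N = npj and J = "\<lambda>k s. imem s (IAux 0) 0 = k \<and> holds x l s \<and>
    loads x s \<and> ranked np x s \<and> found (npj - k) x s"] order_refl])
  fix k s assume k: "k < npj" and J: "imem s (IAux 0) 0 = k \<and> holds x l s \<and>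
    loads x s \<and> ranked np x s \<and> found (npj - k) x s"
  define s' where "s' = exec (find_best ;; iset 0 (isuc (ivar 0))) s"
  \<comment> \<open>Round \<open>k\<close> treats the position \<open>npj - Suc k\<close>, since the
    scan runs backwards.\<close>
  define b where "b = npj - Suc k"
  define e where "e = rk b"
  have b: "npj - k = Suc b" "b < npj" "pj e = b" "e < nE"
    using k pj_rk[of b] rk[of b] npj unfolding b_def e_def by auto
  define s1 where "s1 = exec (iset 5 (IMinus (idec job_positions) (ivar 0)) ;; iset 4 (IGet Ranked (ivar 5))) s"
  have s1: "imem s1 (IAux 0) 0 = k" "holds x l s1" "loads x s1" "ranked np x s1"
    "imem s1 (IAux 4) 0 = e" "imem s1 (IAux 5) 0 = b"
    and s1_aux: "imem s1 (IAux 2) = imem s (IAux 2)" "imem s1 (IAux 3) = imem s (IAux 3)"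
      "imem s1 (IAux 6) = imem s (IAux 6)" "imem s1 (IAux 7) = imem s (IAux 7)"
    using J unfolding s1_def holds_def loads_def ranked_def e_def b_def by auto
  have acc: "bval acceptable s1 \<longleftrightarrow> acc x e" by (rule bval_acceptable[OF s1(2-5) b(4)])
  have s'_eq: "s' = exec (If acceptable
       (IAssign (IAux 3) (at_job (ivar 4)) (isuc (ivar 4)) ;;
        If (ILess (isuc (ivar 5)) (IGet (IAux 2) (at_job (ivar 4)))) (iset 6 (isuc (ivar 4))) Skip ;;
        If (RLess (RGet (RAux 0) (at_job (ivar 4))) (RGet Quota (at_job (ivar 4))))
          (iset 7 (isuc (ivar 4))) Skip)
       Skip ;; iset 0 (isuc (ivar 0))) s1"
    unfolding s'_def find_best_def s1_def by simp
  have je: "jo e < nv" using jo[OF b(4)] unfolding nv_def by simp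
  have r: "imem s' (IAux 0) 0 = Suc k \<and> holds x l s' \<and> loads x s' \<and> ranked np x s'"
    using s1 unfolding s'_eq holds_def loads_def ranked_def by auto
  have a2: "imem s' (IAux 2) = imem s (IAux 2)"
    using s1_aux unfolding s'_eq by simp
  have a3: "imem s' (IAux 3) = (if acc x e then (imem s (IAux 3))(jo e := Suc e) else imem s (IAux 3))"
    using s1 s1_aux acc unfolding s'_eq holds_def by auto
  have a6: "imem s' (IAux 6) 0 = (if acc x e \<and> Suc b < imem s (IAux 2) (jo e) then Suc e else imem s (IAux 6) 0)"
    using s1 s1_aux acc unfolding s'_eq holds_def by auto
  have a7: "imem s' (IAux 7) 0 = (if acc x e \<and> L x (jo e) < q (jo e) then Suc e else imem s (IAux 7) 0)"
    using s1 s1_aux acc je unfolding s'_eq holds_def loads_def by auto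
  have first: "first_acc b x j (if acc x e \<and> j = jo e then Suc e else imem s (IAux 3) j)" if "j < nv" for j
  proof -
    have *: "first_acc (Suc b) x j (imem s (IAux 3) j)" using J that b unfolding found_def by simp
    have "p = b \<or> Suc b \<le> p" if "b \<le> p" for p using that by auto
    then show ?thesis using * b(3) e_def unfolding first_acc_def by (auto split: if_splits)
  qed
  have wit: "witness b Q (if Q e then Suc e else w)" if "witness (Suc b) Q w" for Q w
  proof -
    have "p = b \<or> Suc b \<le> p" if "b \<le> p" for p using that by auto
    then show ?thesis using that e_def unfolding witness_def by (auto split: if_splits)
  qed
  have "first_acc b x j (imem s' (IAux 3) j)" if "j < nv" for j
    using first[OF that] unfolding a3 by (cases "acc x e"; cases "j = jo e") simp_all
  moreover have "witness (Suc b) (\<lambda>e. acc x e \<and> Suc (pj e) < imem s (IAux 2) (jo e)) (imem s (IAux 6) 0)"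
      "witness (Suc b) (\<lambda>e. acc x e \<and> L x (jo e) < q (jo e)) (imem s (IAux 7) 0)"
    using J unfolding found_def b(1) by blast+
  note this[THEN wit, unfolded b(3)]
  ultimately have "found b x s'" unfolding found_def a2 a6 a7 by blast
  with r show "imem s' (IAux 0) 0 = Suc k \<and> holds x l s' \<and> loads x s' \<and> ranked np x s' \<and>
      found (npj - Suc k) x s'"
    unfolding b_def by blast
qed (use assms in \<open>auto simp: find_best_def acceptable_def holds_def loads_def ranked_def found_def ready_def\<close>)

text \<open>The scans are linear in the numbers of vertices and positions. Bounding these by
  multiples of \<open>nv\<^sup>2\<close> gives the factor 55, rounded up to 60.\<close>

lemma wp_configure:
  assumes "holds x l s"
  shows "wp configure (60 * nv\<^sup>2) (ready x l) s"
  unfolding configure_def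
proof (rule wp_Seq[OF configure_clear[OF assms]], rule wp_Seq[OF configure_loads], assumption,
    rule wp_Seq[OF configure_worst], assumption)
  fix s assume *: "holds x l s \<and> loads x s \<and> ranked np x s \<and> (\<forall>v<nv. imem s (IAux 3) v = 0)"
  show "wp (iset 6 (IConst 0) ;; iset 7 (IConst 0) ;; For job_positions find_best)
      (1 + (1 + (2 + npj * 10))) (ready x l) s"
  proof (rule wp_Seq[OF wp_exec wp_Seq[OF wp_exec configure_best]])
    show "holds x l s' \<and> loads x s' \<and> ranked np x s' \<and> found npj x s'"
      if "s' = exec (iset 7 (IConst 0)) (exec (iset 6 (IConst 0)) s)" for s'
      using * unfolding that holds_def loads_def ranked_def found_def first_acc_def witness_def by auto
  qed auto
next
  have "nv \<noteq> 0" using mo[OF nE(1)] by simp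
  then have "1 \<le> nv\<^sup>2" "nv \<le> nv\<^sup>2" by (simp_all add: Suc_le_eq power2_eq_square)
  then show "2 + nv * 5 + (2 + nE * 4 + (2 + np * 8 + (1 + (1 + (2 + npj * 10))))) \<le> 60 * nv\<^sup>2"
    using nE npj by linarith
qed auto

text \<open>The edge \<open>e\<close> certifies that \<open>j\<close> is a job; as it is then no end
  of an edge on the machine side, the stored position lies in the job half of
  \<open>Ranked\<close>.\<close>

lemma worst_job:
  assumes "worst np x j w" "e < nE" "jo e = j"
  shows "0 < w \<Longrightarrow> rk (w - 1) < nE \<and> jo (rk (w - 1)) = j \<and> pj (rk (w - 1)) = w - 1 \<and> 0 < x (rk (w - 1))"
    and "k < nE \<Longrightarrow> jo k = j \<Longrightarrow> 0 < x k \<Longrightarrow> pj k < w"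
proof -
  show "rk (w - 1) < nE \<and> jo (rk (w - 1)) = j \<and> pj (rk (w - 1)) = w - 1 \<and> 0 < x (rk (w - 1))" if "0 < w"
  proof -
    have w: "w - 1 < np" "own (w - 1) = j" "0 < x (rk (w - 1))" using assms that unfolding worst_def by auto
    then have "w - 1 < npj" using bip[OF assms(2) rk[OF w(1)]] assms(3) unfolding own_def by (auto split: if_splits)
    then show ?thesis using w rk pj_rk unfolding own_def by auto
  qed
  show "pj k < w" if "k < nE" "jo k = j" "0 < x k"
    using assms(1) that pj[OF that(1)] npj unfolding worst_def own_def by force
qed

lemma worst_machine:
  assumes "worst np x m w" "e < nE" "mo e = m"
  shows "0 < w \<Longrightarrow> rk (w - 1) < nE \<and> mo (rk (w - 1)) = m \<and> pm (rk (w - 1)) = w - 1 \<and> 0 < x (rk (w - 1))"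
    and "k < nE \<Longrightarrow> mo k = m \<Longrightarrow> 0 < x k \<Longrightarrow> pm k < w"
proof -
  show "rk (w - 1) < nE \<and> mo (rk (w - 1)) = m \<and> pm (rk (w - 1)) = w - 1 \<and> 0 < x (rk (w - 1))" if "0 < w"
  proof -
    have w: "w - 1 < np" "own (w - 1) = m" "0 < x (rk (w - 1))" using assms that unfolding worst_def by auto
    then have "\<not> w - 1 < npj" using bip[OF rk[OF w(1)] assms(2)] assms(3) unfolding own_def by (auto split: if_splits)
    then show ?thesis using w rk pm_rk unfolding own_def by auto
  qed
  show "pm k < w" if "k < nE" "mo k = m" "0 < x k"
    using assms(1) that pm[OF that(1)] unfolding worst_def own_def by force
qed

lemma exec_settle:
  assumes ready: "ready x l s" and feas: "feas x" and F: "0 < imem s (IAux 6) 0"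
  shows "\<exists>e y. holds y (l @ [(e, y)]) (exec settle s) \<and> br e x y \<and> card (tail_free y) < card (tail_free x)"
proof -
  define e where "e = imem s (IAux 6) 0 - 1"
  define W where "W = imem s (IAux 2)"
  have H: "holds x l s" and LD: "loads x s" using ready unfolding ready_def by auto
  have e: "acc x e" "Suc (pj e) < W (jo e)"
    using ready F unfolding ready_def found_def witness_def e_def W_def by auto
  then have eE: "e < nE" unfolding acc_def by simp
  have v: "jo e < nv" "mo e < nv" using jo[OF eE] mo[OF eE] unfolding nv_def by auto
  have wj: "worst np x (jo e) (W (jo e))" and wm: "worst np x (mo e) (W (mo e))"
    and PM: "imem s (IAux 8) e = pm e"
    using ready v pm[OF eE] unfolding ready_def ranked_def W_def by (blast, blast, metis)
  have LDe: "rmem s (RAux 0) (jo e) = L x (jo e)" "rmem s (RAux 0) (mo e) = L x (mo e)"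
    using LD v unfolding loads_def by auto
  define w where "w = rk (W (jo e) - 1)"
  define r where "r = rk (W (mo e) - 1)"
  define D where "D \<longleftrightarrow> Suc (pm e) < W (mo e)"
  have w: "w < nE" "jo w = jo e" "pj w = W (jo e) - 1" "0 < x w" "pj e < pj w"
    using worst_job(1)[OF wj eE] e unfolding w_def by auto
  have worst: "pj k \<le> pj w" if "k < nE" "jo k = jo e" "0 < x k" for k
    using worst_job(2)[OF wj eE _ that] w by simp
  have r: "r < nE" "mo r = mo e" "0 < x r" "pm e < pm r" if D
    using worst_machine(1)[OF wm eE] that unfolding r_def D_def by auto
  \<comment> \<open>Since \<open>e\<close> is acceptable, a machine without a worse positive edge
    must have free quota.\<close>
  have nD: "L x (mo e) < q (mo e)" if "\<not> D"
  proof (rule ccontr)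
    assume "\<not> L x (mo e) < q (mo e)"
    then obtain k where "k < nE" "mo k = mo e" "0 < x k" "pm e < pm k"
      using e(1) unfolding acc_def not_rej by auto
    then show False using worst_machine(2)[OF wm eE, of k] that unfolding D_def by simp
  qed
  \<comment> \<open>The minima are nested in the order in which \<open>cap_by\<close> forms them in
    \<open>RAux 3\<close>.\<close>
  define d1 where "d1 = min (q (jo e) - L x (jo e) + x w) (c e - x e)"
  define d where "d = (if D then min (q (mo e) - L x (mo e) + x r) d1 else min (q (mo e) - L x (mo e)) d1)"
  define y where "y = (if D then x(r := 0) else x)(e := x e + d, w := 0)"
  have re: "D \<Longrightarrow> r \<noteq> e" using r by auto
  have "holds y (l @ [(e, y)]) (exec settle s)"
  proof -
    have vals: "imem s (IAux 6) 0 - Suc 0 = e" "imem s (IAux 2) = W" "rk (W (jo e) - Suc 0) = w"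
      "rk (W (mo e) - Suc 0) = r" "Suc (pm e) < W (mo e) \<longleftrightarrow> D"
      unfolding e_def W_def w_def r_def D_def by simp_all
    note H' = H[unfolded holds_def]
    show ?thesis
    proof (cases D)
      case True
      have y: "y = x(r := 0, e := x e + d, w := 0)" and
        d: "d = min (q (mo e) - L x (mo e) + x r) (min (q (jo e) - L x (jo e) + x w) (c e - x e))"
        unfolding y_def d_def d1_def using True by simp_all
      show ?thesis
        using H' re[OF True] True unfolding settle_def holds_def y d
        by (simp add: vals LDe PM)
    next
      case False
      have y: "y = x(e := x e + d, w := 0)" and
        d: "d = min (q (mo e) - L x (mo e)) (min (q (jo e) - L x (jo e) + x w) (c e - x e))"
        unfolding y_def d_def d1_def using False by simp_all
      show ?thesis
        using H' False unfolding settle_def holds_def y d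
        by (simp add: vals LDe PM)
    qed
  qed
  moreover have le: "L x (jo e) \<le> q (jo e)" "L x (mo e) \<le> q (mo e)"
    using feas eE unfolding feas_def by auto
  have "0 < d1" using le w(4) e(1) unfolding d1_def acc_def by auto
  then have "0 < d" using le r nD unfolding d_def by auto
  moreover have "d \<le> c e - x e" "d \<le> q (jo e) - L x (jo e) + x w" unfolding d_def d1_def by auto
  moreover have "if D then r < nE \<and> mo r = mo e \<and> 0 < x r \<and> pm e < pm r \<and> d \<le> q (mo e) - L x (mo e) + x r
      else d \<le> q (mo e) - L x (mo e)" using r unfolding d_def by auto
  ultimately show ?thesis
    using settle_step[OF feas e(1) w(1,2,4,5) worst _ _ _ _ y_def] by blast
qed

text \<open>\<open>config\<close> speaks about all numbers, while the cells from \<open>nv\<close>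
  on are arbitrary; hence the default 0 there.\<close>

lemma ready_config:
  assumes "ready x l s"
  shows "config x (\<lambda>j. if j < nv then imem s (IAux 3) j else 0) (\<lambda>m. rk (imem s (IAux 2) m - 1))"
  unfolding config_def
proof (intro conjI allI impI)
  have B: "first_acc 0 x j (imem s (IAux 3) j)" if "j < nv" for j
    using assms that unfolding ready_def found_def by blast
  have all: "pj (imem s (IAux 3) (jo f) - 1) \<le> pj f \<and> 0 < imem s (IAux 3) (jo f) \<and> jo f < nv" if "acc x f" for f
  proof -
    have f: "f < nE" using that unfolding acc_def by simp
    then have "jo f < nv" using jo unfolding nv_def by force
    then show ?thesis using B[of "jo f"] pj[OF f] that unfolding first_acc_def by force
  qed
  fix j assume j: "0 < (if j < nv then imem s (IAux 3) j else 0)"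
  then have nv: "j < nv" "0 < imem s (IAux 3) j" by (auto split: if_splits)
  then have *: "acc x (imem s (IAux 3) j - 1)" "jo (imem s (IAux 3) j - 1) = j"
    using B unfolding first_acc_def by blast+
  show "best x ((if j < nv then imem s (IAux 3) j else 0) - 1)"
    unfolding best_def using * nv all by auto
  show "jo ((if j < nv then imem s (IAux 3) j else 0) - 1) = j" using * nv by auto
next
  fix f assume f: "acc x f"
  have f': "f < nE" using f unfolding acc_def by simp
  then have "jo f < nv" using jo unfolding nv_def by force
  then show "0 < (if jo f < nv then imem s (IAux 3) (jo f) else 0)"
    using assms pj[OF f'] f unfolding ready_def found_def first_acc_def by force
next
  fix k assume k: "k < nE" "0 < x k"
  have "worst np x (mo k) (imem s (IAux 2) (mo k))"
    using assms mo[OF k(1)] unfolding ready_def ranked_def by blast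
  note w = worst_machine[OF this k(1) refl]
  have "pm k < imem s (IAux 2) (mo k)" using w(2) k by blast
  then show "rk (imem s (IAux 2) (mo k) - 1) < nE" "mo (rk (imem s (IAux 2) (mo k) - 1)) = mo k"
      "0 < x (rk (imem s (IAux 2) (mo k) - 1))" "pm k \<le> pm (rk (imem s (IAux 2) (mo k) - 1))"
    using w(1) by auto
qed

text \<open>Unlike \<open>ready\<close>, this does not mention the allocation, so it survives pushes
  and shifts. Whether the entries still describe the current allocation is a matter of
  \<open>config\<close>.\<close>

definition tables :: "(nat \<Rightarrow> nat) \<Rightarrow> (nat \<Rightarrow> nat) \<Rightarrow> state \<Rightarrow> bool" where
  "tables P W s \<longleftrightarrow> (\<forall>j<nv. imem s (IAux 3) j = P j) \<and> imem s (IAux 2) = W"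

section \<open>Effects of the loop-free commands\<close>

lemma exec_push_free:
  assumes "holds x l s" "loads x s" "tables P W s" "imem s (IAux 9) 0 = j"
    and "j < nv" "P j - 1 = e" "e < nE" "L x (mo e) < q (mo e)"
    and "y = x(e := x e + min (q (mo e) - L x (mo e)) (min (c e - x e) (q j - L x j)))"
  shows "holds y (l @ [(e, y)]) (exec push s) \<and> imem (exec push s) (IAux 11) 0 = 0"
proof -
  have "rmem s (RAux 0) j = L x j" "rmem s (RAux 0) (mo e) = L x (mo e)" "imem s (IAux 3) j - Suc 0 = e"
    using assms(2,3,5,6) mo[OF assms(7)] unfolding loads_def tables_def by auto
  then show ?thesis
    using assms(1,4,8) unfolding push_def holds_def assms(9) by simp
qed

lemma exec_push_full:
  assumes "holds x l s" "loads x s" "tables P W s" "imem s (IAux 9) 0 = j"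
    and "j < nv" "P j - 1 = e" "e < nE" "\<not> L x (mo e) < q (mo e)" "rk (W (mo e) - 1) = r" "r < nE" "r \<noteq> e"
    and "d = min (x r) (min (c e - x e) (q j - L x j))" and y: "y = x(e := x e + d, r := x r - d)"
    and "s' = exec push s"
  shows "holds y (l @ [(e, y)]) s'" "tables P W s'" "imem s' (IAux 9) 0 = jo r"
    "imem s' (IAux 10) 0 = Suc (imem s (IAux 10) 0)"
    "imem s' (IAux 11) 0 = (if y e < c e \<and> 0 < y r \<and> 0 < P (jo r) then imem s (IAux 11) 0 else 0)"
    "\<forall>v<nv. rmem s' (RAux 0) v = L x v + (if v = j then d else 0) - (if v = jo r then d else 0)"
proof -
  have "jo r < nv" using jo[OF \<open>r < nE\<close>] unfolding nv_def by simp
  then have vals: "rmem s (RAux 0) j = L x j" "rmem s (RAux 0) (mo e) = L x (mo e)" "imem s (IAux 3) j - Suc 0 = e"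
      "imem s (IAux 3) (jo r) = P (jo r)" "rk (imem s (IAux 2) (mo e) - Suc 0) = r" "rmem s (RAux 0) (jo r) = L x (jo r)"
    using assms(2,3,5,6,9) mo[OF assms(7)] unfolding loads_def tables_def by auto
  note H = assms(1)[unfolded holds_def]
  show "holds y (l @ [(e, y)]) s'" "tables P W s'" "imem s' (IAux 9) 0 = jo r"
    "imem s' (IAux 10) 0 = Suc (imem s (IAux 10) 0)"
    using H assms(3,4,8,11) vals unfolding holds_def tables_def y assms(12,14) push_def by simp_all
  show "imem s' (IAux 11) 0 = (if y e < c e \<and> 0 < y r \<and> 0 < P (jo r) then imem s (IAux 11) 0 else 0)"
    using H assms(4,8) assms(11)[symmetric] vals assms(12)[symmetric] unfolding y assms(14) push_def by simp
  show "\<forall>v<nv. rmem s' (RAux 0) v = L x v + (if v = j then d else 0) - (if v = jo r then d else 0)"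
    using H assms(2,4,8,11) vals assms(12)[symmetric] unfolding assms(14) push_def loads_def by simp
qed

lemma exec_shift:
  assumes "holds x l s" "tables P W s" "imem s (IAux 14) 0 = j"
    and "j < nv" "P j - 1 = e" "rk (W (mo e) - 1) = r" "r \<noteq> e"
    and y: "y = x(e := x e + rmem s (RAux d) 0, r := x r - rmem s (RAux 2) 0)"
    and "s' = exec (shift d) s"
  shows "holds y (l @ [(e, y)]) s'" "tables P W s'" "imem s' (IAux 14) 0 = jo r"
    "imem s' (IAux 9) = imem s (IAux 9)" "rmem s' (RAux n) = rmem s (RAux n)"
proof -
  have vals: "imem s (IAux 3) j - Suc 0 = e" "rk (imem s (IAux 2) (mo e) - Suc 0) = r"
    using assms(2,4,5,6) unfolding tables_def by auto
  show "holds y (l @ [(e, y)]) s'" "tables P W s'" "imem s' (IAux 14) 0 = jo r"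
    "imem s' (IAux 9) = imem s (IAux 9)" "rmem s' (RAux n) = rmem s (RAux n)"
    using assms(1,2,3,7) vals unfolding holds_def tables_def y assms(9) shift_def by simp_all
qed

lemma exec_bottleneck:
  assumes "holds x l s" "tables P W s" "imem s (IAux 14) 0 = j"
    and "j < nv" "P j - 1 = e" "rk (W (mo e) - 1) = r" "s' = exec (bottleneck ;; iset 0 (isuc (ivar 0))) s"
  shows "holds x l s'" "tables P W s'" "imem s' (IAux 14) 0 = jo r" "imem s' (IAux 9) = imem s (IAux 9)"
    "rmem s' (RAux 0) = rmem s (RAux 0)" "imem s' (IAux 0) 0 = Suc (imem s (IAux 0) 0)"
    "rmem s' (RAux 2) 0 = min (x r) (min (c e - x e) (rmem s (RAux 2) 0))"
proof -
  have vals: "imem s (IAux 3) j - Suc 0 = e" "rk (imem s (IAux 2) (mo e) - Suc 0) = r"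
    using assms(2,4,5,6) unfolding tables_def by auto
  show "holds x l s'" "tables P W s'" "imem s' (IAux 14) 0 = jo r" "imem s' (IAux 9) = imem s (IAux 9)"
    "rmem s' (RAux 0) = rmem s (RAux 0)" "imem s' (IAux 0) 0 = Suc (imem s (IAux 0) 0)"
    "rmem s' (RAux 2) 0 = min (x r) (min (c e - x e) (rmem s (RAux 2) 0))"
    using assms(1,2,3) vals unfolding holds_def tables_def assms(7) bottleneck_def by simp_all
qed

end

lemma shift_simps [simp]: "loop_free (shift d)" "cost (shift d) = 6"
  unfolding shift_def by simp_all

section \<open>Running time of a rotation\<close>

context indexed begin

lemma wp_rotate:
  fixes P W :: "nat \<Rightarrow> nat" and x :: "nat \<Rightarrow> real" and j :: nat
  defines "p \<equiv> \<lambda>j. P j - 1"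
  defines "r \<equiv> \<lambda>m. rk (W m - 1)"
  defines "re \<equiv> \<lambda>j. r (mo (p j))"
  defines "nxt \<equiv> \<lambda>j. jo (re j)"
  assumes s: "holds x l s" "loads x s" "tables P W s" "imem s (IAux 9) 0 = j"
    and tr: "trace x0 l x" and feas: "feas x" and settled: "settled x"
    and cfg: "config x P r" and live: "L x j < q j"
    and ok: "\<And>k. 0 < P ((nxt ^^ k) j) \<and> q (mo (p ((nxt ^^ k) j))) \<le> L x (mo (p ((nxt ^^ k) j)))"
    and n: "0 < n" "n \<le> nj" "(nxt ^^ n) j = j" "\<And>k. 0 < k \<Longrightarrow> k < n \<Longrightarrow> (nxt ^^ k) j \<noteq> j"
  shows "wp rotate (30 + 16 * nj)
    (\<lambda>s. \<exists>y l. holds y l s \<and> trace x0 l y \<and> feas y \<and> settled y \<and> pot y < pot x) s"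
proof -
  define i where "i = (\<lambda>k. (nxt ^^ k) j)"
  have i0: "i 0 = j" and iS: "i (Suc k) = jo (re (i k))" for k
    unfolding i_def nxt_def by simp_all
  have p: "acc x (p (i k))" "jo (p (i k)) = i k" "p (i k) < nE" "i k < nv" for k
  proof -
    show "acc x (p (i k))" "jo (p (i k)) = i k"
      using cfg ok[of k] unfolding config_def best_def i_def p_def by auto
    then show "p (i k) < nE" unfolding acc_def by simp
    then show "i k < nv" using jo[of "p (i k)"] \<open>jo (p (i k)) = i k\<close> unfolding nv_def by simp
  qed
  have re: "0 < x (re (i k))" "re (i k) \<noteq> p (i k)" for k
    using config_worst[OF cfg p(1)[of k]] ok[of k] unfolding i_def re_def by auto
  \<comment> \<open>As \<open>n \<le> nj\<close>, the first \<open>nj\<close> jobs visited by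
    \<open>bottleneck\<close> include the whole cycle.\<close>
  have i_mod: "\<exists>a<nj. i k = i a" for k
    using funpow_mod_eq[OF n(3), of k] n(1,2) mod_less_divisor[of n k] unfolding i_def
    by (metis order_less_le_trans)
  \<comment> \<open>The last conjunct does not bound \<open>a\<close> by \<open>k\<close>: the
    search starts from the room of the first edge, a value attained before any job has been
    visited.\<close>
  define bounded where "bounded = (\<lambda>(k :: nat) \<theta>. 0 < \<theta> \<and>
    (\<forall>a<k. \<theta> \<le> c (p (i a)) - x (p (i a)) \<and> \<theta> \<le> x (re (i a))) \<and>
    (\<exists>a. \<theta> = c (p (i a)) - x (p (i a)) \<or> \<theta> = x (re (i a))))"
  have room: "0 < c (p (i k)) - x (p (i k))" for k using p(1)[of k] unfolding acc_def by simp
  have bounded_Suc: "bounded (Suc k) (min (x (re (i k))) (min (c (p (i k)) - x (p (i k))) \<theta>))"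
    if "bounded k \<theta>" for k \<theta>
    using that re(1)[of k] room[of k] unfolding bounded_def min_def by (fastforce simp: less_Suc_eq)
  define J where "J = (\<lambda>k s. imem s (IAux 0) 0 = k \<and> holds x l s \<and> tables P W s \<and>
    imem s (IAux 9) 0 = j \<and> rmem s (RAux 0) j = L x j \<and> imem s (IAux 14) 0 = i k \<and>
    bounded k (rmem s (RAux 2) 0))"
  have first: "wp (iset 14 (ivar 9) ;; iset 4 (best_edge (ivar 9)) ;; rset 2 (room (ivar 4))) 3
    (\<lambda>s. J 0 (exec (iset 0 (IConst 0)) s)) s"
  proof (rule wp_exec)
    have e: "imem s (IAux 3) j - Suc 0 = p j" and ld: "rmem s (RAux 0) j = L x j"
      using s(2,3) p(4)[of 0] unfolding tables_def loads_def p_def i0 by auto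
    have "bounded 0 (c (p j) - x (p j))" using room[of 0] unfolding bounded_def i0 using i0 by auto
    then show "J 0 (exec (iset 0 (IConst 0))
        (exec (iset 14 (ivar 9) ;; iset 4 (best_edge (ivar 9)) ;; rset 2 (room (ivar 4))) s))"
      using s(1,3,4) e ld i0 unfolding J_def holds_def tables_def by simp
  qed simp_all
  have search: "wp (For (IGet NJobs (IConst 0)) bottleneck) (2 + nj * 9) (J nj) s"
    if "J 0 (exec (iset 0 (IConst 0)) s)" for s
  proof (rule wp_For[where J = J and N = nj])
    fix k s assume J: "J k s"
    let ?s = "exec (bottleneck ;; iset 0 (isuc (ivar 0))) s"
    note B = exec_bottleneck[of x l s P W "i k" "p (i k)" "re (i k)" ?s]
    show "J (Suc k) ?s"
      using B J p(4)[of k] bounded_Suc[of k] unfolding J_def p_def re_def r_def iS by simp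
  next
    show "imem s (IAux 0) 0 = k \<and> ival (IGet NJobs (IConst 0)) s = nj" if "J k s" for k s
      using that unfolding J_def holds_def by simp
  qed (use that in \<open>simp_all add: bottleneck_def\<close>)
  have finish: "wp ((rset 3 (slack (ivar 9)) ;; cap_by 3 (rvar 2) ;; iset 14 (ivar 9) ;; shift 3) ;;
     While (Not (And (Not (ILess (ivar 14) (ivar 9))) (Not (ILess (ivar 9) (ivar 14))))) (shift 2) ;;
     (iset 4 (best_edge (ivar 9)) ;;
     If (RLess (rvar 3) (rvar 2))
       (RAssign Alloc (ivar 4) (RPlus (RGet Alloc (ivar 4)) (RMinus (rvar 2) (rvar 3))) ;;
        Respond (ivar 4)) Skip)) (20 + 7 * nj)
    (\<lambda>s. \<exists>y l. holds y l s \<and> trace x0 l y \<and> feas y \<and> settled y \<and> pot y < pot x) s"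
    if J: "J nj s" for s
  proof -
    define \<theta> where "\<theta> = rmem s (RAux 2) 0"
    define \<epsilon> where "\<epsilon> = min \<theta> (q j - L x j)"
    have b: "bounded nj \<theta>" using J unfolding J_def \<theta>_def by simp
    have \<theta>: "\<theta> \<le> c (p (i k)) - x (p (i k)) \<and> \<theta> \<le> x (re (i k))" for k
      using b i_mod[of k] unfolding bounded_def by metis
    interpret R: rotation nE jo mo pj pm q c x P r j n \<epsilon> \<theta> p nxt i re
    proof (unfold_locales, goal_cases)
      case (4 k)
      show ?case using ok[of k] unfolding nxt_def re_def p_def .
    next
      case 6
      show ?case using n(3) unfolding nxt_def re_def p_def .
    next
      case (7 k)
      then show ?case using n(4)[of k] unfolding nxt_def re_def p_def by simp
    next
      case (11 k)
      show ?case using \<theta>[of k] unfolding i_def nxt_def re_def p_def .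
    next
      case 12
      have "\<exists>a. \<theta> = c (p (i a)) - x (p (i a)) \<or> \<theta> = x (re (i a))"
        using b unfolding bounded_def by blast
      then show ?case unfolding i_def nxt_def re_def p_def .
    next
      case 13 show "PROP ?case" by (rule p_def)
    next
      case 14 show "PROP ?case" by (rule re_def)
    next
      case 15 show "PROP ?case" by (rule nxt_def)
    next
      case 16 show "PROP ?case" unfolding i_def .
    qed (use feas settled cfg n b live in \<open>simp_all add: bounded_def \<epsilon>_def\<close>)
    \<comment> \<open>The length of the log gives the number of steps made in the lap. No program
      variable counts them, so the log also provides the measure of the loop.\<close>
    define I where "I = (\<lambda>a s. \<exists>l'. holds (R.rot a) l' s \<and> trace x0 l' (R.rot a) \<and>
      length l' = length l + a \<and> tables P W s \<and> imem s (IAux 9) 0 = j \<and> imem s (IAux 14) 0 = i a \<and>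
      rmem s (RAux 3) 0 = \<epsilon> \<and> rmem s (RAux 2) 0 = \<theta>)"
    have I_Suc: "I (Suc a) (exec (shift d) s)"
      if Ia: "I a s" "a < n" "rmem s (RAux d) 0 = (if a = 0 then \<epsilon> else \<theta>)" for a d s
    proof -
      obtain l' where l': "holds (R.rot a) l' s" "trace x0 l' (R.rot a)" "length l' = length l + a"
        "tables P W s" "imem s (IAux 9) 0 = j" "imem s (IAux 14) 0 = i a"
        "rmem s (RAux 3) 0 = \<epsilon>" "rmem s (RAux 2) 0 = \<theta>"
        using Ia(1) unfolding I_def by blast
      have y: "R.rot (Suc a) = (R.rot a)(p (i a) := R.rot a (p (i a)) + rmem s (RAux d) 0,
          re (i a) := R.rot a (re (i a)) - rmem s (RAux 2) 0)"
        using that(3) l'(8) by simp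
      have P: "P (i a) - 1 = p (i a)" "rk (W (mo (p (i a))) - 1) = re (i a)"
        unfolding p_def re_def r_def by simp_all
      note S = exec_shift[OF l'(1,4,6) p(4) P re(2) y refl]
      have "trace x0 (l' @ [(p (i a), R.rot (Suc a))]) (R.rot (Suc a))"
        using trace_snoc[OF l'(2)] R.rot_step[OF that(2) R.feas_rot] that(2) by simp
      then show ?thesis
        unfolding I_def using S l' by (intro exI[of _ "l' @ [(p (i a), R.rot (Suc a))]"]) (simp add: iS del: R.rot.simps)
    qed
    have start: "wp (rset 3 (slack (ivar 9)) ;; cap_by 3 (rvar 2) ;; iset 14 (ivar 9) ;; shift 3) 10 (I 1) s"
    proof (rule wp_exec)
      define s0 where "s0 = exec (rset 3 (slack (ivar 9)) ;; cap_by 3 (rvar 2) ;; iset 14 (ivar 9)) s"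
      have "rmem s (RAux 2) 0 = \<theta>" "min \<theta> (q j - L x j) = \<epsilon>"
        unfolding \<epsilon>_def \<theta>_def by simp_all
      then have "I 0 s0"
        using J tr unfolding I_def J_def s0_def
        by (intro exI[of _ l]) (simp add: i0 holds_def tables_def)
      moreover from this have "rmem s0 (RAux 3) 0 = \<epsilon>" unfolding I_def by blast
      ultimately have "I (Suc 0) (exec (shift 3) s0)" using n(1) by (intro I_Suc) simp_all
      then show "I 1 (exec (rset 3 (slack (ivar 9)) ;; cap_by 3 (rvar 2) ;; iset 14 (ivar 9) ;; shift 3) s)"
        unfolding s0_def by simp
    qed simp_all
    have cycle: "wp (While (Not (And (Not (ILess (ivar 14) (ivar 9))) (Not (ILess (ivar 9) (ivar 14))))) (shift 2))
        (1 + n * 7) (I n) s" if "I 1 s" for s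
    proof (rule wp_mono[OF wp_While[where J = "\<lambda>s. \<exists>a. 0 < a \<and> a \<le> n \<and> I a s" and t = 6 and n = n and
        \<mu> = "\<lambda>s. length l + n - length (step_log s)"] order_refl])
      show "\<exists>a. 0 < a \<and> a \<le> n \<and> I a s" using that n(1) by (intro exI[of _ 1]) simp
      show "length l + n - length (step_log s) \<le> n"
        using that unfolding I_def holds_def by auto
    next
      fix s assume "\<exists>a. 0 < a \<and> a \<le> n \<and> I a s"
        and b: "bval (Not (And (Not (ILess (ivar 14) (ivar 9))) (Not (ILess (ivar 9) (ivar 14))))) s"
      then obtain a where a: "0 < a" "a \<le> n" "I a s" by blast
      have "i a \<noteq> j" using b a(3) unfolding I_def by auto
      then have less: "a < n" using a n(3) unfolding i_def by (metis le_neq_implies_less)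
      have "rmem s (RAux 2) 0 = \<theta>" using a(3) unfolding I_def by blast
      then have I: "I (Suc a) (exec (shift 2) s)" using a less by (intro I_Suc) simp_all
      have len: "length (step_log s) = length l + a" if "I a s" for a s
        using that unfolding I_def holds_def by auto
      show "wp (shift 2) 6 (\<lambda>s'. (\<exists>a. 0 < a \<and> a \<le> n \<and> I a s') \<and>
          length l + n - length (step_log s') < length l + n - length (step_log s)) s"
        by (rule wp_exec) (use I less len[OF I] len[OF a(3)] in \<open>auto intro!: exI[of _ "Suc a"]\<close>)
    next
      fix s assume "(\<exists>a. 0 < a \<and> a \<le> n \<and> I a s) \<and>
        \<not> bval (Not (And (Not (ILess (ivar 14) (ivar 9))) (Not (ILess (ivar 9) (ivar 14))))) s"
      then obtain a where a: "0 < a" "a \<le> n" "I a s" "imem s (IAux 14) 0 = imem s (IAux 9) 0" by auto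
      then have "i a = j" unfolding I_def by auto
      \<comment> \<open>By minimality of the period the loop stops only when the lap is
        complete.\<close>
      then have "a = n" using n(4)[of a] a unfolding i_def by fastforce
      then show "I n s" using a by simp
    qed simp_all
    have final: "wp (iset 4 (best_edge (ivar 9)) ;; If (RLess (rvar 3) (rvar 2))
       (RAssign Alloc (ivar 4) (RPlus (RGet Alloc (ivar 4)) (RMinus (rvar 2) (rvar 3))) ;;
        Respond (ivar 4)) Skip) 4
      (\<lambda>s. \<exists>y l. holds y l s \<and> trace x0 l y \<and> feas y \<and> settled y \<and> pot y < pot x) s"
      if I: "I n s" for s
    proof (rule wp_exec)
      let ?s = "exec (iset 4 (best_edge (ivar 9)) ;; If (RLess (rvar 3) (rvar 2))
       (RAssign Alloc (ivar 4) (RPlus (RGet Alloc (ivar 4)) (RMinus (rvar 2) (rvar 3))) ;;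
        Respond (ivar 4)) Skip) s"
      obtain l' where l': "holds (R.rot n) l' s" "trace x0 l' (R.rot n)" "tables P W s"
        "imem s (IAux 9) 0 = j" "rmem s (RAux 3) 0 = \<epsilon>" "rmem s (RAux 2) 0 = \<theta>"
        using I unfolding I_def by blast
      have e: "imem s (IAux 3) j - Suc 0 = p j"
        using l'(3) p(4)[of 0] unfolding tables_def p_def i0 by auto
      have "\<exists>l. holds R.rotated l ?s \<and> trace x0 l R.rotated"
      proof (cases "\<epsilon> < \<theta>")
        case True
        show ?thesis
        proof (intro exI conjI)
          show "holds R.rotated (l' @ [(p j, R.rotated)]) ?s"
            using l'(1,4,5,6) e True unfolding holds_def R.rotated_def by simp
          show "trace x0 (l' @ [(p j, R.rotated)]) R.rotated"
            by (rule trace_snoc[OF l'(2) R.rotated_step[OF True]])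
        qed
      next
        case False
        then have "\<epsilon> = \<theta>" unfolding \<epsilon>_def by simp
        then show ?thesis using R.rotated_idle l'(1,2,5,6) by (auto simp: holds_def)
      qed
      then show "\<exists>y l. holds y l ?s \<and> trace x0 l y \<and> feas y \<and> settled y \<and> pot y < pot x"
        using R.feas_rotated R.rotated_settled R.rotated_pot by blast
    qed simp_all
    show ?thesis
      by (rule wp_Seq[OF start wp_Seq[OF cycle final order_refl]]) (use n(2) in simp_all)
  qed
  show ?thesis
    unfolding rotate_def
    by (rule wp_Seq[OF first wp_Seq[OF search finish order_refl]]) simp_all
qed

end

lemma push_simps [simp]: "loop_free push" "cost push = 18"
  unfolding push_def by simp_all

lemma settle_simps [simp]: "loop_free settle" "cost settle = 15"
  unfolding settle_def by simp_all

section \<open>Running time of a round of pushes\<close>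

context indexed begin

lemma wp_play:
  assumes ready: "ready x l s" and tr: "trace x0 l x" and feas: "feas x" and settled: "settled x"
    and F: "0 < imem s (IAux 7) 0"
  shows "wp play (100 * nv\<^sup>2)
    (\<lambda>s. \<exists>y l. holds y l s \<and> trace x0 l y \<and> feas y \<and> settled y \<and> pot y < pot x) s"
proof -
  define P where "P = (\<lambda>j. if j < nv then imem s (IAux 3) j else 0)"
  define W where "W = imem s (IAux 2)"
  define p where "p = (\<lambda>j. P j - 1)"
  define r where "r = (\<lambda>m. rk (W m - 1))"
  define re where "re = (\<lambda>j. r (mo (p j)))"
  define nxt where "nxt = (\<lambda>j. jo (re j))"
  define j where "j = jo (imem s (IAux 7) 0 - 1)"
  define ok where "ok = (\<lambda>y j. 0 < P j \<and> q (mo (p j)) \<le> L y (mo (p j)))"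
  have P: "p j < nE" "jo (p j) = j" "best y (p j)" "j < nj" "j < nv" if "config y P r" "0 < P j" for y j
  proof -
    show "jo (p j) = j" "best y (p j)" using that unfolding config_def p_def by auto
    then show "p j < nE" unfolding best_def acc_def by simp
    then show "j < nj" using jo[of "p j"] \<open>jo (p j) = j\<close> by simp
    then show "j < nv" unfolding nv_def by simp
  qed
  \<comment> \<open>A cleared flag means that the potential has already dropped, and nothing is
    claimed about the tables. A set flag means that all pushes so far were uneventful and went to
    full machines along \<open>nxt\<close>.\<close>
  define I where "I = (\<lambda>s. \<exists>y l. holds y l s \<and> trace x0 l y \<and> feas y \<and> settled y \<and>
    (imem s (IAux 11) 0 = 0 \<longrightarrow> pot y < pot x) \<and>
    (0 < imem s (IAux 11) 0 \<longrightarrow> pot y \<le> pot x \<and> loads y s \<and> tables P W s \<and> config y P r \<and>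
       0 < P (imem s (IAux 9) 0) \<and> L y (imem s (IAux 9) 0) < q (imem s (IAux 9) 0) \<and>
       imem s (IAux 9) 0 = (nxt ^^ imem s (IAux 10) 0) j \<and> imem s (IAux 10) 0 \<le> nj \<and>
       (\<forall>k < imem s (IAux 10) 0. ok y ((nxt ^^ k) j))))"
  define cond where "cond = And (ILess (IConst 0) (ivar 11)) (ILess (ivar 10) (IGet NJobs (IConst 0)))"
  have start: "wp (iset 9 (at_job (idec (ivar 7))) ;; iset 10 (IConst 0) ;; iset 11 (IConst 1)) 3 I s"
  proof (rule wp_exec)
    let ?s = "exec (iset 9 (at_job (idec (ivar 7))) ;; iset 10 (IConst 0) ;; iset 11 (IConst 1)) s"
    have H: "holds x l s" "loads x s" using ready unfolding ready_def by auto
    have cfg: "config x P r" using ready_config[OF ready] unfolding P_def r_def W_def .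
    define e where "e = imem s (IAux 7) 0 - 1"
    have e: "acc x e" "L x (jo e) < q (jo e)"
      using ready F unfolding ready_def found_def witness_def e_def by auto
    then have "0 < P j" using cfg unfolding config_def j_def e_def by auto
    then show "I ?s"
      using H tr feas settled cfg e(2) unfolding I_def
      by (intro exI[of _ x] exI[of _ l])
        (simp add: holds_def loads_def tables_def j_def e_def P_def W_def)
  qed simp_all
  have loop: "wp (While cond push) (1 + nj * 19) (\<lambda>s. I s \<and> \<not> bval cond s) s" if "I s" for s
  proof (rule wp_While[where t = 18 and n = nj and
      \<mu> = "\<lambda>s. if 0 < imem s (IAux 11) 0 then nj - imem s (IAux 10) 0 else 0"])
    fix s assume I: "I s" and b: "bval cond s"
    then obtain y l where H: "holds y l s" and tr: "trace x0 l y" and feas: "feas y" and settled: "settled y"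
      and go: "0 < imem s (IAux 11) 0"
      and Y: "pot y \<le> pot x" "loads y s" "tables P W s" "config y P r"
      and PJ: "0 < P (imem s (IAux 9) 0)" and live: "L y (imem s (IAux 9) 0) < q (imem s (IAux 9) 0)"
      and J: "imem s (IAux 9) 0 = (nxt ^^ imem s (IAux 10) 0) j"
      and OK: "\<And>k. k < imem s (IAux 10) 0 \<Longrightarrow> ok y ((nxt ^^ k) j)"
      unfolding I_def cond_def by auto
    have less: "imem s (IAux 10) 0 < nj" using b H unfolding cond_def holds_def by auto
    define h where "h = imem s (IAux 9) 0"
    define e where "e = p h"
    note Ph = P[OF Y(4) PJ, folded h_def, folded e_def]
    have Pe: "P h - 1 = e" unfolding e_def p_def ..
    have acc: "acc y e" using Ph(3) unfolding best_def by simp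
    have pos: "0 < c e - y e" "0 < q h - L y h" using acc live unfolding acc_def h_def by auto
    define s' where "s' = exec push s"
    have "I s' \<and> (if 0 < imem s' (IAux 11) 0 then nj - imem s' (IAux 10) 0 else 0) < nj - imem s (IAux 10) 0"
    proof (cases "L y (mo e) < q (mo e)")
      case True
      define d where "d = min (q (mo e) - L y (mo e)) (min (c e - y e) (q h - L y h))"
      define z where "z = y(e := y e + d)"
      have "holds z (l @ [(e, z)]) s' \<and> imem s' (IAux 11) 0 = 0"
        using exec_push_free[OF H Y(2,3) h_def[symmetric] Ph(5) Pe Ph(1) True z_def[unfolded d_def]]
        unfolding s'_def .
      moreover have "br e y z" "settled z" "pot z < pot y"
        by (rule free_push[OF feas settled Ph(3) True _ _ _ _ _ _ z_def];
            use pos True Ph(2) in \<open>auto simp: d_def min_def\<close>)+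
      ultimately show ?thesis
        using trace_snoc[OF tr, of e z] br_feas[of e y z] Y(1) less unfolding I_def
        by (auto intro!: exI[of _ z] exI[of _ "l @ [(e, z)]"])
    next
      case False
      define R where "R = r (mo e)"
      define d where "d = min (y R) (min (c e - y e) (q h - L y h))"
      define z where "z = y(e := y e + d, R := y R - d)"
      have full: "q (mo e) \<le> L y (mo e)" using False by simp
      note Rf = config_worst[OF Y(4) acc full, folded R_def]
      have RW: "rk (W (mo e) - 1) = R" unfolding R_def r_def ..
      note E = exec_push_full[OF H Y(2,3) h_def[symmetric] Ph(5) Pe Ph(1) False RW Rf(1,7) d_def z_def s'_def]
      have d: "0 < d" "d \<le> q (jo e) - L y (jo e)" "d \<le> c e - y e" "d \<le> y R"
        "d = q (jo e) - L y (jo e) \<or> d = c e - y e \<or> d = y R"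
        using pos Rf(3) Ph(2) unfolding d_def min_def by auto
      have live': "L y (jo e) < q (jo e)" using live Ph(2) unfolding h_def by simp
      note F = full_push[OF feas settled Y(4) Ph(3) R_def full live' d z_def]
      note tr' = trace_snoc[OF tr F(1)]
      have J': "imem s' (IAux 9) 0 = (nxt ^^ imem s' (IAux 10) 0) j"
        using E(3,4) J unfolding nxt_def re_def h_def e_def R_def by simp
      \<comment> \<open>Pushes to full machines keep all machine loads, so the jobs passed earlier
        still propose to full machines.\<close>
      have mach: "L z (mo k) = L y (mo k)" if "k < nE" for k
        using F(5)[of "mo k"] bip[OF Ph(1) that] bip[OF Rf(1) that] by auto
      have OK': "ok z ((nxt ^^ k) j)" if "k < imem s' (IAux 10) 0" for k
      proof (cases "k = imem s (IAux 10) 0")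
        case True
        then have "(nxt ^^ k) j = h" using J h_def by simp
        then show ?thesis using PJ full mach[OF Ph(1)] unfolding ok_def h_def[symmetric] e_def by simp
      next
        case False
        then have o: "ok y ((nxt ^^ k) j)" using that E(4) OK by simp
        then have "p ((nxt ^^ k) j) < nE" using P(1)[OF Y(4)] unfolding ok_def by blast
        then show ?thesis using o mach unfolding ok_def by auto
      qed
      have "loads z s'"
        using E(6) F(5) Ph(2) unfolding loads_def by simp
      then have "I s'"
        unfolding I_def
        using E(1,2,3,4,5) F(2,3,4) tr' br_feas[OF F(1)] J' OK' Y(1) less go
        by (intro exI[of _ z] exI[of _ "l @ [(e, z)]"]) auto
      then show ?thesis using E(4) less by auto
    qed
    then show "wp push 18 (\<lambda>s'. I s' \<and>
        (if 0 < imem s' (IAux 11) 0 then nj - imem s' (IAux 10) 0 else 0) <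
        (if 0 < imem s (IAux 11) 0 then nj - imem s (IAux 10) 0 else 0)) s"
      using go unfolding s'_def by (intro wp_exec) simp_all
  qed (use that in auto)
  have last: "wp (If (ILess (IConst 0) (ivar 11)) rotate Skip) (31 + 16 * nj)
    (\<lambda>s. \<exists>y l. holds y l s \<and> trace x0 l y \<and> feas y \<and> settled y \<and> pot y < pot x) s"
    if Is: "I s \<and> \<not> bval cond s" for s
  proof (rule wp_If[where t = "30 + 16 * nj"])
    assume "\<not> bval (ILess (IConst 0) (ivar 11)) s"
    then show "wp Skip (30 + 16 * nj)
        (\<lambda>s. \<exists>y l. holds y l s \<and> trace x0 l y \<and> feas y \<and> settled y \<and> pot y < pot x) s"
      using Is unfolding I_def by (intro wp_exec) auto
  next
    assume go: "bval (ILess (IConst 0) (ivar 11)) s"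
    then obtain y l where H: "holds y l s" and tr: "trace x0 l y" and feas: "feas y" and settled: "settled y"
      and Y: "pot y \<le> pot x" "loads y s" "tables P W s" "config y P r"
      and PJ: "0 < P (imem s (IAux 9) 0)" and live: "L y (imem s (IAux 9) 0) < q (imem s (IAux 9) 0)"
      and J: "imem s (IAux 9) 0 = (nxt ^^ imem s (IAux 10) 0) j"
      and le: "imem s (IAux 10) 0 \<le> nj"
      and OK: "\<And>k. k < imem s (IAux 10) 0 \<Longrightarrow> ok y ((nxt ^^ k) j)"
      using Is unfolding I_def by auto
    \<comment> \<open>The loop was left with the flag set, so the counter stopped it.\<close>
    have cnt: "imem s (IAux 10) 0 = nj" using Is go le H unfolding cond_def holds_def by auto
    define h where "h = imem s (IAux 9) 0"
    have h: "h = (nxt ^^ nj) j" using J cnt unfolding h_def by simp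
    have bound: "(nxt ^^ k) j < nj" if "k \<le> nj" for k
    proof -
      have "0 < P ((nxt ^^ k) j)"
        using OK[of k] PJ that cnt h unfolding ok_def h_def by (cases "k = nj") auto
      then show ?thesis by (rule P(4)[OF Y(4)])
    qed
    note returns = funpow_returns[of nj nxt j, OF bound]
    \<comment> \<open>Choosing the least period makes the edges of one lap distinct.\<close>
    define n where "n = (LEAST n. 0 < n \<and> (nxt ^^ n) h = h)"
    obtain n' where n': "0 < n'" "n' \<le> nj" "(nxt ^^ n') h = h" using returns(1) unfolding h by blast
    have n: "0 < n \<and> (nxt ^^ n) h = h"
      unfolding n_def by (rule LeastI[of _ n']) (use n' in simp)
    have "n \<le> n'" unfolding n_def by (rule Least_le) (use n' in simp)
    have min: "(nxt ^^ k) h \<noteq> h" if "0 < k" "k < n" for k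
      using not_less_Least[of k "\<lambda>n. 0 < n \<and> (nxt ^^ n) h = h"] that unfolding n_def by blast
    \<comment> \<open>Every job on the cycle occurs among the first \<open>nj\<close> ones, all of
      which pushed to full machines.\<close>
    have okh: "ok y ((nxt ^^ k) h)" for k
    proof -
      obtain a where "a < nj" "(nxt ^^ (k + nj)) j = (nxt ^^ a) j" using returns(2)[of "k + nj"] by blast
      then show ?thesis using OK[of a] cnt unfolding h by (simp add: funpow_add)
    qed
    have "wp rotate (30 + 16 * nj)
        (\<lambda>s. \<exists>z l. holds z l s \<and> trace x0 l z \<and> feas z \<and> settled z \<and> pot z < pot y) s"
    proof (rule wp_rotate[where n = n, OF H Y(2,3) h_def[symmetric] tr feas settled])
      show "config y P (\<lambda>m. rk (W m - 1))" using Y(4) unfolding r_def .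
      show "L y h < q h" using live unfolding h_def .
      show "0 < n" "n \<le> nj" using n \<open>n \<le> n'\<close> n'(2) by auto
    qed (use okh n min in \<open>auto simp: ok_def nxt_def re_def r_def p_def\<close>)
    then show "wp rotate (30 + 16 * nj)
        (\<lambda>s. \<exists>y l. holds y l s \<and> trace x0 l y \<and> feas y \<and> settled y \<and> pot y < pot x) s"
      by (rule wp_mono) (use Y(1) in \<open>auto intro: less_le_trans\<close>)
  qed simp
  have "0 < nv" using mo[OF nE(1)] by simp
  then have "1 \<le> nv\<^sup>2" "nv \<le> nv\<^sup>2" by (simp_all add: Suc_le_eq power2_eq_square)
  then have T: "3 + (1 + nj * 19 + (31 + 16 * nj)) \<le> 100 * nv\<^sup>2" unfolding nv_def by linarith
  show ?thesis
    unfolding play_def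
    by (rule wp_Seq[OF start wp_Seq[OF loop[unfolded cond_def] last[unfolded cond_def] order_refl] T])
qed

section \<open>Stability and the total running time\<close>

definition stable :: "(nat \<Rightarrow> real) \<Rightarrow> bool" where
  "stable x \<longleftrightarrow> (\<forall>e<nE. \<not> blk x e)"

lemma ready_settled:
  assumes ready: "ready x l s" and F: "imem s (IAux 6) 0 = 0"
  shows "settled x"
  unfolding settled_def
proof (intro allI impI, rule ccontr)
  fix e k assume e: "acc x e" and k: "k < nE" "jo k = jo e" "0 < x k" "\<not> pj k \<le> pj e"
  have eE: "e < nE" using e unfolding acc_def by simp
  then have "jo e < nv" using jo unfolding nv_def by force
  then have "worst np x (jo e) (imem s (IAux 2) (jo e))" using ready unfolding ready_def ranked_def by blast
  then have "pj k < imem s (IAux 2) (jo e)" using worst_job(2) eE k by blast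
  then have "Suc (pj e) < imem s (IAux 2) (jo e)" using k(4) by simp
  then show False
    using ready F e pj[OF eE] unfolding ready_def found_def witness_def by force
qed

lemma ready_stable:
  assumes ready: "ready x l s" and settled: "settled x" and F: "imem s (IAux 7) 0 = 0"
  shows "stable x"
  unfolding stable_def
proof (intro allI impI notI)
  fix e assume e: "e < nE" "blk x e"
  then have acc: "acc x e" unfolding blk_def by simp
  then have "L x (jo e) < q (jo e)" using e settled unfolding blk_def settled_def by fastforce
  then show False using ready F acc pj[OF e(1)] unfolding ready_def found_def witness_def by force
qed

text \<open>At most \<open>nE\<close> settling steps and \<open>7 * nE\<close> rounds of pushes are
  made, each followed by \<open>configure\<close>. With all lower terms bounded by
  \<open>nv\<^sup>2 * nE\<close> the coefficients add up to 1269, rounded up to 2000.\<close>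

lemma wp_stabilize:
  assumes H: "holds x [] s" and feas: "feas x"
  shows "wp stabilize (2000 * (nv\<^sup>2 * nE))
    (\<lambda>s. \<exists>y l. holds y l s \<and> trace x l y \<and> feas y \<and> stable y) s"
proof -
  define I where "I = (\<lambda>s. \<exists>y l. ready y l s \<and> trace x l y \<and> feas y)"
  define K where "K = (\<lambda>s. \<exists>y l. ready y l s \<and> trace x l y \<and> feas y \<and> settled y)"
  have "0 < nv" using mo[OF nE(1)] by simp
  then have nv2: "1 \<le> nv\<^sup>2" by simp
  have first: "wp configure (60 * nv\<^sup>2) I s"
    by (rule wp_mono[OF wp_configure[OF H] order_refl]) (use feas in \<open>auto simp: I_def intro!: exI[of _ "[]"]\<close>)
  have one: "wp (While (ILess (IConst 0) (ivar 6)) (settle ;; configure))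
      (1 + nE * (18 + 60 * nv\<^sup>2 + 1)) K s" if "I s" for s
  \<comment> \<open>The invariant hides the allocation behind a quantifier, so the measure reads it
    off \<open>Alloc\<close>.\<close>
  proof (rule wp_mono[OF wp_While[where J = I and n = nE and \<mu> = "\<lambda>s. card (tail_free (rmem s Alloc))"] order_refl])
    fix s assume "I s" and b: "bval (ILess (IConst 0) (ivar 6)) s"
    then obtain y l where y: "ready y l s" "trace x l y" "feas y" unfolding I_def by blast
    have "rmem s Alloc = y" using y(1) unfolding ready_def holds_def by simp
    obtain e z where z: "holds z (l @ [(e, z)]) (exec settle s)" "br e y z" "card (tail_free z) < card (tail_free y)"
      using exec_settle[OF y(1,3)] b by auto
    show "wp (settle ;; configure) (18 + 60 * nv\<^sup>2)
        (\<lambda>s'. I s' \<and> card (tail_free (rmem s' Alloc)) < card (tail_free (rmem s Alloc))) s"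
    proof (rule wp_Seq[where R = "holds z (l @ [(e, z)])" and u = "60 * nv\<^sup>2"])
      show "wp settle 18 (holds z (l @ [(e, z)])) s" by (rule wp_exec) (use z in simp_all)
      fix s' assume "holds z (l @ [(e, z)]) s'"
      then show "wp configure (60 * nv\<^sup>2)
          (\<lambda>s'. I s' \<and> card (tail_free (rmem s' Alloc)) < card (tail_free (rmem s Alloc))) s'"
        by (rule wp_mono[OF wp_configure order_refl])
          (use z trace_snoc[OF y(2) z(2)] br_feas[OF z(2)] \<open>rmem s Alloc = y\<close> in
            \<open>auto simp: I_def ready_def holds_def intro!: exI[of _ "l @ [(e, z)]"]\<close>)
    qed simp
  next
    show "I s \<and> \<not> bval (ILess (IConst 0) (ivar 6)) s \<Longrightarrow> K s" for s
      using ready_settled unfolding I_def K_def by (metis bval.simps(1) ival.simps(1,2) neq0_conv)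
  qed (use that card_tail_free in auto)
  have two: "wp (While (ILess (IConst 0) (ivar 7)) (play ;; configure))
      (1 + 7 * nE * (100 * nv\<^sup>2 + 60 * nv\<^sup>2 + 1))
      (\<lambda>s. \<exists>y l. holds y l s \<and> trace x l y \<and> feas y \<and> stable y) s" if "K s" for s
  proof (rule wp_mono[OF wp_While[where J = K and n = "7 * nE" and \<mu> = "\<lambda>s. pot (rmem s Alloc)"] order_refl])
    fix s assume "K s" and b: "bval (ILess (IConst 0) (ivar 7)) s"
    then obtain y l where y: "ready y l s" "trace x l y" "feas y" "settled y" unfolding K_def by blast
    have "rmem s Alloc = y" using y(1) unfolding ready_def holds_def by simp
    show "wp (play ;; configure) (100 * nv\<^sup>2 + 60 * nv\<^sup>2)
        (\<lambda>s'. K s' \<and> pot (rmem s' Alloc) < pot (rmem s Alloc)) s"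
    proof (rule wp_Seq[OF wp_play[OF y]])
      show "0 < imem s (IAux 7) 0" using b by simp
      fix s' assume "\<exists>z l. holds z l s' \<and> trace x l z \<and> feas z \<and> settled z \<and> pot z < pot y"
      then obtain z l where z: "holds z l s'" "trace x l z" "feas z" "settled z" "pot z < pot y" by blast
      show "wp configure (60 * nv\<^sup>2) (\<lambda>s'. K s' \<and> pot (rmem s' Alloc) < pot (rmem s Alloc)) s'"
        by (rule wp_mono[OF wp_configure[OF z(1)] order_refl])
          (use z \<open>rmem s Alloc = y\<close> in \<open>auto simp: K_def ready_def holds_def\<close>)
    qed simp
  next
    show "K s \<and> \<not> bval (ILess (IConst 0) (ivar 7)) s \<Longrightarrow>
        \<exists>y l. holds y l s \<and> trace x l y \<and> feas y \<and> stable y" for s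
      using ready_stable unfolding K_def by (metis bval.simps(1) ival.simps(1,2) neq0_conv ready_def)
  qed (use that pot_le in auto)
  have "wp (configure ;; While (ILess (IConst 0) (ivar 6)) (settle ;; configure) ;;
      While (ILess (IConst 0) (ivar 7)) (play ;; configure))
      (60 * nv\<^sup>2 + (1 + nE * (18 + 60 * nv\<^sup>2 + 1) + (1 + 7 * nE * (100 * nv\<^sup>2 + 60 * nv\<^sup>2 + 1))))
      (\<lambda>s. \<exists>y l. holds y l s \<and> trace x l y \<and> feas y \<and> stable y) s"
    by (rule wp_Seq[OF first wp_Seq[OF one two order_refl] order_refl])
  moreover have "1 + (60 * nv\<^sup>2 + (1 + nE * (18 + 60 * nv\<^sup>2 + 1) + (1 + 7 * nE * (100 * nv\<^sup>2 + 60 * nv\<^sup>2 + 1))))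
      \<le> 2000 * (nv\<^sup>2 * nE)"
  proof -
    have "nv\<^sup>2 \<le> nv\<^sup>2 * nE" "nE \<le> nv\<^sup>2 * nE" "1 \<le> nv\<^sup>2 * nE" using nv2 nE(1) by auto
    moreover have "nE * (18 + 60 * nv\<^sup>2 + 1) = 19 * nE + 60 * (nv\<^sup>2 * nE)"
      "7 * nE * (100 * nv\<^sup>2 + 60 * nv\<^sup>2 + 1) = 7 * nE + 1120 * (nv\<^sup>2 * nE)"
      by (simp_all add: algebra_simps)
    ultimately show ?thesis by linarith
  qed
  ultimately show ?thesis
    unfolding stabilize_def using H nE(1) by (intro wp_If) (auto simp: holds_def)
qed

end

section \<open>Encoded instances\<close>

lemma concat_nth:
  "i < length xss \<Longrightarrow> d < length (xss ! i) \<Longrightarrow>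
     concat xss ! ((\<Sum>k<i. length (xss ! k)) + d) = xss ! i ! d"
proof (induction xss arbitrary: i)
  case (Cons xs xss)
  then show ?case
    by (cases i) (simp_all add: nth_append sum.lessThan_Suc_shift add.assoc del: sum.lessThan_Suc)
qed simp

text \<open>Rankings are finite, so among the positive edges there is one of largest position. It is
  the worst positive one, and it lies below \<open>e\<close> if any positive edge does.\<close>

lemma prefers_positive_iff:
  assumes "valid_instance I" "v \<in> vertices I"
  shows "(\<exists>f. worst_positive I x v f \<and> prefers I v e f) \<longleftrightarrow> (\<exists>f. 0 < x f \<and> prefers I v e f)"
proof
  assume "\<exists>f. 0 < x f \<and> prefers I v e f"
  then obtain i k where ik: "i < k" "k < length (ranking I v)" "ranking I v ! i = e" "0 < x (ranking I v ! k)"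
    unfolding prefers_def by auto
  define D where "D = {d. d < length (ranking I v) \<and> 0 < x (ranking I v ! d)}"
  have D: "finite D" "k \<in> D" unfolding D_def using ik by auto
  define m where "m = Max D"
  have m: "m \<in> D" "k \<le> m" unfolding m_def using D by (auto intro: Max_in Max_ge)
  have set: "set (ranking I v) = incident I v" using assms unfolding valid_instance_def by blast
  have "worst_positive I x v (ranking I v ! m)"
    unfolding worst_positive_def
  proof (intro conjI ballI impI)
    show "ranking I v ! m \<in> incident I v" "0 < x (ranking I v ! m)"
      using m(1) nth_mem[of m "ranking I v"] unfolding D_def set by simp_all
    fix g assume g: "g \<in> incident I v" "0 < x g"
    then obtain d where d: "d < length (ranking I v)" "ranking I v ! d = g"
      unfolding set[symmetric] in_set_conv_nth by blast
    then have "d \<in> D" using g unfolding D_def by simp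
    then have "d \<le> m" unfolding m_def using D(1) by simp
    then consider "d = m" | "d < m" by linarith
    then show "g = ranking I v ! m \<or> prefers I v g (ranking I v ! m)"
    proof cases
      case 2
      then have "prefers I v g (ranking I v ! m)"
        unfolding prefers_def using d m(1) D_def by (intro exI[of _ d] exI[of _ m]) simp
      then show ?thesis ..
    qed (use d in simp)
  qed
  moreover have "prefers I v e (ranking I v ! m)"
    using ik m unfolding prefers_def D_def by (intro exI[of _ i] exI[of _ m]) auto
  ultimately show "\<exists>f. worst_positive I x v f \<and> prefers I v e f" by blast
qed (auto simp: worst_positive_def)

locale encoding =
  fixes I :: "'v alloc_instance" and x0 :: "'v allocation" and js ms :: "'v list" and es :: "'v edge list"
    and s :: state
  assumes valid: "valid_instance I" and enc: "encodes I x0 js ms es s"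
begin

section \<open>Vertex numbers and positions of an encoded instance\<close>

definition vs where "vs = js @ ms"
definition jo where "jo = imem s JobOf"
definition mo where "mo = imem s MachineOf"
definition rk where "rk = imem s Ranked"
definition base where "base = imem s First"
definition npj where "npj = base (length js)"
definition np where "np = base (length vs)"
text \<open>Each edge occurs once in the rankings of the jobs and once in those of the machines;
  \<open>pj\<close> and \<open>pm\<close> invert \<open>rk\<close> on these two halves.\<close>

definition pj where "pj e = (SOME p. p < npj \<and> rk p = e)"
definition pm where "pm e = (SOME p. npj \<le> p \<and> p < np \<and> rk p = e)"
definition rank where "rank i = ranking I (vs ! i)"

lemma vs: "distinct vs" "set vs = vertices I" "length vs = length js + length ms"
  "length vs = card (vertices I)"
proof -
  show d: "distinct vs" and v: "set vs = vertices I" and "length vs = length js + length ms"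
    using enc valid unfolding encodes_def valid_instance_def vs_def vertices_def by auto
  show "length vs = card (vertices I)" using distinct_card[OF d] v by simp
qed

lemma es: "distinct es" "set es = edges I" "length es = card (edges I)"
proof -
  show d: "distinct es" and e: "set es = edges I" using enc unfolding encodes_def by auto
  show "length es = card (edges I)" using distinct_card[OF d] e by simp
qed

text \<open>Jobs are numbered before machines and the color classes are disjoint, so comparing a
  number with \<open>length js\<close> tells its side.\<close>

lemma ends:
  assumes "e < length es"
  shows "jo e < length js" "vs ! jo e = fst (es ! e)" "length js \<le> mo e" "mo e < length vs"
    "vs ! mo e = snd (es ! e)"
proof -
  have E: "jo e < length vs" "vs ! jo e = fst (es ! e)" "mo e < length vs" "vs ! mo e = snd (es ! e)"
    using enc assms unfolding encodes_def jo_def mo_def vs_def by auto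
  have "es ! e \<in> edges I" using assms es(2) nth_mem by blast
  then have fs: "fst (es ! e) \<in> jobs I" "snd (es ! e) \<in> machines I"
    using valid unfolding valid_instance_def by auto
  have jm: "jobs I \<inter> machines I = {}" "set js = jobs I" "set ms = machines I"
    using enc valid unfolding encodes_def valid_instance_def by auto
  show "jo e < length js"
  proof (rule ccontr)
    assume "\<not> jo e < length js"
    then have "vs ! jo e \<in> set ms" using E(1) unfolding vs_def by (simp add: nth_append)
    then show False using E(2) fs jm by auto
  qed
  show "length js \<le> mo e"
  proof (rule ccontr)
    assume "\<not> length js \<le> mo e"
    then have "vs ! mo e \<in> set js" unfolding vs_def by (simp add: nth_append)
    then show False using E(4) fs jm by auto
  qed
qed (use enc assms in \<open>auto simp: encodes_def jo_def mo_def vs_def\<close>)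

lemma ends_eq:
  assumes "e < length es" "i < length vs"
  shows "fst (es ! e) = vs ! i \<longleftrightarrow> jo e = i" "snd (es ! e) = vs ! i \<longleftrightarrow> mo e = i"
  using ends[OF assms(1)] nth_eq_iff_index_eq[OF vs(1)] assms(2) vs(3) by (metis trans_less_add1)+

lemma rank:
  assumes "i < length vs"
  shows "distinct (rank i)" "set (rank i) = incident I (vs ! i)"
    "base (Suc i) = base i + length (rank i)"
    "d < length (rank i) \<Longrightarrow> rk (base i + d) < length es \<and> es ! rk (base i + d) = rank i ! d"
proof -
  have "vs ! i \<in> vertices I" using assms vs(2) nth_mem by blast
  then show "distinct (rank i)" "set (rank i) = incident I (vs ! i)"
    using valid unfolding valid_instance_def rank_def by auto
  show "base (Suc i) = base i + length (rank i)"
    "d < length (rank i) \<Longrightarrow> rk (base i + d) < length es \<and> es ! rk (base i + d) = rank i ! d"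
    using enc assms unfolding encodes_def rank_def base_def rk_def vs_def by auto
qed

lemma base_0: "base 0 = 0"
  using enc unfolding encodes_def base_def by simp

lemma base_mono: "i \<le> k \<Longrightarrow> k \<le> length vs \<Longrightarrow> base i \<le> base k"
proof (induction k)
  case (Suc k)
  then show ?case using rank(3)[of k] by (cases "i = Suc k") auto
qed simp

lemma position:
  assumes "base a \<le> p" "p < base k" "k \<le> length vs" "a \<le> length vs"
  obtains i d where "a \<le> i" "i < k" "d < length (rank i)" "p = base i + d"
  using assms
proof (induction k arbitrary: thesis)
  case 0
  then show ?case using base_0 by simp
next
  case (Suc k)
  have k: "k < length vs" using Suc.prems by simp
  show ?case
  proof (cases "p < base k")
    case True
    show ?thesis
    proof (rule Suc.IH[OF _ Suc.prems(2) True _ Suc.prems(5)])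
      show "k \<le> length vs" using k by simp
      show thesis if "a \<le> i" "i < k" "d < length (rank i)" "p = base i + d" for i d
        using Suc.prems(1)[of i d] that by simp
    qed
  next
    case False
    have "a \<le> k"
    proof (rule ccontr)
      assume "\<not> a \<le> k"
      then show False using base_mono[of "Suc k" a] Suc.prems by simp
    qed
    then show ?thesis using Suc.prems(1)[of k "p - base k"] False Suc.prems rank(3)[OF k] by simp
  qed
qed

text \<open>The position lies in the segment of some vertex \<open>i\<close>, and the edge listed
  there is incident to \<open>i\<close>. Being numbered among the jobs, \<open>i\<close> is the job
  end of that edge.\<close>

lemma at_job:
  assumes "p < npj"
  shows "rk p < length es"
    "\<exists>d < length (rank (jo (rk p))). p = base (jo (rk p)) + d \<and> rank (jo (rk p)) ! d = es ! rk p"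
proof -
  obtain i d where i: "i < length js" "d < length (rank i)" "p = base i + d"
    using position[of 0 p "length js"] assms base_0 vs(3) unfolding npj_def by auto
  then have v: "i < length vs" using vs(3) by simp
  have e: "rk p < length es" "es ! rk p = rank i ! d" using rank(4)[OF v i(2)] i(3) by auto
  have "es ! rk p \<in> incident I (vs ! i)" using rank(2)[OF v] i(2) e(2) nth_mem by metis
  then have "jo (rk p) = i \<or> mo (rk p) = i" using ends_eq[OF e(1) v] unfolding incident_def by auto
  then have "jo (rk p) = i" using ends(3)[OF e(1)] i(1) by linarith
  then show "rk p < length es"
    "\<exists>d < length (rank (jo (rk p))). p = base (jo (rk p)) + d \<and> rank (jo (rk p)) ! d = es ! rk p"
    using e i by auto
qed

lemma at_machine:
  assumes "npj \<le> p" "p < np"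
  shows "rk p < length es"
    "\<exists>d < length (rank (mo (rk p))). p = base (mo (rk p)) + d \<and> rank (mo (rk p)) ! d = es ! rk p"
proof -
  obtain i d where i: "length js \<le> i" "i < length vs" "d < length (rank i)" "p = base i + d"
    using position[of "length js" p "length vs"] assms vs(3) unfolding npj_def np_def by auto
  have e: "rk p < length es" "es ! rk p = rank i ! d" using rank(4)[OF i(2,3)] i(4) by auto
  have "es ! rk p \<in> incident I (vs ! i)" using rank(2)[OF i(2)] i(3) e(2) nth_mem by metis
  then have "jo (rk p) = i \<or> mo (rk p) = i" using ends_eq[OF e(1) i(2)] unfolding incident_def by auto
  then have "mo (rk p) = i" using ends(1)[OF e(1)] i(1) by linarith
  then show "rk p < length es"
    "\<exists>d < length (rank (mo (rk p))). p = base (mo (rk p)) + d \<and> rank (mo (rk p)) ! d = es ! rk p"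
    using e i by auto
qed

lemma listed:
  assumes "e < length es" "i < length vs" "jo e = i \<or> mo e = i"
  obtains d where "d < length (rank i)" "rk (base i + d) = e" "base i + d < base (Suc i)"
proof -
  have "es ! e \<in> incident I (vs ! i)"
    using ends_eq[OF assms(1,2)] assms(1,3) es(2) nth_mem unfolding incident_def by auto
  then obtain d where d: "d < length (rank i)" "rank i ! d = es ! e"
    using rank(2)[OF assms(2)] by (metis in_set_conv_nth)
  then have "rk (base i + d) = e"
    using rank(4)[OF assms(2) d(1)] nth_eq_iff_index_eq[OF es(1)] assms(1) by auto
  then show thesis using that d(1) rank(3)[OF assms(2)] by simp
qed

lemma pj: "e < length es \<Longrightarrow> pj e < npj \<and> rk (pj e) = e"
proof -
  assume e: "e < length es"
  have v: "jo e < length vs" using ends(1)[OF e] vs(3) by simp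
  obtain d where "rk (base (jo e) + d) = e" "base (jo e) + d < base (Suc (jo e))"
    using listed[OF e v] by auto
  moreover have "base (Suc (jo e)) \<le> npj"
    unfolding npj_def using ends(1)[OF e] vs(3) by (intro base_mono) auto
  ultimately have "\<exists>p. p < npj \<and> rk p = e" by (intro exI[of _ "base (jo e) + d"]) simp
  then show ?thesis unfolding pj_def by (rule someI_ex)
qed

lemma pm: "e < length es \<Longrightarrow> npj \<le> pm e \<and> pm e < np \<and> rk (pm e) = e"
proof -
  assume e: "e < length es"
  obtain d where "rk (base (mo e) + d) = e" "base (mo e) + d < base (Suc (mo e))"
    using listed[OF e ends(4)[OF e]] by auto
  moreover have "base (Suc (mo e)) \<le> np" "npj \<le> base (mo e)"
    unfolding npj_def np_def using ends(3,4)[OF e] vs(3) by (auto intro: base_mono)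
  ultimately have "\<exists>p. npj \<le> p \<and> p < np \<and> rk p = e" by (intro exI[of _ "base (mo e) + d"]) simp
  then show ?thesis unfolding pm_def by (rule someI_ex)
qed

lemma pj_rk: "p < npj \<Longrightarrow> pj (rk p) = p"
proof -
  assume p: "p < npj"
  define e where "e = rk p"
  have e: "e < length es" using at_job(1)[OF p] unfolding e_def .
  have v: "jo e < length vs" using ends(1)[OF e] vs(3) by simp
  obtain d where d: "d < length (rank (jo e))" "p = base (jo e) + d" "rank (jo e) ! d = es ! e"
    using at_job(2)[OF p] unfolding e_def by blast
  obtain d' where d': "d' < length (rank (jo e))" "pj e = base (jo e) + d'" "rank (jo e) ! d' = es ! e"
    using at_job(2)[of "pj e"] pj[OF e] by auto
  have "d = d'" using nth_eq_iff_index_eq[OF rank(1)[OF v] d(1) d'(1)] d(3) d'(3) by simp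
  then show ?thesis using d(2) d'(2) unfolding e_def by simp
qed

lemma pm_rk: "npj \<le> p \<Longrightarrow> p < np \<Longrightarrow> pm (rk p) = p"
proof -
  assume p: "npj \<le> p" "p < np"
  define e where "e = rk p"
  have e: "e < length es" using at_machine(1)[OF p] unfolding e_def .
  note v = ends(4)[OF e]
  obtain d where d: "d < length (rank (mo e))" "p = base (mo e) + d" "rank (mo e) ! d = es ! e"
    using at_machine(2)[OF p] unfolding e_def by blast
  obtain d' where d': "d' < length (rank (mo e))" "pm e = base (mo e) + d'" "rank (mo e) ! d' = es ! e"
    using at_machine(2)[of "pm e"] pm[OF e] by auto
  have "d = d'" using nth_eq_iff_index_eq[OF rank(1)[OF v] d(1) d'(1)] d(3) d'(3) by simp
  then show ?thesis using d(2) d'(2) unfolding e_def by simp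
qed

section \<open>Preferences as comparisons of positions\<close>

lemma prefers_iff:
  assumes "i < length vs" "d < length (rank i)" "d' < length (rank i)"
  shows "prefers I (vs ! i) (rank i ! d) (rank i ! d') \<longleftrightarrow> d < d'"
proof
  assume "prefers I (vs ! i) (rank i ! d) (rank i ! d')"
  then obtain a b where "a < b" "b < length (rank i)" "rank i ! a = rank i ! d" "rank i ! b = rank i ! d'"
    unfolding prefers_def rank_def by blast
  then show "d < d'" using nth_eq_iff_index_eq[OF rank(1)[OF assms(1)]] assms(2,3) by auto
qed (use assms in \<open>auto simp: prefers_def rank_def\<close>)

lemma prefers_incident: "i < length vs \<Longrightarrow> prefers I (vs ! i) e f \<Longrightarrow> f \<in> incident I (vs ! i)"
  using rank(2)[of i] nth_mem[of _ "rank i"] unfolding prefers_def rank_def by blast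

text \<open>Within one segment, positions are ranks shifted by the constant \<open>base\<close>, so
  both compare alike.\<close>

lemma prefers_job:
  assumes e: "e < length es" and f: "f < length es"
  shows "prefers I (fst (es ! e)) (es ! e) (es ! f) \<longleftrightarrow> jo f = jo e \<and> pj e < pj f"
proof -
  have v: "jo e < length vs" using ends(1)[OF e] vs(3) by simp
  obtain d where d: "d < length (rank (jo e))" "pj e = base (jo e) + d" "rank (jo e) ! d = es ! e"
    using at_job(2)[of "pj e"] pj[OF e] by auto
  have "jo f = jo e" if "prefers I (vs ! jo e) (es ! e) (es ! f)"
    using prefers_incident[OF v that] ends_eq[OF f v] ends(3)[OF f] ends(1)[OF e] unfolding incident_def by auto
  moreover have "prefers I (vs ! jo e) (es ! e) (es ! f) \<longleftrightarrow> pj e < pj f" if eq: "jo f = jo e"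
  proof -
    obtain d' where d': "d' < length (rank (jo e))" "pj f = base (jo e) + d'" "rank (jo e) ! d' = es ! f"
      using at_job(2)[of "pj f"] pj[OF f] eq by auto
    show ?thesis using prefers_iff[OF v d(1) d'(1)] d d' by simp
  qed
  ultimately show ?thesis using ends(2)[OF e] by auto
qed

lemma prefers_machine:
  assumes e: "e < length es" and f: "f < length es"
  shows "prefers I (snd (es ! e)) (es ! e) (es ! f) \<longleftrightarrow> mo f = mo e \<and> pm e < pm f"
proof -
  note v = ends(4)[OF e]
  obtain d where d: "d < length (rank (mo e))" "pm e = base (mo e) + d" "rank (mo e) ! d = es ! e"
    using at_machine(2)[of "pm e"] pm[OF e] by auto
  have "mo f = mo e" if "prefers I (vs ! mo e) (es ! e) (es ! f)"
    using prefers_incident[OF v that] ends_eq[OF f v] ends(3)[OF e] ends(1)[OF f] unfolding incident_def by auto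
  moreover have "prefers I (vs ! mo e) (es ! e) (es ! f) \<longleftrightarrow> pm e < pm f" if eq: "mo f = mo e"
  proof -
    obtain d' where d': "d' < length (rank (mo e))" "pm f = base (mo e) + d'" "rank (mo e) ! d' = es ! f"
      using at_machine(2)[of "pm f"] pm[OF f] eq by auto
    show ?thesis using prefers_iff[OF v d(1) d'(1)] d d' by simp
  qed
  ultimately show ?thesis using ends(5)[OF e] by auto
qed

sublocale market "length es" jo mo pj pm "rmem s Quota" "rmem s Capacity"
proof
  fix k l assume k: "k < length es" and l: "l < length es"
  show "jo k \<noteq> mo l" using ends(1)[OF k] ends(3)[OF l] by simp
  show "k = l" if "jo k = jo l" "mo k = mo l"
    using that ends(2,5)[OF k] ends(2,5)[OF l] nth_eq_iff_index_eq[OF es(1) k l] by (simp add: prod_eq_iff)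
  show "k = l" if "pj k = pj l" using that pj[OF k] pj[OF l] by metis
  show "k = l" if "pm k = pm l" using that pm[OF k] pm[OF l] by metis
qed

section \<open>Allocations and the arrays representing them\<close>

lemma edges_conv: "(\<forall>f \<in> edges I. Q f) \<longleftrightarrow> (\<forall>k < length es. Q (es ! k))"
  unfolding es(2)[symmetric] set_conv_nth by blast

lemma vertices_conv: "(\<forall>v \<in> vertices I. Q v) \<longleftrightarrow> (\<forall>i < length vs. Q (vs ! i))"
  unfolding vs(2)[symmetric] set_conv_nth by blast

lemma quota: "i < length vs \<Longrightarrow> rmem s Quota i = quota I (vs ! i)"
  and capacity: "k < length es \<Longrightarrow> rmem s Capacity k = capacity I (es ! k)"
  using enc unfolding encodes_def vs_def represents_def by auto

lemma load_eq:
  assumes a: "represents es a x" and i: "i < length vs"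
  shows "load I x (vs ! i) = L a i"
proof -
  have "load I x (vs ! i) = (\<Sum>e\<in>edges I. if fst e = vs ! i \<or> snd e = vs ! i then x e else 0)"
    unfolding load_def incident_def by (rule sum.inter_filter) (simp flip: es(2))
  also have "\<dots> = (\<Sum>k<length es. if fst (es ! k) = vs ! i \<or> snd (es ! k) = vs ! i then x (es ! k) else 0)"
    using bij_betw_nth[OF es(1) refl es(2)[symmetric]] by (rule sum.reindex_bij_betw[symmetric])
  also have "\<dots> = L a i"
    unfolding L_def using ends_eq[OF _ i] a unfolding represents_def by (intro sum.cong) auto
  finally show ?thesis .
qed

lemma feasible_iff:
  assumes a: "represents es a x"
  shows "feasible I x \<longleftrightarrow> feas a"
proof
  have v: "jo k < length vs" "mo k < length vs" if "k < length es" for k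
    using ends[OF that] vs(3) by auto
  show "feas a" if "feasible I x"
    unfolding feas_def
  proof (intro allI impI)
    fix k assume k: "k < length es"
    have "0 \<le> x (es ! k) \<and> x (es ! k) \<le> capacity I (es ! k)"
      using that k unfolding feasible_def edges_conv by blast
    moreover have "load I x (vs ! i) \<le> quota I (vs ! i)" if "i < length vs" for i
      using \<open>feasible I x\<close> that unfolding feasible_def vertices_conv by blast
    ultimately show "0 \<le> a k \<and> a k \<le> rmem s Capacity k \<and> L a (jo k) \<le> rmem s Quota (jo k) \<and>
        L a (mo k) \<le> rmem s Quota (mo k)"
      using v[OF k] load_eq[OF a] quota capacity[OF k] a k unfolding represents_def by simp
  qed
  assume f: "feas a"
  show "feasible I x"
    unfolding feasible_def edges_conv vertices_conv
  proof (intro conjI allI impI)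
    fix k assume "k < length es"
    then show "0 \<le> x (es ! k)" "x (es ! k) \<le> capacity I (es ! k)"
      using f a capacity unfolding feas_def represents_def by auto
  next
    fix i assume i: "i < length vs"
    show "load I x (vs ! i) \<le> quota I (vs ! i)"
    proof (cases "\<exists>k < length es. jo k = i \<or> mo k = i")
      case True
      then show ?thesis using f unfolding load_eq[OF a i] quota[OF i, symmetric] feas_def by metis
    next
      case False
      \<comment> \<open>\<open>feas\<close> inspects only vertices with edges; an isolated vertex
        has load 0 and a nonnegative quota.\<close>
      then have "L a i = 0" unfolding L_def by (intro sum.neutral) auto
      moreover have "0 \<le> quota I (vs ! i)"
        using valid i vs(2) nth_mem unfolding valid_instance_def by metis
      ultimately show ?thesis unfolding load_eq[OF a i] by simp
    qed
  qed
qed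

lemma blocks_iff:
  assumes a: "represents es a x" and e: "e < length es"
  shows "blocks I x (es ! e) \<longleftrightarrow> blk a e"
proof -
  have v: "jo e < length vs" "mo e < length vs" using ends[OF e] vs(3) by auto
  have V: "vs ! jo e \<in> vertices I" "vs ! mo e \<in> vertices I" using v vs(2) nth_mem by metis+
  \<comment> \<open>Whatever \<open>prefers\<close> compares stands in a ranking and is an edge of
    the instance, so edge numbers capture all witnesses.\<close>
  have in_es: "\<exists>k < length es. es ! k = f" if "i < length vs" "prefers I (vs ! i) g f" for i f g
    using prefers_incident[OF that] es(2) unfolding incident_def by (metis (no_types, lifting) in_set_conv_nth mem_Collect_eq)
  have j: "(\<exists>f. 0 < x f \<and> prefers I (fst (es ! e)) (es ! e) f) \<longleftrightarrow>
      (\<exists>k<length es. jo k = jo e \<and> 0 < a k \<and> pj e < pj k)"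
    using prefers_job[OF e] in_es[OF v(1), unfolded ends(2)[OF e]] a unfolding represents_def by metis
  have m: "(\<exists>f. 0 < x f \<and> prefers I (snd (es ! e)) (es ! e) f) \<longleftrightarrow>
      (\<exists>k<length es. mo k = mo e \<and> 0 < a k \<and> pm e < pm k)"
    using prefers_machine[OF e] in_es[OF v(2), unfolded ends(5)[OF e]] a unfolding represents_def by metis
  have "es ! e \<in> edges I" using e es(2) nth_mem by metis
  then show ?thesis
    using load_eq[OF a v(1)] load_eq[OF a v(2)] quota[OF v(1)] quota[OF v(2)] capacity[OF e] a e
      prefers_positive_iff[OF valid V(1), unfolded ends(2)[OF e]]
      prefers_positive_iff[OF valid V(2), unfolded ends(5)[OF e]] j m
    unfolding blocks_def blk_def acc_def not_rej represents_def ends(2)[OF e] ends(5)[OF e] by auto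
qed

lemma better_response_if_br:
  assumes a: "represents es a x" and b: "represents es b y" and br: "br e a b"
  shows "e < length es" "better_response I (es ! e) x y"
proof -
  show e: "e < length es" using br unfolding br_def blk_def acc_def by simp
  have "es ! k = es ! e \<longleftrightarrow> k = e" if "k < length es" for k
    using nth_eq_iff_index_eq[OF es(1) that e] .
  then show "better_response I (es ! e) x y"
    using br a b e feasible_iff[OF b] blocks_iff[OF a e] prefers_job[OF e] prefers_machine[OF e]
    unfolding better_response_def edges_conv br_def represents_def by auto
qed

section \<open>Decoding the log of the program\<close>

definition decode :: "(nat \<Rightarrow> real) \<Rightarrow> 'v allocation" where
  "decode a = (\<lambda>f. a (SOME k. k < length es \<and> es ! k = f))"

lemma represents_decode: "represents es a (decode a)"
  unfolding represents_def
proof (intro allI impI)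
  fix k assume k: "k < length es"
  have "(SOME k'. k' < length es \<and> es ! k' = es ! k) = k"
    by (rule some_equality) (use k nth_eq_iff_index_eq[OF es(1)] in auto)
  then show "a k = decode a (es ! k)" unfolding decode_def by simp
qed

lemma trace_decode:
  assumes "trace a l b" "represents es a x"
  defines "p \<equiv> map (\<lambda>(k, a). (es ! k, decode a)) l"
  shows "better_response_seq I x p \<and> records_seq es l p \<and> represents es b (final_allocation x p)"
  using assms(1,2) unfolding p_def
proof (induction l arbitrary: a x)
  case (Cons kz l)
  obtain k z where kz: "kz = (k, z)" by fastforce
  have "br k a z" "trace z l b" using Cons.prems(1) unfolding kz by auto
  then show ?case
    using Cons.IH[OF _ represents_decode, of z] represents_decode[of z]
      better_response_if_br[OF Cons.prems(2) represents_decode, of k z]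
    unfolding kz records_seq_def final_allocation_def by simp
qed (simp add: records_seq_def final_allocation_def)

lemma runs_stabilize:
  assumes feasible: "feasible I x0"
  shows "\<exists>t s' p. runs stabilize s t s' \<and>
     t \<le> 2000 * max 1 ((card (vertices I))\<^sup>2 * card (edges I)) \<and>
     better_response_seq I x0 p \<and> stable_allocation I (final_allocation x0 p) \<and>
     records_seq es (step_log s') p \<and> represents es (rmem s' Alloc) (final_allocation x0 p)"
proof (cases "length es = 0")
  case True
  have "runs stabilize s (1 + 1) s"
    unfolding stabilize_def using enc True by (intro runs.IfFalse runs.Skip) (simp add: encodes_def)
  \<comment> \<open>Without edges every feasible allocation is stable, and the empty sequence
    matches the empty log.\<close>
  moreover have "edges I = {}" using True es(2) by auto
  then have "stable_allocation I x0" using feasible unfolding stable_allocation_def by simp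
  ultimately show ?thesis
    using True enc by (intro exI[of _ "1 + 1"] exI[of _ s] exI[of _ "[]"])
      (auto simp: final_allocation_def records_seq_def encodes_def represents_def)
next
  case False
  have vle: "jo k < length js + length ms" "mo k < length js + length ms" if "k < length es" for k
    using ends[OF that] vs(3) by auto
  have np: "npj \<le> np" unfolding npj_def np_def using vs(3) by (intro base_mono) auto
  \<comment> \<open>Each half of \<open>Ranked\<close> lists an edge at most once, so its length is
    bounded by the number of edges.\<close>
  have "card {..<npj} \<le> card {..<length es}"
    by (rule card_inj_on_le[of rk]) (use pj_rk at_job(1) in \<open>auto intro!: inj_on_inverseI[of _ pj]\<close>)
  moreover have "card {npj..<np} \<le> card {..<length es}"
    by (rule card_inj_on_le[of rk]) (use pm_rk at_machine(1) in \<open>auto intro!: inj_on_inverseI[of _ pm]\<close>)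
  ultimately have np2: "np \<le> 2 * length es" by simp
  have fin: "finite (vertices I)" "finite (jobs I)" "finite (machines I)"
    and sub: "edges I \<subseteq> jobs I \<times> machines I"
    using valid unfolding valid_instance_def vertices_def by auto
  have "card (edges I) \<le> card (jobs I \<times> machines I)" using fin sub by (intro card_mono) auto
  also have "\<dots> \<le> card (vertices I) * card (vertices I)"
    unfolding card_cartesian_product vertices_def using fin by (intro mult_mono card_mono) auto
  finally have nE2: "length es \<le> (length js + length ms)\<^sup>2"
    using vs(3,4) es(3) by (simp add: power2_eq_square)
  interpret indexed "length es" jo mo pj pm "rmem s Quota" "rmem s Capacity" "length js" "length ms"
    np npj rk "length js + length ms"
  proof (unfold_locales, goal_cases)
    case (1 e) then show ?case by (rule ends(1))
  next
    case (3 p)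
    then show ?case using at_job(1)[of p] at_machine(1)[of p] by (cases "p < npj") auto
  qed (use vle np np2 nE2 False pj pm pj_rk pm_rk in auto)
  have a: "represents es (rmem s Alloc) x0" using enc unfolding encodes_def by simp
  have "holds (rmem s Alloc) [] s"
    unfolding holds_def
    using enc vs(3) unfolding encodes_def jo_def mo_def rk_def npj_def np_def base_def by simp
  then obtain t s' b l where r: "runs stabilize s t s'" "t \<le> 2000 * ((length js + length ms)\<^sup>2 * length es)"
      "holds b l s'" "trace (rmem s Alloc) l b" "feas b" "stable b"
    using wp_stabilize feasible feasible_iff[OF a] unfolding wp_def by blast
  define p where "p = map (\<lambda>(k, a). (es ! k, decode a)) l"
  have p: "better_response_seq I x0 p" "records_seq es l p" "represents es b (final_allocation x0 p)"
    using trace_decode[OF r(4) a] unfolding p_def by auto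
  have "stable_allocation I (final_allocation x0 p)"
    unfolding stable_allocation_def edges_conv
    using feasible_iff[OF p(3)] blocks_iff[OF p(3)] r(5,6) unfolding stable_def by auto
  moreover have "step_log s' = l" "rmem s' Alloc = b" using r(3) unfolding holds_def by auto
  ultimately show ?thesis
    using r(1,2) p vs(3,4) es(3) by (intro exI[of _ t] exI[of _ s'] exI[of _ p]) auto
qed

end

text \<open>The pure existence of a better response sequence is obtained by running the program,
  which presupposes some encoding.\<close>

lemma encoding_exists:
  assumes "valid_instance I"
  shows "\<exists>js ms es s. encodes I x js ms es s"
proof -
  have fin: "finite (jobs I)" "finite (machines I)" "finite (edges I)"
    and sub: "edges I \<subseteq> jobs I \<times> machines I"
    using assms finite_subset[of "edges I" "jobs I \<times> machines I"] unfolding valid_instance_def by auto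
  obtain js ms es where lists: "distinct js" "set js = jobs I" "distinct ms" "set ms = machines I"
      "distinct es" "set es = edges I"
    using fin[THEN finite_distinct_list] by blast
  define vs where "vs = js @ ms"
  define index where "index = (\<lambda>(xs :: 'a list) y. SOME i. i < length xs \<and> xs ! i = y)"
  define index_e where "index_e = (\<lambda>y. SOME i. i < length es \<and> es ! i = y)"
  have index: "index xs y < length xs \<and> xs ! index xs y = y" if "y \<in> set xs" for xs y
    using that unfolding index_def in_set_conv_nth by (rule someI_ex)
  have index_e: "index_e y < length es \<and> es ! index_e y = y" if "y \<in> set es" for y
    using that unfolding index_e_def in_set_conv_nth by (rule someI_ex)
  \<comment> \<open>Prefix sums of the ranking lengths: they delimit the segments when
    \<open>Ranked\<close> is the concatenation of all rankings.\<close>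
  define f where "f = (\<lambda>i. \<Sum>k<i. length (map (ranking I) vs ! k))"
  define im where "im = (\<lambda>_ _. 0)(NJobs := \<lambda>_. length js, NMachines := \<lambda>_. length ms, NEdges := \<lambda>_. length es,
    JobOf := \<lambda>k. index vs (fst (es ! k)), MachineOf := \<lambda>k. index vs (snd (es ! k)), First := f,
    Ranked := \<lambda>p. index_e (concat (map (ranking I) vs) ! p))"
  define rm where "rm = (\<lambda>_ _. 0)(Quota := \<lambda>i. quota I (vs ! i), Capacity := \<lambda>k. capacity I (es ! k),
    Alloc := \<lambda>k. x (es ! k))"
  have "encodes I x js ms es \<lparr>imem = im, rmem = rm, step_log = []\<rparr>"
    unfolding encodes_def represents_def vs_def[symmetric]
  proof (intro conjI allI impI; (simp add: im_def rm_def lists f_def; fail)?)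
    fix k assume "k < length es"
    then have "es ! k \<in> jobs I \<times> machines I" using lists(6) sub nth_mem by blast
    then have "fst (es ! k) \<in> set vs" "snd (es ! k) \<in> set vs" unfolding vs_def using lists by auto
    note index[OF this(1)] index[OF this(2)]
    then show "imem \<lparr>imem = im, rmem = rm, step_log = []\<rparr> JobOf k < length vs"
      "vs ! imem \<lparr>imem = im, rmem = rm, step_log = []\<rparr> JobOf k = fst (es ! k)"
      "imem \<lparr>imem = im, rmem = rm, step_log = []\<rparr> MachineOf k < length vs"
      "vs ! imem \<lparr>imem = im, rmem = rm, step_log = []\<rparr> MachineOf k = snd (es ! k)"
      unfolding im_def by auto
  next
    fix i d assume i: "i < length vs" and d: "d < length (ranking I (vs ! i))"
    have "concat (map (ranking I) vs) ! (f i + d) = ranking I (vs ! i) ! d"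
      using concat_nth[of i "map (ranking I) vs" d] i d unfolding f_def by simp
    moreover have "ranking I (vs ! i) ! d \<in> set es"
    proof -
      have "vs ! i \<in> vertices I" using i lists nth_mem[of i vs] unfolding vs_def vertices_def by auto
      then have "set (ranking I (vs ! i)) = incident I (vs ! i)"
        using assms unfolding valid_instance_def by blast
      then show ?thesis using d nth_mem lists(6) unfolding incident_def by fastforce
    qed
    note index_e[OF this]
    ultimately show "imem \<lparr>imem = im, rmem = rm, step_log = []\<rparr> Ranked
          (imem \<lparr>imem = im, rmem = rm, step_log = []\<rparr> First i + d) < length es"
      "es ! imem \<lparr>imem = im, rmem = rm, step_log = []\<rparr> Ranked
          (imem \<lparr>imem = im, rmem = rm, step_log = []\<rparr> First i + d) = ranking I (vs ! i) ! d"
      unfolding im_def by auto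
  qed
  then show ?thesis by blast
qed

theorem theorem6:
  shows "(\<forall>(I :: 'v alloc_instance) x. valid_instance I \<and> feasible I x \<longrightarrow>
            (\<exists>p. better_response_seq I x p \<and> stable_allocation I (final_allocation x p))) \<and>
         (\<exists>(P :: com) (C :: nat). \<forall>(I :: 'v alloc_instance) x js ms es s.
            valid_instance I \<and> feasible I x \<and> encodes I x js ms es s \<longrightarrow>
            (\<exists>t s' p. runs P s t s' \<and>
               t \<le> C * max 1 ((card (vertices I))\<^sup>2 * card (edges I)) \<and>
               better_response_seq I x p \<and> stable_allocation I (final_allocation x p) \<and>
               records_seq es (step_log s') p \<and>
               represents es (rmem s' Alloc) (final_allocation x p)))"
proof
  show "\<forall>(I :: 'v alloc_instance) x. valid_instance I \<and> feasible I x \<longrightarrow>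
      (\<exists>p. better_response_seq I x p \<and> stable_allocation I (final_allocation x p))"
  proof (intro allI impI)
    fix I :: "'v alloc_instance" and x
    assume I: "valid_instance I \<and> feasible I x"
    then obtain js ms es s where "encodes I x js ms es s" using encoding_exists by blast
    then interpret encoding I x js ms es s using I by unfold_locales auto
    show "\<exists>p. better_response_seq I x p \<and> stable_allocation I (final_allocation x p)"
      using runs_stabilize I by blast
  qed
next
  show "\<exists>(P :: com) (C :: nat). \<forall>(I :: 'v alloc_instance) x js ms es s.
      valid_instance I \<and> feasible I x \<and> encodes I x js ms es s \<longrightarrow>
      (\<exists>t s' p. runs P s t s' \<and>
         t \<le> C * max 1 ((card (vertices I))\<^sup>2 * card (edges I)) \<and>
         better_response_seq I x p \<and> stable_allocation I (final_allocation x p) \<and>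
         records_seq es (step_log s') p \<and>
         represents es (rmem s' Alloc) (final_allocation x p))"
    by (rule exI[of _ stabilize], rule exI[of _ 2000], intro allI impI)
      (blast intro: encoding.runs_stabilize encoding.intro)
qed

end
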